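(* Let $(X_t)_{t\ge0}$ be a Markov process on a state space $E'$, with laws $(\mathbb{Q}_x)_{x\in E'}$, and assume that it admits an invariant probability measure $\beta$ and that there exist a function $\psi:E'\to[c,+\infty)$ (with $c>0$) and two constants $C,\gamma>0$ such that, for all $x\in E'$ and $t\ge0$, $$\|\mathbb{Q}_x(X_t\in\cdot)-\beta\|_\psi\le C e^{-\gamma t}\psi(x).$$ For bounded measurable $f$ set $\sigma_f^2:=2\int_0^\infty\mathbf{Cov}^{\mathbb{Q}}_\beta(f(X_0),f(X_s))\,ds$. Then there exist a positive constant $C_1$ and a sequence of positive constants $(D_k)_{k\in\mathbb{N}}$ ($\mathbb{N}=\{1,2,\dots\}$) such that: (i) for all $k\in\mathbb{N}$, all $\mu\in\mathcal{M}_1(E')$ with $\mu(\psi)<+\infty$, all $f\in\mathcal{B}_1(E')$ with $\beta(f)=0$ and all $t>0$, $$\left|\mathbb{E}^{\mathbb{Q}}_\mu\left(\frac1{t^k}\left(\int_0^tf(X_s)ds\right)^{2k}\right)-\frac{(2k)!}{k!}\frac{\sigma_f^{2k}}{2^k}\right|\le(2k)!\,D_k\,C_1\,\frac{k}{(k-1)!}\,\frac{\mu(\psi)}{t};$$ (ii) for all integers $k\ge0$, all $\mu\in\mathcal{M}_1(E')$ with $\mu(\psi)<+\infty$ and all $f\in\mathcal{B}_1(E')$ with $\beta(f)=0$, $$\lim_{t\to\infty}\mathbb{E}^{\mathbb{Q}}_\mu\left(\frac1{t^k\sqrt t}\left(\int_0^tf(X_s)ds\right)^{2k+1}\right)=0.$$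 In particular, for all $\mu\in\mathcal{M}_1(E')$ with $\mu(\psi)<+\infty$ and all $f\in\mathcal{B}_1(E')$ with $\beta(f)=0$ and $\sigma_f^2>0$, the law $\mathbb{Q}_\mu\left(\frac1{\sqrt t}\int_0^tf(X_s)ds\in\cdot\right)$ converges weakly, as $t\to\infty$, to the centered Gaussian law $\mathcal{N}(0,\sigma_f^2)$. Moreover, a suitable sequence $(D_k)_{k\in\mathbb{N}}$ satisfying the inequalities in (i) is $$D_k:=\left(\left(\frac C\gamma\Big(1+\frac{\beta(\psi)}c\Big)\right)^{k-1}\vee1\right)\times\left(\frac{C^2}c\vee\frac{C\beta(\psi)}{c^2\gamma}\right),\qquad k\in\mathbb{N}.$$
   Context: $(X_t)_{t\ge0}$ is a general time-homogeneous continuous-time Markov process on a state space $E'$, with $\mathbb{Q}_x(X_0=x)=1$ for $x\in E'$, and $\mathbb{Q}_\mu:=\int_{E'}\mathbb{Q}_x\,\mu(dx)$ for $\mu\in\mathcal{M}_1(E')$, the set of probability measures on $E'$. $\mathbb{E}^{\mathbb{Q}}_\mu$ and $\mathbf{Cov}^{\mathbb{Q}}_\mu$ are the expectation and covariance under $\mathbb{Q}_\mu$. $E'$ and the sample paths are equipped with appropriate $\sigma$-fields so that $\int_0^tf(X_s)ds$ makes sense for bounded measurable $f$ (e.g. joint measurability of $(s,\omega)\mapsto X_s(\omega)$). $\mathcal{B}_1(E')$ is the set of measurable real functions on $E'$ bounded by $1$ in absolute value. $\mu(f):=\int f\,d\mu$. For positive $\psi$, $\mathbb{L}^\infty(\psi)$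 is the set of measurable $f$ with $f/\psi$ bounded, $\|f\|_{\mathbb{L}^\infty(\psi)}:=\|f/\psi\|_\infty$, and $\|\mu-\nu\|_\psi:=\sup_{\|f\|_{\mathbb{L}^\infty(\psi)}\le1}|\mu(f)-\nu(f)|$. $a\vee b:=\max(a,b)$. *)

theory Defs
  imports "HOL-Probability.Probability"
begin

definition past :: "'e measure \<Rightarrow> 'w measure \<Rightarrow> (real \<Rightarrow> 'w \<Rightarrow> 'e) \<Rightarrow> real \<Rightarrow> 'w measure" where
  "past E M X s = sigma (space M) {X r -` A \<inter> space M |r A. 0 \<le> r \<and> r \<le> s \<and> A \<in> sets E}"

text \<open>
  The state space is the measurable space \<open>E\<close>, the sample space is the measurable space \<open>M\<close>
  (only its sigma-algebra matters), and times range over the nonnegative reals. The Markov property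
  is required for the natural filtration; a Markov process for a larger filtration has it as well.
\<close>

locale markov_process =
  fixes E :: "'e measure" and M :: "'w measure"
    and X :: "real \<Rightarrow> 'w \<Rightarrow> 'e" and Q :: "'e \<Rightarrow> 'w measure"
  assumes kernel: "Q \<in> E \<rightarrow>\<^sub>M prob_algebra M"
    and jointly_measurable: "(\<lambda>(s, \<omega>). X s \<omega>) \<in> restrict_space borel {0..} \<Otimes>\<^sub>M M \<rightarrow>\<^sub>M E"
    and starts_at: "\<And>x. x \<in> space E \<Longrightarrow> AE \<omega> in Q x. X 0 \<omega> = x"
    and markov: "\<And>x s t A. x \<in> space E \<Longrightarrow> 0 \<le> s \<Longrightarrow> 0 \<le> t \<Longrightarrow> A \<in> sets E \<Longrightarrow>
        AE \<omega> in Q x. real_cond_exp (Q x) (past E M X s) (\<lambda>\<omega>'. indicator A (X (s + t) \<omega>')) \<omega>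
          = measure (Q (X s \<omega>)) {\<omega>' \<in> space M. X t \<omega>' \<in> A}"

text \<open>\<open>\<beta> \<bind> Q\<close> is the law of the process with initial distribution \<open>\<beta>\<close>.\<close>

definition invariant_prob ::
  "'e measure \<Rightarrow> (real \<Rightarrow> 'w \<Rightarrow> 'e) \<Rightarrow> ('e \<Rightarrow> 'w measure) \<Rightarrow> 'e measure \<Rightarrow> bool" where
  "invariant_prob E X Q \<beta> \<longleftrightarrow>
     \<beta> \<in> space (prob_algebra E) \<and> (\<forall>t\<ge>0. distr (\<beta> \<bind> Q) E (X t) = \<beta>)"

definition Linf_norm :: "'e measure \<Rightarrow> ('e \<Rightarrow> real) \<Rightarrow> ('e \<Rightarrow> real) \<Rightarrow> ennreal" where
  "Linf_norm E \<psi> f = (SUP x\<in>space E. ennreal \<bar>f x / \<psi> x\<bar>)"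

text \<open>
  The Bochner integral of a non-integrable function is 0. This is harmless if \<open>\<psi>\<close> is integrable
  under one of the two measures: testing with the truncations \<open>min \<psi> n\<close> then shows that a finite
  distance makes \<open>\<psi>\<close>, and so every test function, integrable under the other one as well.
\<close>

definition weighted_dist :: "'e measure \<Rightarrow> ('e \<Rightarrow> real) \<Rightarrow> 'e measure \<Rightarrow> 'e measure \<Rightarrow> ennreal" where
  "weighted_dist E \<psi> \<mu> \<nu> =
     (SUP f\<in>{f \<in> borel_measurable E. Linf_norm E \<psi> f \<le> 1}.
        ennreal \<bar>(\<integral>x. f x \<partial>\<mu>) - (\<integral>x. f x \<partial>\<nu>)\<bar>)"

definition unit_bounded :: "'e measure \<Rightarrow> ('e \<Rightarrow> real) set" where
  "unit_bounded E = {f \<in> borel_measurable E. \<forall>x\<in>space E. \<bar>f x\<bar> \<le> 1}"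

definition time_integral :: "(real \<Rightarrow> 'w \<Rightarrow> 'e) \<Rightarrow> ('e \<Rightarrow> real) \<Rightarrow> real \<Rightarrow> 'w \<Rightarrow> real" where
  "time_integral X f t \<omega> = (LINT s:{0..t}|lborel. f (X s \<omega>))"

definition covariance :: "'w measure \<Rightarrow> ('w \<Rightarrow> real) \<Rightarrow> ('w \<Rightarrow> real) \<Rightarrow> real" where
  "covariance P U V = (\<integral>\<omega>. (U \<omega> - (\<integral>\<omega>'. U \<omega>' \<partial>P)) * (V \<omega> - (\<integral>\<omega>'. V \<omega>' \<partial>P)) \<partial>P)"

definition asymptotic_variance ::
  "(real \<Rightarrow> 'w \<Rightarrow> 'e) \<Rightarrow> ('e \<Rightarrow> 'w measure) \<Rightarrow> 'e measure \<Rightarrow> ('e \<Rightarrow> real) \<Rightarrow> real" where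
  "asymptotic_variance X Q \<beta> f =
     2 * (LINT s:{0..}|lborel. covariance (\<beta> \<bind> Q) (\<lambda>\<omega>. f (X 0 \<omega>)) (\<lambda>\<omega>. f (X s \<omega>)))"

text \<open>
  The library's \<^const>\<open>weak_conv_m\<close> covers sequences only; here the index runs along an
  arbitrary filter. The two lemmas below compare the notions.
\<close>

definition weak_conv_along :: "'i filter \<Rightarrow> ('i \<Rightarrow> real measure) \<Rightarrow> real measure \<Rightarrow> bool" where
  "weak_conv_along F \<mu> \<nu> \<longleftrightarrow>
     (\<forall>g::real \<Rightarrow> real. continuous_on UNIV g \<longrightarrow> bounded (range g) \<longrightarrow>
        ((\<lambda>i. \<integral>x. g x \<partial>\<mu> i) \<longlongrightarrow> (\<integral>x. g x \<partial>\<nu>)) F)"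

lemma weak_conv_along_sequentially_iff:
  assumes "\<And>n. real_distribution (\<mu> n)" "real_distribution \<nu>"
  shows "weak_conv_along sequentially \<mu> \<nu> \<longleftrightarrow> weak_conv_m \<mu> \<nu>"
proof
  assume conv: "weak_conv_along sequentially \<mu> \<nu>"
  show "weak_conv_m \<mu> \<nu>"
  proof (rule integral_bdd_continuous_conv_imp_weak_conv[OF assms])
    fix g :: "real \<Rightarrow> real"
    assume "\<And>x. isCont g x" and bd: "\<And>x. \<bar>g x\<bar> \<le> 1"
    then have "continuous_on UNIV g"
      by (simp add: continuous_at_imp_continuous_on)
    moreover have "bounded (range g)"
      using bd by (auto simp: bounded_iff)
    ultimately show "(\<lambda>n. integral\<^sup>L (\<mu> n) g) \<longlonglongrightarrow> integral\<^sup>L \<nu> g"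
      using conv by (simp add: weak_conv_along_def)
  qed
next
  assume conv: "weak_conv_m \<mu> \<nu>"
  show "weak_conv_along sequentially \<mu> \<nu>"
    unfolding weak_conv_along_def
  proof (intro allI impI)
    fix g :: "real \<Rightarrow> real"
    assume g: "continuous_on UNIV g" "bounded (range g)"
    obtain B where "\<And>x. norm (g x) \<le> B"
      using g(2) by (auto simp: bounded_iff)
    moreover have "\<And>x. isCont g x"
      using g(1) by (simp add: continuous_on_eq_continuous_at)
    ultimately show "(\<lambda>n. \<integral>x. g x \<partial>\<mu> n) \<longlonglongrightarrow> (\<integral>x. g x \<partial>\<nu>)"
      by (intro weak_conv_imp_integral_bdd_continuous_conv[OF assms conv])
  qed
qed

lemma weak_conv_along_at_top_iff:
  fixes \<mu> :: "real \<Rightarrow> real measure"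
  assumes "\<And>t. real_distribution (\<mu> t)" "real_distribution \<nu>"
  shows "weak_conv_along at_top \<mu> \<nu> \<longleftrightarrow>
    (\<forall>T. filterlim T at_top sequentially \<longrightarrow> weak_conv_m (\<lambda>n. \<mu> (T n)) \<nu>)"
proof -
  have seq: "(h \<longlongrightarrow> l) at_top \<longleftrightarrow>
      (\<forall>T. filterlim T at_top sequentially \<longrightarrow> (\<lambda>n. h (T n)) \<longlonglongrightarrow> l)"
    for h :: "real \<Rightarrow> real" and l :: real
    by (metis filterlim_compose tendsto_at_topI_sequentially)
  have "weak_conv_along at_top \<mu> \<nu> \<longleftrightarrow>
      (\<forall>T. filterlim T at_top sequentially \<longrightarrow> weak_conv_along sequentially (\<lambda>n. \<mu> (T n)) \<nu>)"
    unfolding weak_conv_along_def seq by blast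
  then show ?thesis
    using assms by (simp add: weak_conv_along_sequentially_iff)
qed

end

theory Submission
  imports Defs
begin

text \<open>
  Write \<open>A t\<close> for the time integral of \<open>f\<close> up to time \<open>t\<close>, and \<open>m\<^sub>n(t, x)\<close> for its \<open>n\<close>-th moment under
  the start in \<open>x\<close>, divided by \<open>n!\<close>. Ordering the \<open>n\<close> times and conditioning on the first of them gives
  the recursion \<open>m\<^sub>n\<^sub>+\<^sub>1(t, \<cdot>) = \<integral>\<^sub>0\<^sup>t P\<^sub>u(f m\<^sub>n(t - u, \<cdot>)) du\<close> with the transition operators \<open>P\<^sub>u\<close>
  (\<open>moment_Suc\<close>). All estimates are read off from it.

  Split \<open>m\<^sub>n(t, x)\<close> into its mean \<open>b\<^sub>n(t)\<close> under the invariant law \<open>\<beta>\<close> and a centred part \<open>r\<^sub>n(t, x)\<close>. By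
  invariance and \<open>\<beta>(f) = 0\<close>, the derivative of \<open>b\<^sub>n\<^sub>+\<^sub>1\<close> is \<open>\<beta>(f r\<^sub>n)\<close> (\<open>mean_Suc\<close>), while \<open>r\<^sub>n\<^sub>+\<^sub>1\<close> is an
  integral over deviations from equilibrium of \<open>b\<^sub>n f + f r\<^sub>n\<close> (\<open>centred_Suc\<close>), which decay exponentially
  in the norm weighted by \<open>\<psi>\<close>. So passing to a centred part costs a constant, passing to a mean gains one
  power of \<open>t\<close>, and \<open>m\<^sub>n\<close> grows like a polynomial of degree \<open>n div 2\<close> (\<open>mean_centred_bound\<close>). For odd
  \<open>n = 2 k + 1\<close> this is half a power of \<open>t\<close> below the normalisation, whence the limit 0.

  For even \<open>n = 2 k\<close> two steps of the recursion read
  \<open>b\<^sub>2\<^sub>k' = \<kappa> * b\<^sub>2\<^sub>k\<^sub>-\<^sub>2 + lower order\<close>, a convolution with the stationary correlation \<open>\<kappa>\<close> of \<open>f\<close>, whose total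
  mass is half the asymptotic variance. Since \<open>\<kappa>\<close> decays exponentially, replacing it by a point mass at 0
  costs one power of \<open>t\<close>, and the leading term is the \<open>k\<close>-fold time integral of the constant
  \<open>(\<sigma>\<^sub>f\<^sup>2 / 2)\<^sup>k\<close> (\<open>even_mean_error\<close>). Every error is kept as a multiple of a partial sum of \<open>exp (t / a)\<close>
  with one fixed time scale \<open>a = max 1 (C / \<gamma> (1 + \<beta>(\<psi>) / c))\<close>. Passing from \<open>k\<close> to \<open>k + 1\<close> raises the
  degree of these sums by one and multiplies the bounds by \<open>a\<^sup>2\<close> and by no further constant, which yields
  the stated growth in \<open>k\<close>. The partial sums are comparable with their top term only for \<open>t \<ge> k a\<close>; below
  that threshold the bound \<open>|A t| \<le> t\<close> makes the moment small enough, and the leading term is small there as well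
  (\<open>even_moment_error\<close>).

  The limits of the moments of \<open>A t / \<surd>t\<close> are those of the centred Gaussian law, and convergence of
  moments to those of a law with not too rapidly growing moments implies weak convergence
  (\<open>weak_conv_of_moments\<close>).
\<close>

section \<open>Integrals over compact intervals\<close>

lemma set_integrable_interval_bounded:
  fixes g :: "real \<Rightarrow> real"
  assumes "set_borel_measurable lborel {a..b} g" "\<And>s. s \<in> {a..b} \<Longrightarrow> \<bar>g s\<bar> \<le> K"
  shows "set_integrable lborel {a..b} g"
  unfolding set_integrable_def
proof (rule integrableI_bounded_set[where A = "{a..b}" and B = K])
  show "(\<lambda>x. indicat_real {a..b} x *\<^sub>R g x) \<in> borel_measurable lborel"
    using assms(1) by (simp add: set_borel_measurable_def)
qed (use assms(2) in \<open>auto split: split_indicator simp: emeasure_lborel_Icc_eq\<close>)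

lemma set_integrable_interval_continuous:
  fixes g :: "real \<Rightarrow> real"
  assumes "continuous_on {a..b} g"
  shows "set_integrable lborel {a..b} g"
  using borel_integrable_atLeastAtMost'[OF assms] .

text \<open>A non-integrable \<open>g\<close> has integral 0, so only the majorant has to be integrable.\<close>

lemma set_integral_abs_le:
  fixes g G :: "'a \<Rightarrow> real"
  assumes "set_integrable N A G" "\<And>s. s \<in> A \<Longrightarrow> \<bar>g s\<bar> \<le> G s"
  shows "\<bar>LINT s:A|N. g s\<bar> \<le> (LINT s:A|N. G s)"
proof -
  have nn: "0 \<le> (LINT s:A|N. G s)"
    unfolding set_lebesgue_integral_def
    by (rule Bochner_Integration.integral_nonneg)
       (use assms(2) in \<open>force split: split_indicator\<close>)
  show ?thesis
  proof (cases "set_integrable N A g")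
    case True
    have "\<bar>LINT s:A|N. g s\<bar> \<le> (\<integral>s. \<bar>indicator A s *\<^sub>R g s\<bar> \<partial>N)"
      unfolding set_lebesgue_integral_def by (rule integral_abs_bound)
    also have "\<dots> \<le> (LINT s:A|N. G s)"
      unfolding set_lebesgue_integral_def
      by (rule integral_mono)
         (use True assms in \<open>auto simp: set_integrable_def split: split_indicator\<close>)
    finally show ?thesis .
  next
    case False
    then have "(LINT s:A|N. g s) = 0"
      unfolding set_integrable_def set_lebesgue_integral_def by (rule not_integrable_integral_eq)
    with nn show ?thesis by simp
  qed
qed

lemma set_integral_interval_abs_le_const:
  fixes g :: "real \<Rightarrow> real"
  assumes "a \<le> b" "\<And>s. s \<in> {a..b} \<Longrightarrow> \<bar>g s\<bar> \<le> K"
  shows "\<bar>LINT s:{a..b}|lborel. g s\<bar> \<le> (b - a) * K"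
proof -
  have "\<bar>LINT s:{a..b}|lborel. g s\<bar> \<le> (LINT s:{a..b}|lborel. K)"
    by (rule set_integral_abs_le) (use assms in \<open>auto intro: set_integrable_interval_continuous\<close>)
  also have "\<dots> = (b - a) * K"
    using assms(1) by (simp add: set_lebesgue_integral_def)
  finally show ?thesis .
qed

lemma set_integral_interval_FTC:
  fixes F g :: "real \<Rightarrow> real"
  assumes "a \<le> b" "\<And>x. (F has_real_derivative g x) (at x)" "continuous_on {a..b} g"
  shows "(LINT s:{a..b}|lborel. g s) = F b - F a"
  unfolding set_lebesgue_integral_def
  by (rule integral_FTC_atLeastAtMost[OF assms(1) _ assms(3)])
     (metis assms(2) has_real_derivative_iff_has_vector_derivative has_vector_derivative_at_within)

lemma set_integral_interval_shift:
  fixes g :: "real \<Rightarrow> real"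
  shows "(LINT r:{s..t}|lborel. g r) = (LINT u:{0..t - s}|lborel. g (s + u))"
  unfolding set_lebesgue_integral_def
  by (subst lborel_integral_real_affine[where c = 1 and t = s])
     (auto intro!: Bochner_Integration.integral_cong split: split_indicator)

lemma set_integral_interval_reflect:
  fixes g :: "real \<Rightarrow> real"
  shows "(LINT s:{0..t}|lborel. g (t - s)) = (LINT s:{0..t}|lborel. g s)"
  unfolding set_lebesgue_integral_def
  by (subst (2) lborel_integral_real_affine[where c = "-1" and t = t])
     (auto intro!: Bochner_Integration.integral_cong split: split_indicator)

lemma
  fixes g :: "real \<Rightarrow> 'a \<Rightarrow> real"
  assumes fin: "finite_measure N"
    and meas: "(\<lambda>(s, \<omega>). indicator {a..b} s * g s \<omega>) \<in> borel_measurable (borel \<Otimes>\<^sub>M N)"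
    and bound: "\<And>s \<omega>. s \<in> {a..b} \<Longrightarrow> \<omega> \<in> space N \<Longrightarrow> \<bar>g s \<omega>\<bar> \<le> K"
  shows integral_interval_swap:
      "(\<integral>\<omega>. (LINT s:{a..b}|lborel. g s \<omega>) \<partial>N) = (LINT s:{a..b}|lborel. \<integral>\<omega>. g s \<omega> \<partial>N)"
    and set_integrable_integral_interval:
      "set_integrable lborel {a..b} (\<lambda>s. \<integral>\<omega>. g s \<omega> \<partial>N)"
proof -
  interpret N: finite_measure N by fact
  interpret pair_sigma_finite lborel N ..
  have meas': "(\<lambda>(s, \<omega>). indicator {a..b} s * g s \<omega>) \<in> borel_measurable (lborel \<Otimes>\<^sub>M N)"
    using meas by (simp add: measurable_cong_sets[OF sets_pair_measure_cong[OF sets_lborel refl] refl])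
  have int: "integrable (lborel \<Otimes>\<^sub>M N) (\<lambda>(s, \<omega>). indicator {a..b} s * g s \<omega>)"
  proof (rule integrableI_bounded_set[where A = "{a..b} \<times> space N" and B = K])
    show "emeasure (lborel \<Otimes>\<^sub>M N) ({a..b} \<times> space N) < \<infinity>"
      by (subst N.emeasure_pair_measure_Times)
         (auto simp: emeasure_lborel_Icc_eq N.emeasure_eq_measure ennreal_mult_less_top)
    show "AE x in lborel \<Otimes>\<^sub>M N. x \<notin> {a..b} \<times> space N \<longrightarrow>
        (case x of (s, \<omega>) \<Rightarrow> indicat_real {a..b} s * g s \<omega>) = 0"
      by (rule AE_I2) (auto simp: space_pair_measure indicator_def split: if_splits)
  qed (use meas' bound in auto)
  have "(\<integral>\<omega>. (LINT s:{a..b}|lborel. g s \<omega>) \<partial>N)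
      = (\<integral>\<omega>. (\<integral>s. indicator {a..b} s * g s \<omega> \<partial>lborel) \<partial>N)"
    by (simp add: set_lebesgue_integral_def)
  also have "\<dots> = (\<integral>s. (\<integral>\<omega>. indicator {a..b} s * g s \<omega> \<partial>N) \<partial>lborel)"
    by (rule Fubini_integral[OF int])
  also have "\<dots> = (LINT s:{a..b}|lborel. \<integral>\<omega>. g s \<omega> \<partial>N)"
    by (simp add: set_lebesgue_integral_def)
  finally show "(\<integral>\<omega>. (LINT s:{a..b}|lborel. g s \<omega>) \<partial>N)
      = (LINT s:{a..b}|lborel. \<integral>\<omega>. g s \<omega> \<partial>N)" .
  have "integrable lborel (\<lambda>s. \<integral>\<omega>. indicator {a..b} s * g s \<omega> \<partial>N)"
    using integrable_fst[OF int] by simp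
  then show "set_integrable lborel {a..b} (\<lambda>s. \<integral>\<omega>. g s \<omega> \<partial>N)"
    by (simp add: set_integrable_def)
qed

lemma set_integral_interval_split:
  fixes g :: "real \<Rightarrow> real"
  assumes "set_integrable lborel {a..c} g" "a \<le> b" "b \<le> c"
  shows "(LINT s:{a..c}|lborel. g s) = (LINT s:{a..b}|lborel. g s) + (LINT s:{b..c}|lborel. g s)"
proof -
  have "(LINT s:{a..b} \<union> {b..c}|lborel. g s)
      = (LINT s:{a..b}|lborel. g s) + (LINT s:{b..c}|lborel. g s)"
  proof (rule set_integral_Un_AE)
    show "AE x in lborel. \<not> (x \<in> {a..b} \<and> x \<in> {b..c})"
      using AE_lborel_singleton[of b] by eventually_elim auto
  qed (use assms in \<open>auto intro: set_integrable_subset\<close>)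
  moreover have "{a..b} \<union> {b..c} = {a..c}" using assms by auto
  ultimately show ?thesis by simp
qed

text \<open>
  The chain rule for a path integral \<open>\<integral>\<^sub>r\<^sup>t h\<close> of a merely measurable \<open>h\<close>, which need not be
  differentiable in \<open>r\<close>. Writing \<open>J\<^sub>n(r)\<close> for the left-hand side and \<open>H(r) = \<integral>\<^sub>r\<^sup>t h\<close>, Fubini's
  theorem over the triangle gives \<open>J\<^sub>n = J\<^sub>n\<^sub>-\<^sub>1 H - \<integral> h J\<^sub>n\<^sub>-\<^sub>1\<close>, and the claim for \<open>n - 1\<close> turns
  the last integral into \<open>J\<^sub>n / n\<close>.
\<close>

lemma integral_times_power_of_remaining_integral:
  fixes h :: "real \<Rightarrow> real"
  assumes h[measurable]: "h \<in> borel_measurable borel" and bd: "\<And>r. \<bar>h r\<bar> \<le> K" and "s \<le> t"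
  shows "(LINT r:{s..t}|lborel. h r * (LINT v:{r..t}|lborel. h v) ^ n)
    = (LINT r:{s..t}|lborel. h r) ^ Suc n / real (Suc n)"
  using \<open>s \<le> t\<close>
proof (induction n arbitrary: s)
  case 0
  then show ?case by simp
next
  case (Suc n)
  have K: "0 \<le> K" using bd[of 0] by simp
  define H where "H r = (LINT v:{r..t}|lborel. h v)" for r
  have H_eq: "H r = (\<integral>v. (if r \<le> v \<and> v \<le> t then 1 else 0) * h v \<partial>lborel)" for r
    unfolding H_def set_lebesgue_integral_def
    by (auto intro!: Bochner_Integration.integral_cong split: split_indicator)
  have H_meas[measurable]: "H \<in> borel_measurable borel"
    unfolding H_eq[abs_def] by measurable
  have H_bd: "\<bar>H r\<bar> \<le> (t - s) * K" if "r \<in> {s..t}" for r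
  proof -
    have "\<bar>H r\<bar> \<le> (t - r) * K"
      unfolding H_def by (rule set_integral_interval_abs_le_const) (use that bd in auto)
    also have "\<dots> \<le> (t - s) * K"
      using that K by (intro mult_right_mono) auto
    finally show ?thesis .
  qed
  have integrable_hH: "set_integrable lborel {s..t} (\<lambda>r. h r * H r ^ m)" for m
  proof (rule set_integrable_interval_bounded)
    show "set_borel_measurable lborel {s..t} (\<lambda>r. h r * H r ^ m)"
      unfolding set_borel_measurable_def by measurable
    show "\<bar>h r * H r ^ m\<bar> \<le> K * ((t - s) * K) ^ m" if "r \<in> {s..t}" for r
      unfolding abs_mult power_abs
      using bd H_bd[OF that] K Suc.prems by (intro mult_mono power_mono) auto
  qed
  define J where "J m r = (LINT v:{r..t}|lborel. h v * H v ^ m)" for m r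
  have IH: "J n r = H r ^ Suc n / real (Suc n)" if "r \<le> t" for r
    using Suc.IH[OF that] by (simp add: J_def H_def)
  \<comment> \<open>Restricting the inner variable makes its measure finite, as the exchange lemma requires.\<close>
  let ?N = "restrict_space lborel {s..t}"
  have finN: "finite_measure ?N"
    by (rule finite_measureI)
       (simp add: space_restrict_space emeasure_restrict_space emeasure_lborel_Icc_eq)
  let ?g = "\<lambda>r v. indicator {r..t} v * (h r * H r ^ n * h v)"
  have restrict: "(\<integral>v. F v \<partial>?N) = (LINT v:{s..t}|lborel. F v)" for F :: "real \<Rightarrow> real"
    by (subst integral_restrict_space) (auto simp: set_lebesgue_integral_def)
  have meas: "(\<lambda>(r, v). indicator {s..t} r * ?g r v) \<in> borel_measurable (borel \<Otimes>\<^sub>M ?N)"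
  proof -
    have "(\<lambda>(r, v). indicator {s..t} r * ((if r \<le> v \<and> v \<le> t then 1 else 0) * (h r * H r ^ n * h v)))
        \<in> borel_measurable (borel \<Otimes>\<^sub>M borel)"
      by measurable
    also have "(\<lambda>(r, v). indicator {s..t} r * ((if r \<le> v \<and> v \<le> t then 1 else 0) * (h r * H r ^ n * h v)))
        = (\<lambda>(r, v). indicator {s..t} r * ?g r v)"
      by (auto split: split_indicator)
    finally have m: "(\<lambda>p. indicator {s..t} (fst p) * ?g (fst p) (snd p)) \<in> borel_measurable (borel \<Otimes>\<^sub>M borel)"
      by (simp add: case_prod_beta')
    have *: "(\<lambda>p. (fst p, snd p)) \<in> borel \<Otimes>\<^sub>M ?N \<rightarrow>\<^sub>M borel \<Otimes>\<^sub>M borel"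
      by (rule measurable_Pair) (auto intro!: measurable_compose[OF measurable_snd] measurable_restrict_space1)
    show ?thesis
      using measurable_compose[OF * m] by (simp add: case_prod_beta')
  qed
  \<comment> \<open>One factor \<open>H r\<close> is written as an integral over \<open>v \<ge> r\<close>, giving an integral over the triangle.\<close>
  have "J (Suc n) s = (LINT r:{s..t}|lborel. \<integral>v. ?g r v \<partial>?N)"
    unfolding J_def
  proof (rule set_lebesgue_integral_cong)
    show "\<forall>r. r \<in> {s..t} \<longrightarrow> h r * H r ^ Suc n = (\<integral>v. ?g r v \<partial>?N)"
    proof (intro allI impI)
      fix r assume r: "r \<in> {s..t}"
      have "(\<integral>v. ?g r v \<partial>?N) = (\<integral>v. (h r * H r ^ n) * (indicator {r..t} v * h v) \<partial>lborel)"
        unfolding restrict set_lebesgue_integral_def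
        by (rule Bochner_Integration.integral_cong) (use r in \<open>auto split: split_indicator\<close>)
      also have "\<dots> = h r * H r ^ n * H r"
        by (simp add: H_def set_lebesgue_integral_def)
      finally show "h r * H r ^ Suc n = (\<integral>v. ?g r v \<partial>?N)" by simp
    qed
  qed simp
  also have "\<dots> = (\<integral>v. (LINT r:{s..t}|lborel. ?g r v) \<partial>?N)"
  proof (rule integral_interval_swap[OF finN meas, symmetric])
    fix r v assume "r \<in> {s..t}" "v \<in> space ?N"
    then show "\<bar>?g r v\<bar> \<le> K * ((t - s) * K) ^ n * K"
      unfolding abs_mult power_abs using bd H_bd[of r] K Suc.prems
      by (auto split: split_indicator intro!: mult_mono power_mono mult_nonneg_nonneg zero_le_power)
  qed
  also have "\<dots> = (LINT v:{s..t}|lborel. h v * (J n s - J n v))"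
    unfolding restrict
  proof (rule set_lebesgue_integral_cong)
    show "\<forall>v. v \<in> {s..t} \<longrightarrow> (LINT r:{s..t}|lborel. ?g r v) = h v * (J n s - J n v)"
    proof (intro allI impI)
      fix v assume v: "v \<in> {s..t}"
      have "(LINT r:{s..t}|lborel. ?g r v) = (LINT r:{s..v}|lborel. h v * (h r * H r ^ n))"
        unfolding set_lebesgue_integral_def using v
        by (auto intro!: Bochner_Integration.integral_cong split: split_indicator)
      also have "\<dots> = h v * (LINT r:{s..v}|lborel. h r * H r ^ n)"
        by (rule set_integral_mult_right)
      also have "(LINT r:{s..v}|lborel. h r * H r ^ n) = J n s - J n v"
        unfolding J_def using set_integral_interval_split[OF integrable_hH, of v n] v by simp
      finally show "(LINT r:{s..t}|lborel. ?g r v) = h v * (J n s - J n v)" .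
    qed
  qed simp
  also have "\<dots> = (LINT v:{s..t}|lborel. J n s * (h v * H v ^ 0) - (h v * H v ^ Suc n) / real (Suc n))"
    by (rule set_lebesgue_integral_cong) (auto simp: IH algebra_simps)
  also have "\<dots> = J n s * H s - J (Suc n) s / real (Suc n)"
    using integrable_hH[of 0] integrable_hH[of "Suc n"]
    by (subst set_integral_diff(2)) (auto simp: J_def H_def)
  finally have "J (Suc n) s * (1 + 1 / real (Suc n)) = H s ^ Suc (Suc n) / real (Suc n)"
    using IH[OF Suc.prems] by (simp add: algebra_simps)
  then show ?case
    by (simp add: J_def H_def field_simps)
qed

section \<open>The Markov property\<close>

lemma borel_measurable_kernel_integral:
  fixes F :: "'a \<Rightarrow> 'b \<Rightarrow> real"
  assumes [measurable]: "(\<lambda>(p, \<omega>). F p \<omega>) \<in> borel_measurable (N \<Otimes>\<^sub>M M)"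
    and L[measurable]: "L \<in> N \<rightarrow>\<^sub>M subprob_algebra M"
  shows "(\<lambda>p. \<integral>\<omega>. F p \<omega> \<partial>L p) \<in> borel_measurable N"
proof -
  note measurable_distr2[measurable]
  have "(\<lambda>p. \<integral>z. (case z of (p, \<omega>) \<Rightarrow> F p \<omega>) \<partial>distr (L p) (N \<Otimes>\<^sub>M M) (\<lambda>\<omega>. (p, \<omega>)))
      \<in> borel_measurable N"
    by measurable
  then show ?thesis
  proof (rule measurable_cong[THEN iffD1, rotated])
    fix p assume p: "p \<in> space N"
    have [simp]: "sets (L p) = sets M" using L p by (rule sets_kernel)
    have *: "(\<lambda>\<omega>. (p, \<omega>)) \<in> L p \<rightarrow>\<^sub>M N \<Otimes>\<^sub>M M"
      using p by simp
    show "(\<integral>z. (case z of (p, \<omega>) \<Rightarrow> F p \<omega>) \<partial>distr (L p) (N \<Otimes>\<^sub>M M) (\<lambda>\<omega>. (p, \<omega>)))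
        = (\<integral>\<omega>. F p \<omega> \<partial>L p)"
      by (subst integral_distr[OF *]) simp_all
  qed
qed

context markov_process
begin

definition transition :: "real \<Rightarrow> ('e \<Rightarrow> real) \<Rightarrow> 'e \<Rightarrow> real" where
  "transition s g x = (\<integral>\<omega>. g (X s \<omega>) \<partial>Q x)"

lemma kernel_subprob[measurable]: "Q \<in> E \<rightarrow>\<^sub>M subprob_algebra M"
  using kernel by (rule measurable_prob_algebraD)

lemma
  assumes "x \<in> space E"
  shows prob_space_Q: "prob_space (Q x)" and sets_Q: "sets (Q x) = sets M"
    and space_Q: "space (Q x) = space M"
  using measurable_space[OF kernel assms] by (auto simp: space_prob_algebra dest: sets_eq_imp_space_eq)

text \<open>Extending the paths constantly to negative times makes all times range over the whole line.\<close>

lemma jointly_measurable_max: "(\<lambda>(s, \<omega>). X (max 0 s) \<omega>) \<in> borel \<Otimes>\<^sub>M M \<rightarrow>\<^sub>M E"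
proof -
  have "(\<lambda>p. (max 0 (fst p), snd p)) \<in> borel \<Otimes>\<^sub>M M \<rightarrow>\<^sub>M restrict_space borel {0::real..} \<Otimes>\<^sub>M M"
    by (intro measurable_Pair measurable_restrict_space2) auto
  from measurable_compose[OF this jointly_measurable] show ?thesis
    by (simp add: case_prod_beta')
qed

lemma measurable_X_max[measurable (raw)]:
  assumes "\<tau> \<in> borel_measurable N" "\<xi> \<in> N \<rightarrow>\<^sub>M M"
  shows "(\<lambda>p. X (max 0 (\<tau> p)) (\<xi> p)) \<in> N \<rightarrow>\<^sub>M E"
  using measurable_compose[OF measurable_Pair[OF assms] jointly_measurable_max] by simp

lemma measurable_X: "0 \<le> s \<Longrightarrow> X s \<in> M \<rightarrow>\<^sub>M E"
  using measurable_X_max[of "\<lambda>_. s" M "\<lambda>\<omega>. \<omega>"] by (simp add: max_def)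

lemma X_in_space: "0 \<le> s \<Longrightarrow> \<omega> \<in> space M \<Longrightarrow> X s \<omega> \<in> space E"
  using measurable_space[OF measurable_X] .

lemma borel_measurable_transition:
  assumes [measurable]: "\<tau> \<in> borel_measurable N" "\<xi> \<in> N \<rightarrow>\<^sub>M E"
    "(\<lambda>(p, y). G p y) \<in> borel_measurable (N \<Otimes>\<^sub>M E)"
  shows "(\<lambda>p. transition (max 0 (\<tau> p)) (G p) (\<xi> p)) \<in> borel_measurable N"
  unfolding transition_def
proof (rule borel_measurable_kernel_integral)
  show "(\<lambda>p. Q (\<xi> p)) \<in> N \<rightarrow>\<^sub>M subprob_algebra M" by measurable
  have "(\<lambda>q. (fst q, X (max 0 (\<tau> (fst q))) (snd q))) \<in> N \<Otimes>\<^sub>M M \<rightarrow>\<^sub>M N \<Otimes>\<^sub>M E"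
    by measurable
  from measurable_compose[OF this assms(3)]
  show "(\<lambda>(p, \<omega>). G p (X (max 0 (\<tau> p)) \<omega>)) \<in> borel_measurable (N \<Otimes>\<^sub>M M)"
    by (simp add: case_prod_beta')
qed

lemma borel_measurable_transition_fixed:
  assumes "0 \<le> s" "g \<in> borel_measurable E"
  shows "transition s g \<in> borel_measurable E"
proof -
  have "(\<lambda>(p, y). g y) \<in> borel_measurable (E \<Otimes>\<^sub>M E)"
    using assms(2) by measurable
  from borel_measurable_transition[OF measurable_const measurable_ident this, of s] show ?thesis
    using assms(1) by (simp add: max_def)
qed

lemma integrable_X:
  fixes g :: "'e \<Rightarrow> real"
  assumes "x \<in> space E" "0 \<le> s" "g \<in> borel_measurable E" "\<And>y. y \<in> space E \<Longrightarrow> \<bar>g y\<bar> \<le> K"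
  shows "integrable (Q x) (\<lambda>\<omega>. g (X s \<omega>))"
proof -
  interpret prob_space "Q x" by (rule prob_space_Q[OF assms(1)])
  show ?thesis
  proof (rule integrable_const_bound[where B = K])
    show "(\<lambda>\<omega>. g (X s \<omega>)) \<in> borel_measurable (Q x)"
      using measurable_compose[OF measurable_X[OF assms(2)] assms(3)]
      by (simp add: measurable_cong_sets[OF sets_Q[OF assms(1)] refl])
  qed (auto intro!: assms X_in_space simp: space_Q[OF assms(1)])
qed

lemma transition_abs_le:
  assumes x: "x \<in> space E" and s: "0 \<le> s" and g: "g \<in> borel_measurable E"
    and bd: "\<And>y. y \<in> space E \<Longrightarrow> \<bar>g y\<bar> \<le> K"
  shows "\<bar>transition s g x\<bar> \<le> K"
proof -
  interpret prob_space "Q x" by (rule prob_space_Q[OF x])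
  have "\<bar>transition s g x\<bar> \<le> (\<integral>\<omega>. \<bar>g (X s \<omega>)\<bar> \<partial>Q x)"
    unfolding transition_def by (rule integral_abs_bound)
  also have "\<dots> \<le> (\<integral>\<omega>. K \<partial>Q x)"
    using integrable_X[OF assms]
    by (intro integral_mono_AE) (auto intro!: bd X_in_space s simp: space_Q[OF x])
  finally show ?thesis by (simp add: prob_space)
qed

lemma transition_linear:
  assumes "x \<in> space E" "0 \<le> s"
    and "g \<in> borel_measurable E" "\<And>y. y \<in> space E \<Longrightarrow> \<bar>g y\<bar> \<le> K"
    and "h \<in> borel_measurable E" "\<And>y. y \<in> space E \<Longrightarrow> \<bar>h y\<bar> \<le> L"
  shows "transition s (\<lambda>y. a * g y + b * h y) x = a * transition s g x + b * transition s h x"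
  unfolding transition_def
  using integrable_X[OF assms(1-4)] integrable_X[OF assms(1,2,5,6)] by simp

lemma transition_cong:
  assumes "x \<in> space E" "0 \<le> s" "\<And>y. y \<in> space E \<Longrightarrow> g y = h y"
  shows "transition s g x = transition s h x"
  unfolding transition_def
  by (rule Bochner_Integration.integral_cong)
     (use assms in \<open>auto simp: space_Q intro!: X_in_space\<close>)

text \<open>
Under \<open>Q x\<close> the path starts in \<open>x\<close>, so a factor depending on the initial state is constant.
\<close>

lemma integral_at_time_0:
  fixes g :: "'e \<Rightarrow> real" and W :: "'w \<Rightarrow> real"
  assumes "x \<in> space E" "g \<in> borel_measurable E" "W \<in> borel_measurable M"
  shows "(\<integral>\<omega>. g (X 0 \<omega>) * W \<omega> \<partial>Q x) = g x * (\<integral>\<omega>. W \<omega> \<partial>Q x)"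
proof -
  have [measurable]: "W \<in> borel_measurable (Q x)" "(\<lambda>\<omega>. g (X 0 \<omega>)) \<in> borel_measurable (Q x)"
    using assms measurable_compose[OF measurable_X[of 0] assms(2)]
    by (simp_all add: measurable_cong_sets[OF sets_Q[OF assms(1)] refl])
  have "(\<integral>\<omega>. g (X 0 \<omega>) * W \<omega> \<partial>Q x) = (\<integral>\<omega>. g x * W \<omega> \<partial>Q x)"
  proof (rule integral_cong_AE)
    show "AE \<omega> in Q x. g (X 0 \<omega>) * W \<omega> = g x * W \<omega>"
      using starts_at[OF assms(1)] by eventually_elim simp
  qed measurable
  then show ?thesis by simp
qed

lemma space_past: "space (past E M X s) = space M"
  unfolding past_def by (rule space_measure_of) auto

lemma sets_past:
  "sets (past E M X s)
    = sigma_sets (space M) {X r -` A \<inter> space M |r A. 0 \<le> r \<and> r \<le> s \<and> A \<in> sets E}"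
  unfolding past_def by (rule sets_measure_of) auto

lemma sets_past_subset: "sets (past E M X s) \<subseteq> sets M"
  unfolding sets_past
  by (rule sets.sigma_sets_subset) (auto intro: measurable_sets[OF measurable_X])

lemma subalgebra_past: "x \<in> space E \<Longrightarrow> subalgebra (Q x) (past E M X s)"
  unfolding subalgebra_def using sets_past_subset by (simp add: space_past space_Q sets_Q)

lemma borel_measurable_past_imp: "Z \<in> borel_measurable (past E M X s) \<Longrightarrow> Z \<in> borel_measurable M"
  using measurable_mono[of borel borel "past E M X s" M] sets_past_subset
  by (auto simp: space_past)

lemma borel_measurable_past_mono:
  assumes "s \<le> r" "Z \<in> borel_measurable (past E M X s)"
  shows "Z \<in> borel_measurable (past E M X r)"
proof -
  have "sets (past E M X s) \<subseteq> sets (past E M X r)"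
    unfolding sets_past by (rule sigma_sets_mono') (use assms(1) in force)
  then show ?thesis
    using measurable_mono[of borel borel "past E M X s" "past E M X r"] assms(2)
    by (auto simp: space_past)
qed

lemma measurable_X_past:
  assumes "0 \<le> r" "r \<le> s"
  shows "X r \<in> past E M X s \<rightarrow>\<^sub>M E"
proof (rule measurableI)
  show "X r \<omega> \<in> space E" if "\<omega> \<in> space (past E M X s)" for \<omega>
    using that X_in_space[OF assms(1)] by (simp add: space_past)
  show "X r -` A \<inter> space (past E M X s) \<in> sets (past E M X s)" if "A \<in> sets E" for A
    unfolding sets_past space_past by (rule sigma_sets.Basic) (use assms that in blast)
qed

text \<open>
  The defining property concerns indicators and conditional expectations. Both sides below are
  linear in \<open>g\<close> and continuous along bounded increasing sequences, so it extends to bounded nonnegative \<open>g\<close>.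
\<close>

lemma markov_integral_nonneg:
  assumes x: "x \<in> space E" and s: "0 \<le> s" and t: "0 \<le> t"
    and Z: "Z \<in> borel_measurable (past E M X s)" and Zbd: "\<And>\<omega>. \<omega> \<in> space M \<Longrightarrow> \<bar>Z \<omega>\<bar> \<le> K"
    and g: "g \<in> borel_measurable E" "\<And>y. 0 \<le> g y"
    and gbd: "\<exists>L. \<forall>y\<in>space E. g y \<le> L"
  shows "(\<integral>\<omega>. Z \<omega> * g (X (s + t) \<omega>) \<partial>Q x) = (\<integral>\<omega>. Z \<omega> * transition t g (X s \<omega>) \<partial>Q x)"
  using g gbd
proof (induction rule: borel_measurable_induct_real)
  case (set A)
  interpret prob_space "Q x" by (rule prob_space_Q[OF x])
  interpret F: finite_measure_subalgebra "Q x" "past E M X s"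
    by unfold_locales (rule subalgebra_past[OF x])
  have ZM: "Z \<in> borel_measurable (Q x)"
    using borel_measurable_past_imp[OF Z] by (simp add: measurable_cong_sets[OF sets_Q[OF x] refl])
  have gm: "(\<lambda>\<omega>. indicat_real A (X (s + t) \<omega>)) \<in> borel_measurable (Q x)"
    using measurable_compose[OF measurable_X, of "s + t" "indicat_real A"] s t set
    by (simp add: measurable_cong_sets[OF sets_Q[OF x] refl])
  have int: "integrable (Q x) (\<lambda>\<omega>. Z \<omega> * indicat_real A (X (s + t) \<omega>))"
  proof (rule integrable_const_bound[where B = K])
    show "AE \<omega> in Q x. norm (Z \<omega> * indicat_real A (X (s + t) \<omega>)) \<le> K"
      using Zbd by (intro AE_I2) (force simp: space_Q[OF x] indicator_def)
  qed (use ZM gm in measurable)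
  have "(\<integral>\<omega>. Z \<omega> * indicator A (X (s + t) \<omega>) \<partial>Q x)
      = (\<integral>\<omega>. Z \<omega> * real_cond_exp (Q x) (past E M X s) (\<lambda>\<omega>. indicator A (X (s + t) \<omega>)) \<omega> \<partial>Q x)"
    by (rule F.real_cond_exp_intg(2)[symmetric, OF int Z gm])
  also have "\<dots> = (\<integral>\<omega>. Z \<omega> * transition t (indicator A) (X s \<omega>) \<partial>Q x)"
  proof (rule integral_cong_AE)
    have "(\<lambda>\<omega>. transition t (indicator A) (X s \<omega>)) \<in> borel_measurable M"
      by (rule measurable_compose[OF measurable_X[OF s] borel_measurable_transition_fixed[OF t]])
         (use set in simp)
    then show "(\<lambda>\<omega>. Z \<omega> * transition t (indicator A) (X s \<omega>)) \<in> borel_measurable (Q x)"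
      using ZM by (simp add: measurable_cong_sets[OF sets_Q[OF x] refl])
    have tr: "transition t (indicator A) (X s \<omega>) = measure (Q (X s \<omega>)) {\<omega>' \<in> space M. X t \<omega>' \<in> A}"
      if "\<omega> \<in> space M" for \<omega>
    proof -
      have y: "X s \<omega> \<in> space E" using X_in_space[OF s that] .
      have ms: "{\<omega>' \<in> space M. X t \<omega>' \<in> A} \<in> sets (Q (X s \<omega>))"
        using measurable_sets[OF measurable_X[OF t] set.hyps] 
        by (simp add: sets_Q[OF y] vimage_def Int_def conj_commute)
      have "transition t (indicator A) (X s \<omega>)
          = (\<integral>\<omega>'. indicator {\<omega>' \<in> space M. X t \<omega>' \<in> A} \<omega>' \<partial>Q (X s \<omega>))"
        unfolding transition_def
        by (rule Bochner_Integration.integral_cong) (auto simp: space_Q[OF y] indicator_def)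
      also have "\<dots> = measure (Q (X s \<omega>)) {\<omega>' \<in> space M. X t \<omega>' \<in> A}"
        using ms by (simp add: Int_absorb2 space_Q[OF y] Collect_restrict)
      finally show ?thesis .
    qed
    show "AE \<omega> in Q x. Z \<omega> * real_cond_exp (Q x) (past E M X s) (\<lambda>\<omega>. indicator A (X (s + t) \<omega>)) \<omega>
        = Z \<omega> * transition t (indicator A) (X s \<omega>)"
      using markov[OF x s t set.hyps] AE_space[of "Q x"]
      by eventually_elim (simp add: tr space_Q[OF x])
  qed (use ZM in simp)
  finally show ?case .
next
  case (mult g a)
  show ?case
  proof (cases "a = 0")
    case True
    then show ?thesis by (simp add: transition_def)
  next
    case False
    with mult.hyps have "0 < a" by simp
    from mult.prems obtain L where "\<forall>y\<in>space E. a * g y \<le> L" by blast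
    with \<open>0 < a\<close> have "\<forall>y\<in>space E. g y \<le> L / a"
      by (simp add: field_simps)
    then have "(\<integral>\<omega>. Z \<omega> * g (X (s + t) \<omega>) \<partial>Q x) = (\<integral>\<omega>. Z \<omega> * transition t g (X s \<omega>) \<partial>Q x)"
      using mult.IH by blast
    then have "(\<integral>\<omega>. a * (Z \<omega> * g (X (s + t) \<omega>)) \<partial>Q x) = (\<integral>\<omega>. a * (Z \<omega> * transition t g (X s \<omega>)) \<partial>Q x)"
      by simp
    moreover have "transition t (\<lambda>y. a * g y) z = a * transition t g z" for z
      by (simp add: transition_def)
    ultimately show ?thesis by (simp add: mult.left_commute)
  qed
next
  case (add g h)
  from add.prems obtain L where L: "\<And>y. y \<in> space E \<Longrightarrow> h y + g y \<le> L" by blast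
  have bd: "\<And>y. y \<in> space E \<Longrightarrow> \<bar>g y\<bar> \<le> L" "\<And>y. y \<in> space E \<Longrightarrow> \<bar>h y\<bar> \<le> L"
    using L add.hyps(2,4) by (smt (verit))+
  interpret prob_space "Q x" by (rule prob_space_Q[OF x])
  have int: "integrable (Q x) (\<lambda>\<omega>. Z \<omega> * G (X r \<omega>))"
    if "0 \<le> r" "G \<in> borel_measurable E" "\<And>y. y \<in> space E \<Longrightarrow> \<bar>G y\<bar> \<le> L" for r G
  proof (rule integrable_const_bound[where B = "K * L"])
    show "AE \<omega> in Q x. norm (Z \<omega> * G (X r \<omega>)) \<le> K * L"
      unfolding real_norm_def abs_mult space_Q[OF x]
      by (intro AE_I2 mult_mono)
         (use that Zbd X_in_space in \<open>auto simp: space_Q[OF x] intro: order_trans[OF abs_ge_zero]\<close>)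
    show "(\<lambda>\<omega>. Z \<omega> * G (X r \<omega>)) \<in> borel_measurable (Q x)"
      using borel_measurable_past_imp[OF Z] measurable_compose[OF measurable_X[OF that(1)] that(2)]
      by (simp add: measurable_cong_sets[OF sets_Q[OF x] refl])
  qed
  note tr = borel_measurable_transition_fixed[OF t] transition_abs_le[OF _ t]
  have ex: "\<exists>L. \<forall>y\<in>space E. g y \<le> L" "\<exists>L. \<forall>y\<in>space E. h y \<le> L"
    using bd abs_le_D1 by blast+
  have st: "0 \<le> s + t" using s t by simp
  have eq: "transition t (\<lambda>y. h y + g y) z = transition t h z + transition t g z" if "z \<in> space E" for z
    using transition_linear[OF that t add.hyps(3) bd(2) add.hyps(1) bd(1), of 1 1] by simp
  have "(\<integral>\<omega>. Z \<omega> * (h (X (s + t) \<omega>) + g (X (s + t) \<omega>)) \<partial>Q x)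
      = (\<integral>\<omega>. Z \<omega> * h (X (s + t) \<omega>) \<partial>Q x) + (\<integral>\<omega>. Z \<omega> * g (X (s + t) \<omega>) \<partial>Q x)"
    unfolding distrib_left
    by (rule Bochner_Integration.integral_add; rule int) (use st add.hyps bd in auto)
  also have "\<dots> = (\<integral>\<omega>. Z \<omega> * transition t h (X s \<omega>) \<partial>Q x) + (\<integral>\<omega>. Z \<omega> * transition t g (X s \<omega>) \<partial>Q x)"
    by (simp only: add.IH(1)[OF ex(1)] add.IH(2)[OF ex(2)])
  also have "\<dots> = (\<integral>\<omega>. Z \<omega> * (transition t h (X s \<omega>) + transition t g (X s \<omega>)) \<partial>Q x)"
    unfolding distrib_left
    by (rule Bochner_Integration.integral_add[symmetric]; rule int)
       (use s tr add.hyps bd in auto)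
  also have "\<dots> = (\<integral>\<omega>. Z \<omega> * transition t (\<lambda>y. h y + g y) (X s \<omega>) \<partial>Q x)"
    by (rule Bochner_Integration.integral_cong) (auto simp: eq space_Q[OF x] X_in_space[OF s])
  finally show ?case .
next
  case (seq U)
  from seq.prems obtain L where L: "\<And>y. y \<in> space E \<Longrightarrow> g y \<le> L" by blast
  have Ug: "U i y \<le> g y" if "y \<in> space E" for i y
  proof (rule LIMSEQ_le_const[OF seq.hyps(4)[OF that]])
    show "\<exists>N. \<forall>n\<ge>N. U i y \<le> U n y"
      using seq.hyps(3) by (auto simp: incseq_def le_fun_def)
  qed
  have Ubd: "\<bar>U i y\<bar> \<le> L" if "y \<in> space E" for i y
    using Ug[OF that, of i] L[OF that] seq.hyps(2)[of i y] by simp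
  have gm: "g \<in> borel_measurable E"
    by (rule borel_measurable_LIMSEQ_real[OF seq.hyps(4) seq.hyps(1)])
  have gbd: "\<bar>g y\<bar> \<le> L" if "y \<in> space E" for y
    using L[OF that] Ug[OF that, of 0] seq.hyps(2)[of 0 y] by simp
  have conv: "(\<lambda>i. \<integral>\<omega>. Y \<omega> * G i (X r \<omega>) \<partial>Q z) \<longlonglongrightarrow> (\<integral>\<omega>. Y \<omega> * G' (X r \<omega>) \<partial>Q z)"
    if "z \<in> space E" "0 \<le> r" "Y \<in> borel_measurable M" "\<And>\<omega>. \<omega> \<in> space M \<Longrightarrow> \<bar>Y \<omega>\<bar> \<le> K'"
      "\<And>i. G i \<in> borel_measurable E" "\<And>i y. y \<in> space E \<Longrightarrow> \<bar>G i y\<bar> \<le> L"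
      "\<And>y. y \<in> space E \<Longrightarrow> (\<lambda>i. G i y) \<longlonglongrightarrow> G' y" for z r Y K' G G'
  proof -
    interpret z: prob_space "Q z" by (rule prob_space_Q[OF that(1)])
    have mG': "G' \<in> borel_measurable E"
      by (rule borel_measurable_LIMSEQ_real[OF that(7) that(5)])
    note mm = measurable_cong_sets[OF sets_Q[OF that(1)] refl]
    show ?thesis
    proof (rule integral_dominated_convergence[where w = "\<lambda>_. K' * L"])
      show "(\<lambda>\<omega>. Y \<omega> * G' (X r \<omega>)) \<in> borel_measurable (Q z)"
        using that(3) measurable_compose[OF measurable_X[OF that(2)] mG'] by (simp add: mm)
      show "(\<lambda>\<omega>. Y \<omega> * G i (X r \<omega>)) \<in> borel_measurable (Q z)" for i
        using that(3) measurable_compose[OF measurable_X[OF that(2)] that(5)] by (simp add: mm)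
      show "AE \<omega> in Q z. (\<lambda>i. Y \<omega> * G i (X r \<omega>)) \<longlonglongrightarrow> Y \<omega> * G' (X r \<omega>)"
        by (intro AE_I2 tendsto_mult tendsto_const that(7) X_in_space) (use that in \<open>auto simp: space_Q\<close>)
      show "AE \<omega> in Q z. norm (Y \<omega> * G i (X r \<omega>)) \<le> K' * L" for i
        unfolding real_norm_def abs_mult
        by (intro AE_I2 mult_mono)
           (use that X_in_space in \<open>auto simp: space_Q intro: order_trans[OF abs_ge_zero]\<close>)
    qed simp
  qed
  have trans_conv: "(\<lambda>i. transition t (U i) y) \<longlonglongrightarrow> transition t g y" if "y \<in> space E" for y
    using conv[OF that t, of "\<lambda>_. 1" 1 U g] seq.hyps Ubd by (simp add: transition_def)
  have "(\<lambda>i. \<integral>\<omega>. Z \<omega> * U i (X (s + t) \<omega>) \<partial>Q x) \<longlonglongrightarrow> (\<integral>\<omega>. Z \<omega> * g (X (s + t) \<omega>) \<partial>Q x)"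
    by (rule conv[OF x _ borel_measurable_past_imp[OF Z] Zbd seq.hyps(1) Ubd seq.hyps(4)]) (use s t in auto)
  moreover have "(\<lambda>i. \<integral>\<omega>. Z \<omega> * transition t (U i) (X s \<omega>) \<partial>Q x) \<longlonglongrightarrow> (\<integral>\<omega>. Z \<omega> * transition t g (X s \<omega>) \<partial>Q x)"
    by (rule conv[OF x s borel_measurable_past_imp[OF Z] Zbd borel_measurable_transition_fixed[OF t seq.hyps(1)] _ trans_conv])
       (use transition_abs_le[OF _ t seq.hyps(1) Ubd] in auto)
  moreover have "(\<integral>\<omega>. Z \<omega> * U i (X (s + t) \<omega>) \<partial>Q x) = (\<integral>\<omega>. Z \<omega> * transition t (U i) (X s \<omega>) \<partial>Q x)" for i
  proof (rule seq.IH)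
    show "\<exists>L. \<forall>y\<in>space E. U i y \<le> L" using Ubd[of _ i] abs_le_D1 by blast
  qed
  ultimately show ?case
    using LIMSEQ_unique by auto
qed

lemma markov_integral:
  assumes x: "x \<in> space E" and s: "0 \<le> s" and t: "0 \<le> t"
    and Z: "Z \<in> borel_measurable (past E M X s)" and Zbd: "\<And>\<omega>. \<omega> \<in> space M \<Longrightarrow> \<bar>Z \<omega>\<bar> \<le> K"
    and g: "g \<in> borel_measurable E" and gbd: "\<And>y. y \<in> space E \<Longrightarrow> \<bar>g y\<bar> \<le> L"
  shows "(\<integral>\<omega>. Z \<omega> * g (X (s + t) \<omega>) \<partial>Q x) = (\<integral>\<omega>. Z \<omega> * transition t g (X s \<omega>) \<partial>Q x)"
proof -
  interpret prob_space "Q x" by (rule prob_space_Q[OF x])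
  have int: "integrable (Q x) (\<lambda>\<omega>. Z \<omega> * G (X r \<omega>))"
    if "0 \<le> r" "G \<in> borel_measurable E" "\<And>y. y \<in> space E \<Longrightarrow> \<bar>G y\<bar> \<le> L'" for r G L'
  proof (rule integrable_const_bound[where B = "K * L'"])
    show "AE \<omega> in Q x. norm (Z \<omega> * G (X r \<omega>)) \<le> K * L'"
      unfolding real_norm_def abs_mult space_Q[OF x]
      by (intro AE_I2 mult_mono)
         (use that Zbd X_in_space in \<open>auto simp: space_Q[OF x] intro: order_trans[OF abs_ge_zero]\<close>)
    show "(\<lambda>\<omega>. Z \<omega> * G (X r \<omega>)) \<in> borel_measurable (Q x)"
      using borel_measurable_past_imp[OF Z] measurable_compose[OF measurable_X[OF that(1)] that(2)]
      by (simp add: measurable_cong_sets[OF sets_Q[OF x] refl])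
  qed
  let ?p = "\<lambda>y. max 0 (g y)" and ?n = "\<lambda>y. max 0 (- g y)"
  have pn: "?p \<in> borel_measurable E" "?n \<in> borel_measurable E"
    using g by auto
  have pn_le: "\<bar>?p y\<bar> \<le> L" "\<bar>?n y\<bar> \<le> L" if "y \<in> space E" for y
    using gbd[OF that] by linarith+
  have split: "transition t g z = transition t (\<lambda>y. max 0 (g y)) z - transition t (\<lambda>y. max 0 (- g y)) z"
    if z: "z \<in> space E" for z
  proof -
    have "transition t g z = transition t (\<lambda>y. 1 * max 0 (g y) + (-1) * max 0 (- g y)) z"
      by (rule transition_cong[OF z t]) auto
    also have "\<dots> = 1 * transition t (\<lambda>y. max 0 (g y)) z + (-1) * transition t (\<lambda>y. max 0 (- g y)) z"
      by (rule transition_linear[OF z t pn(1) pn_le(1) pn(2) pn_le(2)])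
    finally show ?thesis by simp
  qed
  have pos: "(\<integral>\<omega>. Z \<omega> * G (X (s + t) \<omega>) \<partial>Q x) = (\<integral>\<omega>. Z \<omega> * transition t G (X s \<omega>) \<partial>Q x)"
    if "G \<in> borel_measurable E" "\<And>y. 0 \<le> G y" "\<And>y. y \<in> space E \<Longrightarrow> G y \<le> L" for G
    by (rule markov_integral_nonneg[OF x s t Z Zbd that(1,2)]) (use that(3) in auto)
  have st: "0 \<le> s + t" using s t by simp
  note tr = borel_measurable_transition_fixed[OF t] transition_abs_le[OF _ t]
  have "(\<integral>\<omega>. Z \<omega> * g (X (s + t) \<omega>) \<partial>Q x)
      = (\<integral>\<omega>. Z \<omega> * ?p (X (s + t) \<omega>) - Z \<omega> * ?n (X (s + t) \<omega>) \<partial>Q x)"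
    by (rule Bochner_Integration.integral_cong) (auto simp: max_def)
  also have "\<dots> = (\<integral>\<omega>. Z \<omega> * ?p (X (s + t) \<omega>) \<partial>Q x) - (\<integral>\<omega>. Z \<omega> * ?n (X (s + t) \<omega>) \<partial>Q x)"
    by (rule Bochner_Integration.integral_diff[OF int[OF st pn(1) pn_le(1)] int[OF st pn(2) pn_le(2)]])
  also have "\<dots> = (\<integral>\<omega>. Z \<omega> * transition t ?p (X s \<omega>) \<partial>Q x) - (\<integral>\<omega>. Z \<omega> * transition t ?n (X s \<omega>) \<partial>Q x)"
    by (simp only: pos[OF pn(1) max.cobounded1 abs_le_D1[OF pn_le(1)]]
        pos[OF pn(2) max.cobounded1 abs_le_D1[OF pn_le(2)]])
  also have "\<dots> = (\<integral>\<omega>. Z \<omega> * transition t ?p (X s \<omega>) - Z \<omega> * transition t ?n (X s \<omega>) \<partial>Q x)"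
    by (rule Bochner_Integration.integral_diff[symmetric,
          OF int[OF s tr(1)[OF pn(1)] tr(2)[OF _ pn(1) pn_le(1)]]
             int[OF s tr(1)[OF pn(2)] tr(2)[OF _ pn(2) pn_le(2)]]])
  also have "\<dots> = (\<integral>\<omega>. Z \<omega> * transition t g (X s \<omega>) \<partial>Q x)"
    by (rule Bochner_Integration.integral_cong)
       (auto simp: split space_Q[OF x] X_in_space[OF s] right_diff_distrib)
  finally show ?thesis .
qed

end

section \<open>Recursion for the moments of the time integral\<close>

locale markov_functional = markov_process E M X Q
  for E :: "'e measure" and M :: "'w measure" and X :: "real \<Rightarrow> 'w \<Rightarrow> 'e" and Q :: "'e \<Rightarrow> 'w measure" +
  fixes f :: "'e \<Rightarrow> real"
  assumes unit_bounded: "f \<in> unit_bounded E"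
begin

abbreviation A :: "real \<Rightarrow> 'w \<Rightarrow> real" where
  "A \<equiv> time_integral X f"

definition moment :: "nat \<Rightarrow> real \<Rightarrow> 'e \<Rightarrow> real" where
  "moment n t x = (\<integral>\<omega>. A t \<omega> ^ n \<partial>Q x) / fact n"

lemma measurable_f[measurable]: "f \<in> borel_measurable E"
  using unit_bounded by (simp add: unit_bounded_def)

lemma f_abs_le: "x \<in> space E \<Longrightarrow> \<bar>f x\<bar> \<le> 1"
  using unit_bounded by (simp add: unit_bounded_def)

lemma time_integral_eq:
  "A t \<omega> = (\<integral>s. (if 0 \<le> s \<and> s \<le> t then 1 else 0) * f (X (max 0 s) \<omega>) \<partial>lborel)"
  unfolding time_integral_def set_lebesgue_integral_def
  by (auto intro!: Bochner_Integration.integral_cong simp: max_def split: split_indicator)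

lemma measurable_time_integral[measurable (raw)]:
  assumes [measurable]: "\<tau> \<in> borel_measurable N" "\<xi> \<in> N \<rightarrow>\<^sub>M M"
  shows "(\<lambda>p. A (\<tau> p) (\<xi> p)) \<in> borel_measurable N"
  unfolding time_integral_eq by measurable

lemma set_integrable_path:
  assumes \<omega>: "\<omega> \<in> space M" and "0 \<le> s"
  shows "set_integrable lborel {s..t} (\<lambda>r. f (X r \<omega>))"
proof (rule set_integrable_interval_bounded)
  have "(\<lambda>r. indicator {s..t} r *\<^sub>R f (X (max 0 r) \<omega>)) \<in> borel_measurable lborel"
    using \<omega> by measurable
  also have "(\<lambda>r. indicator {s..t} r *\<^sub>R f (X (max 0 r) \<omega>)) = (\<lambda>r. indicator {s..t} r *\<^sub>R f (X r \<omega>))"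
    using \<open>0 \<le> s\<close> by (auto split: split_indicator simp: max_def)
  finally show "set_borel_measurable lborel {s..t} (\<lambda>r. f (X r \<omega>))"
    by (simp add: set_borel_measurable_def)
  show "\<bar>f (X r \<omega>)\<bar> \<le> 1" if "r \<in> {s..t}" for r
    using that \<open>0 \<le> s\<close> by (intro f_abs_le X_in_space \<omega>) auto
qed

lemma time_integral_diff:
  assumes "\<omega> \<in> space M" "0 \<le> s" "s \<le> t"
  shows "A t \<omega> - A s \<omega> = (LINT r:{s..t}|lborel. f (X r \<omega>))"
  unfolding time_integral_def
  using set_integral_interval_split[OF set_integrable_path[OF assms(1) order_refl] assms(2,3)] by simp

lemma time_integral_diff_abs_le:
  assumes "\<omega> \<in> space M" "0 \<le> s" "s \<le> t"
  shows "\<bar>A t \<omega> - A s \<omega>\<bar> \<le> t - s"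
proof -
  have "\<bar>LINT r:{s..t}|lborel. f (X r \<omega>)\<bar> \<le> (t - s) * 1"
    by (rule set_integral_interval_abs_le_const) (use assms in \<open>auto intro!: f_abs_le X_in_space\<close>)
  then show ?thesis by (simp add: time_integral_diff[OF assms])
qed

lemma time_integral_0: "A 0 \<omega> = 0"
  using set_integral_interval_abs_le_const[of 0 0 "\<lambda>r. f (X r \<omega>)" "\<bar>f (X 0 \<omega>)\<bar>"]
  by (simp add: time_integral_def)

lemma time_integral_abs_le:
  assumes "\<omega> \<in> space M" "0 \<le> t"
  shows "\<bar>A t \<omega>\<bar> \<le> t"
  using time_integral_diff_abs_le[OF assms(1) order_refl assms(2)] by (simp add: time_integral_0)

lemma increment_power_Suc:
  assumes \<omega>: "\<omega> \<in> space M" and s: "0 \<le> s" "s \<le> t"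
  shows "(A t \<omega> - A s \<omega>) ^ Suc n
    = real (Suc n) * (LINT r:{s..t}|lborel. f (X r \<omega>) * (A t \<omega> - A r \<omega>) ^ n)"
proof -
  let ?h = "\<lambda>r. f (X (max 0 r) \<omega>)"
  have A_eq: "(LINT v:{r..t}|lborel. ?h v) = A t \<omega> - A r \<omega>" if "r \<in> {s..t}" for r
  proof -
    have "(LINT v:{r..t}|lborel. ?h v) = (LINT v:{r..t}|lborel. f (X v \<omega>))"
      by (rule set_lebesgue_integral_cong) (use that s in \<open>auto simp: max_def\<close>)
    also have "\<dots> = A t \<omega> - A r \<omega>"
      by (rule time_integral_diff[symmetric]) (use that s \<omega> in auto)
    finally show ?thesis .
  qed
  have "(LINT r:{s..t}|lborel. ?h r * (LINT v:{r..t}|lborel. ?h v) ^ n)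
      = (LINT r:{s..t}|lborel. ?h r) ^ Suc n / real (Suc n)"
    by (rule integral_times_power_of_remaining_integral[where K = 1])
       (use \<omega> s in \<open>auto intro!: f_abs_le X_in_space\<close>)
  moreover have "(LINT r:{s..t}|lborel. ?h r * (LINT v:{r..t}|lborel. ?h v) ^ n)
      = (LINT r:{s..t}|lborel. f (X r \<omega>) * (A t \<omega> - A r \<omega>) ^ n)"
    by (rule set_lebesgue_integral_cong) (use s A_eq in \<open>auto simp: max_def\<close>)
  ultimately show ?thesis
    using A_eq[of s] s by (simp add: field_simps)
qed

lemma borel_measurable_moment[measurable (raw)]:
  assumes [measurable]: "\<tau> \<in> borel_measurable N" "\<xi> \<in> N \<rightarrow>\<^sub>M E"
  shows "(\<lambda>p. moment n (\<tau> p) (\<xi> p)) \<in> borel_measurable N"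
  unfolding moment_def
proof (rule borel_measurable_divide)
  show "(\<lambda>p. \<integral>\<omega>. A (\<tau> p) \<omega> ^ n \<partial>Q (\<xi> p)) \<in> borel_measurable N"
    by (rule borel_measurable_kernel_integral[where M = M]) measurable
qed simp

lemma moment_0: "x \<in> space E \<Longrightarrow> moment 0 t x = 1"
  using prob_space.prob_space[OF prob_space_Q] by (simp add: moment_def)

lemma moment_abs_le:
  assumes x: "x \<in> space E" and t: "0 \<le> t"
  shows "\<bar>moment n t x\<bar> \<le> t ^ n / fact n"
proof -
  interpret prob_space "Q x" by (rule prob_space_Q[OF x])
  have "\<bar>\<integral>\<omega>. A t \<omega> ^ n \<partial>Q x\<bar> \<le> (\<integral>\<omega>. t ^ n \<partial>Q x)"
  proof (rule order_trans[OF integral_abs_bound integral_mono])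
    have le: "\<bar>A t \<omega> ^ n\<bar> \<le> t ^ n" if "\<omega> \<in> space (Q x)" for \<omega>
      unfolding power_abs using time_integral_abs_le[of \<omega> t] that t
      by (intro power_mono) (auto simp: space_Q[OF x])
    then show "\<bar>A t \<omega> ^ n\<bar> \<le> t ^ n" if "\<omega> \<in> space (Q x)" for \<omega> using that .
    have "(\<lambda>\<omega>. A t \<omega> ^ n) \<in> borel_measurable (Q x)"
      by (subst measurable_cong_sets[OF sets_Q[OF x] refl]) measurable
    then show "integrable (Q x) (\<lambda>\<omega>. \<bar>A t \<omega> ^ n\<bar>)"
      using le by (intro integrable_abs integrable_const_bound[where B = "t ^ n"] AE_I2) auto
  qed auto
  then show ?thesis
    by (simp add: moment_def abs_divide divide_right_mono prob_space)
qed

lemma borel_measurable_moment_transition: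
  "(\<lambda>(u, x). transition (max 0 u) (\<lambda>y. f y * moment n (t - u) y) x) \<in> borel_measurable (borel \<Otimes>\<^sub>M E)"
proof -
  have "(\<lambda>p. transition (max 0 (fst p)) (\<lambda>y. f y * moment n (t - fst p) y) (snd p))
      \<in> borel_measurable (borel \<Otimes>\<^sub>M E)"
    by (rule borel_measurable_transition) measurable
  then show ?thesis by (simp add: case_prod_beta')
qed

lemma f_moment_abs_le:
  assumes "x \<in> space E" "0 \<le> u" "u \<le> t"
  shows "\<bar>f x * moment n u x\<bar> \<le> t ^ n / fact n"
proof -
  have "\<bar>f x * moment n u x\<bar> \<le> 1 * (u ^ n / fact n)"
    unfolding abs_mult using f_abs_le[OF assms(1)] moment_abs_le[OF assms(1,2)]
    by (intro mult_mono) auto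
  also have "\<dots> \<le> t ^ n / fact n"
    using assms by (auto intro!: divide_right_mono power_mono)
  finally show ?thesis .
qed

text \<open>
The right-hand side of the recursion for the moments: the process runs for a time \<open>u\<close>, collects
one factor \<open>f\<close>, and has time \<open>t - u\<close> left for the other \<open>n\<close> factors.
\<close>

definition moment_step :: "nat \<Rightarrow> real \<Rightarrow> 'e \<Rightarrow> real" where
  "moment_step n t x = (LINT u:{0..t}|lborel. transition u (\<lambda>y. f y * moment n (t - u) y) x)"

lemma borel_measurable_moment_step: "moment_step n t \<in> borel_measurable E"
proof -
  have "(\<lambda>p. transition (max 0 (snd p)) (\<lambda>y. f y * moment n (t - snd p) y) (fst p))
      \<in> borel_measurable (E \<Otimes>\<^sub>M borel)"
    by (rule borel_measurable_transition) measurable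
  then have [measurable]: "(\<lambda>(x, u). transition (max 0 u) (\<lambda>y. f y * moment n (t - u) y) x)
      \<in> borel_measurable (E \<Otimes>\<^sub>M borel)"
    by (simp add: case_prod_beta')
  have "(\<lambda>x. \<integral>u. indicator {0..t} u * transition (max 0 u) (\<lambda>y. f y * moment n (t - u) y) x \<partial>lborel)
      \<in> borel_measurable E"
    by measurable
  also have "(\<lambda>x. \<integral>u. indicator {0..t} u * transition (max 0 u) (\<lambda>y. f y * moment n (t - u) y) x \<partial>lborel)
      = moment_step n t"
    unfolding moment_step_def set_lebesgue_integral_def
    by (auto intro!: Bochner_Integration.integral_cong simp: max_def split: split_indicator)
  finally show ?thesis .
qed

text \<open>
Conditionally on the past up to time \<open>s\<close>, the \<open>n\<close>-th moment of \<open>A t - A s\<close> is \<open>n!\<close> times a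
function \<open>u (t - s)\<close> of the current state. The conditional expectation is tested against bounded
functions \<open>Z\<close> of the past, because this is the form in which the induction over \<open>n\<close> closes.
\<close>

definition increment_markov :: "nat \<Rightarrow> (real \<Rightarrow> 'e \<Rightarrow> real) \<Rightarrow> bool" where
  "increment_markov n u \<longleftrightarrow> (\<forall>x s t Z K. x \<in> space E \<longrightarrow> 0 \<le> s \<longrightarrow> s \<le> t \<longrightarrow>
    Z \<in> borel_measurable (past E M X s) \<longrightarrow> (\<forall>\<omega>\<in>space M. \<bar>Z \<omega>\<bar> \<le> K) \<longrightarrow>
    (\<integral>\<omega>. Z \<omega> * (A t \<omega> - A s \<omega>) ^ n \<partial>Q x) = fact n * (\<integral>\<omega>. Z \<omega> * u (t - s) (X s \<omega>) \<partial>Q x))"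

text \<open>
Taking \<open>s = 0\<close> and \<open>Z = 1\<close> identifies the function: it is the moment itself.
\<close>

lemma increment_markov_unique:
  assumes "increment_markov n u" "x \<in> space E" "0 \<le> t" "u t \<in> borel_measurable E"
  shows "u t x = moment n t x"
proof -
  have "(\<integral>\<omega>. 1 * (A t \<omega> - A 0 \<omega>) ^ n \<partial>Q x) = fact n * (\<integral>\<omega>. 1 * u (t - 0) (X 0 \<omega>) \<partial>Q x)"
    using assms(1)[unfolded increment_markov_def, rule_format, of x 0 t "\<lambda>_. 1" 1] assms(2,3) by simp
  then have "(\<integral>\<omega>. A t \<omega> ^ n \<partial>Q x) = fact n * (\<integral>\<omega>. u t (X 0 \<omega>) * 1 \<partial>Q x)"
    by (simp add: time_integral_0)
  also have "\<dots> = fact n * u t x"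
    using integral_at_time_0[OF assms(2,4), of "\<lambda>_. 1"] prob_space.prob_space[OF prob_space_Q[OF assms(2)]]
    by simp
  finally show ?thesis by (simp add: moment_def)
qed

text \<open>
The \<open>(n + 1)\<close>-st power of the increment is an integral over \<open>r\<close> of \<open>f (X r)\<close> times the \<open>n\<close>-th
power of the increment after \<open>r\<close>. The hypothesis applied at time \<open>r\<close>, with the past variable
\<open>Z * f (X r)\<close>, removes that power; the Markov property at the single time \<open>s\<close> then moves the
remaining function of \<open>X r\<close> back to \<open>X s\<close>.
\<close>

lemma increment_markov_step:
  assumes "increment_markov n (moment n)"
  shows "increment_markov (Suc n) (moment_step n)"
  unfolding increment_markov_def
proof (intro allI impI)
  fix x s t and Z :: "'w \<Rightarrow> real" and K :: real
  assume x: "x \<in> space E" and s: "0 \<le> s" and st: "s \<le> t"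
    and Z: "Z \<in> borel_measurable (past E M X s)" and Zbd: "\<forall>\<omega>\<in>space M. \<bar>Z \<omega>\<bar> \<le> K"
  interpret prob_space "Q x" by (rule prob_space_Q[OF x])
  note meas_Q = measurable_cong_sets[OF sets_pair_measure_cong[OF refl sets_Q[OF x]] refl]
  have ZM[measurable]: "Z \<in> borel_measurable M" by (rule borel_measurable_past_imp[OF Z])
  have K: "0 \<le> K" using Zbd not_empty by (auto simp: space_Q[OF x] intro: order_trans[OF abs_ge_zero])
  have "(\<integral>\<omega>. Z \<omega> * (A t \<omega> - A s \<omega>) ^ Suc n \<partial>Q x)
      = (\<integral>\<omega>. real (Suc n) * (LINT r:{s..t}|lborel. Z \<omega> * f (X r \<omega>) * (A t \<omega> - A r \<omega>) ^ n) \<partial>Q x)"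
  proof (rule Bochner_Integration.integral_cong[OF refl])
    fix \<omega> assume "\<omega> \<in> space (Q x)"
    then have \<omega>: "\<omega> \<in> space M" by (simp add: space_Q[OF x])
    have "Z \<omega> * (A t \<omega> - A s \<omega>) ^ Suc n
        = real (Suc n) * (Z \<omega> * (LINT r:{s..t}|lborel. f (X r \<omega>) * (A t \<omega> - A r \<omega>) ^ n))"
      unfolding increment_power_Suc[OF \<omega> s st] by (rule mult.left_commute)
    also have "Z \<omega> * (LINT r:{s..t}|lborel. f (X r \<omega>) * (A t \<omega> - A r \<omega>) ^ n)
        = (LINT r:{s..t}|lborel. Z \<omega> * f (X r \<omega>) * (A t \<omega> - A r \<omega>) ^ n)"
      unfolding mult.assoc by (rule set_integral_mult_right[symmetric])
    finally show "Z \<omega> * (A t \<omega> - A s \<omega>) ^ Suc n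
        = real (Suc n) * (LINT r:{s..t}|lborel. Z \<omega> * f (X r \<omega>) * (A t \<omega> - A r \<omega>) ^ n)" .
  qed
  also have "\<dots> = real (Suc n) * (\<integral>\<omega>. (LINT r:{s..t}|lborel. Z \<omega> * f (X r \<omega>) * (A t \<omega> - A r \<omega>) ^ n) \<partial>Q x)"
    by (rule integral_mult_right_zero)
  also have "(\<integral>\<omega>. (LINT r:{s..t}|lborel. Z \<omega> * f (X r \<omega>) * (A t \<omega> - A r \<omega>) ^ n) \<partial>Q x)
      = (LINT r:{s..t}|lborel. \<integral>\<omega>. Z \<omega> * f (X r \<omega>) * (A t \<omega> - A r \<omega>) ^ n \<partial>Q x)"
  proof (rule integral_interval_swap[OF finite_measure_axioms])
    have "(\<lambda>(r, \<omega>). indicator {s..t} r * (Z \<omega> * f (X (max 0 r) \<omega>) * (A t \<omega> - A r \<omega>) ^ n))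
        \<in> borel_measurable (borel \<Otimes>\<^sub>M M)"
      by measurable
    also have "(\<lambda>(r, \<omega>). indicator {s..t} r * (Z \<omega> * f (X (max 0 r) \<omega>) * (A t \<omega> - A r \<omega>) ^ n))
        = (\<lambda>(r, \<omega>). indicator {s..t} r * (Z \<omega> * f (X r \<omega>) * (A t \<omega> - A r \<omega>) ^ n))"
      using s by (auto simp: max_def split: split_indicator)
    finally show "(\<lambda>(r, \<omega>). indicator {s..t} r * (Z \<omega> * f (X r \<omega>) * (A t \<omega> - A r \<omega>) ^ n))
        \<in> borel_measurable (borel \<Otimes>\<^sub>M Q x)"
      unfolding meas_Q .
    fix r \<omega> assume r: "r \<in> {s..t}" and \<omega>: "\<omega> \<in> space (Q x)"
    then have \<omega>: "\<omega> \<in> space M" by (simp add: space_Q[OF x])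
    have "\<bar>A t \<omega> - A r \<omega>\<bar> \<le> t"
      using time_integral_diff_abs_le[OF \<omega>, of r t] r s by simp
    moreover have "\<bar>f (X r \<omega>)\<bar> \<le> 1" using r s by (intro f_abs_le X_in_space \<omega>) auto
    ultimately show "\<bar>Z \<omega> * f (X r \<omega>) * (A t \<omega> - A r \<omega>) ^ n\<bar> \<le> K * 1 * t ^ n"
      unfolding abs_mult power_abs using Zbd \<omega> K by (intro mult_mono power_mono) auto
  qed
  also have "\<dots> = (LINT r:{s..t}|lborel. fact n *
      (\<integral>\<omega>. Z \<omega> * transition (r - s) (\<lambda>y. f y * moment n (t - r) y) (X s \<omega>) \<partial>Q x))"
  proof (rule set_lebesgue_integral_cong; (intro allI impI)?)
    fix r assume r: "r \<in> {s..t}"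
    then have r0: "0 \<le> r" "s \<le> r" "r \<le> t" using s by auto
    have "(\<lambda>\<omega>. Z \<omega> * f (X r \<omega>)) \<in> borel_measurable (past E M X r)"
      using borel_measurable_past_mono[OF r0(2) Z]
        measurable_compose[OF measurable_X_past[OF r0(1) order_refl] measurable_f] by simp
    moreover have "\<forall>\<omega>\<in>space M. \<bar>Z \<omega> * f (X r \<omega>)\<bar> \<le> K * 1"
      unfolding abs_mult using Zbd K
      by (intro ballI mult_mono f_abs_le X_in_space r0) auto
    ultimately have "(\<integral>\<omega>. (Z \<omega> * f (X r \<omega>)) * (A t \<omega> - A r \<omega>) ^ n \<partial>Q x)
        = fact n * (\<integral>\<omega>. (Z \<omega> * f (X r \<omega>)) * moment n (t - r) (X r \<omega>) \<partial>Q x)"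
      using assms x r0 unfolding increment_markov_def by blast
    also have "(\<integral>\<omega>. (Z \<omega> * f (X r \<omega>)) * moment n (t - r) (X r \<omega>) \<partial>Q x)
        = (\<integral>\<omega>. Z \<omega> * (\<lambda>y. f y * moment n (t - r) y) (X (s + (r - s)) \<omega>) \<partial>Q x)"
      by (simp add: mult.assoc)
    also have "\<dots> = (\<integral>\<omega>. Z \<omega> * transition (r - s) (\<lambda>y. f y * moment n (t - r) y) (X s \<omega>) \<partial>Q x)"
      by (rule markov_integral[OF x s _ Z _ _ f_moment_abs_le[of _ _ t]]) (use r0 Zbd in auto)
    finally show "(\<integral>\<omega>. Z \<omega> * f (X r \<omega>) * (A t \<omega> - A r \<omega>) ^ n \<partial>Q x)
        = fact n * (\<integral>\<omega>. Z \<omega> * transition (r - s) (\<lambda>y. f y * moment n (t - r) y) (X s \<omega>) \<partial>Q x)" .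
  qed simp
  also have "\<dots> = fact n * (LINT u:{0..t - s}|lborel.
      \<integral>\<omega>. Z \<omega> * transition u (\<lambda>y. f y * moment n (t - s - u) y) (X s \<omega>) \<partial>Q x)"
    by (subst set_integral_interval_shift) (simp add: diff_diff_add)
  also have "(LINT u:{0..t - s}|lborel.
      \<integral>\<omega>. Z \<omega> * transition u (\<lambda>y. f y * moment n (t - s - u) y) (X s \<omega>) \<partial>Q x)
      = (\<integral>\<omega>. (LINT u:{0..t - s}|lborel. Z \<omega> * transition u (\<lambda>y. f y * moment n (t - s - u) y) (X s \<omega>)) \<partial>Q x)"
  proof (rule integral_interval_swap[OF finite_measure_axioms, symmetric])
    have "(\<lambda>q. (fst q, X s (snd q))) \<in> borel \<Otimes>\<^sub>M M \<rightarrow>\<^sub>M borel \<Otimes>\<^sub>M E"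
      using measurable_X[OF s] by measurable
    from measurable_compose[OF this borel_measurable_moment_transition[of n "t - s"]]
    have [measurable]: "(\<lambda>(u, \<omega>). transition (max 0 u) (\<lambda>y. f y * moment n (t - s - u) y) (X s \<omega>))
        \<in> borel_measurable (borel \<Otimes>\<^sub>M M)"
      by (simp add: case_prod_beta')
    have "(\<lambda>(u, \<omega>). indicator {0..t - s} u *
          (Z \<omega> * transition (max 0 u) (\<lambda>y. f y * moment n (t - s - u) y) (X s \<omega>)))
        \<in> borel_measurable (borel \<Otimes>\<^sub>M M)"
      by measurable
    also have "(\<lambda>(u, \<omega>). indicator {0..t - s} u *
          (Z \<omega> * transition (max 0 u) (\<lambda>y. f y * moment n (t - s - u) y) (X s \<omega>)))
        = (\<lambda>(u, \<omega>). indicator {0..t - s} u *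
          (Z \<omega> * transition u (\<lambda>y. f y * moment n (t - s - u) y) (X s \<omega>)))"
      by (auto simp: max_def split: split_indicator)
    finally show "(\<lambda>(u, \<omega>). indicator {0..t - s} u *
          (Z \<omega> * transition u (\<lambda>y. f y * moment n (t - s - u) y) (X s \<omega>)))
        \<in> borel_measurable (borel \<Otimes>\<^sub>M Q x)"
      unfolding meas_Q .
    fix u \<omega> assume u: "u \<in> {0..t - s}" and "\<omega> \<in> space (Q x)"
    then have \<omega>: "\<omega> \<in> space M" by (simp add: space_Q[OF x])
    have "\<bar>transition u (\<lambda>y. f y * moment n (t - s - u) y) (X s \<omega>)\<bar> \<le> t ^ n / fact n"
      by (rule transition_abs_le[OF X_in_space[OF s \<omega>]], use u in simp, measurable)
         (use u s in \<open>auto intro!: f_moment_abs_le\<close>)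
    then show "\<bar>Z \<omega> * transition u (\<lambda>y. f y * moment n (t - s - u) y) (X s \<omega>)\<bar> \<le> K * (t ^ n / fact n)"
      unfolding abs_mult using Zbd \<omega> K by (intro mult_mono) auto
  qed
  finally show "(\<integral>\<omega>. Z \<omega> * (A t \<omega> - A s \<omega>) ^ Suc n \<partial>Q x)
      = fact (Suc n) * (\<integral>\<omega>. Z \<omega> * moment_step n (t - s) (X s \<omega>) \<partial>Q x)"
    by (simp add: moment_step_def)
qed

lemma increment_markov_moment: "increment_markov n (moment n)"
proof (induction n)
  case 0
  show ?case
    unfolding increment_markov_def
    by (auto intro!: Bochner_Integration.integral_cong simp: moment_0 space_Q X_in_space)
next
  case (Suc n)
  have eq: "moment_step n t x = moment (Suc n) t x" if "x \<in> space E" "0 \<le> t" for t x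
    by (rule increment_markov_unique[OF increment_markov_step[OF Suc.IH] that borel_measurable_moment_step])
  show ?case
    unfolding increment_markov_def
  proof (intro allI impI)
    fix x s t and Z :: "'w \<Rightarrow> real" and K :: real
    assume *: "x \<in> space E" "0 \<le> s" "s \<le> t" "Z \<in> borel_measurable (past E M X s)"
      "\<forall>\<omega>\<in>space M. \<bar>Z \<omega>\<bar> \<le> K"
    have "(\<integral>\<omega>. Z \<omega> * (A t \<omega> - A s \<omega>) ^ Suc n \<partial>Q x)
        = fact (Suc n) * (\<integral>\<omega>. Z \<omega> * moment_step n (t - s) (X s \<omega>) \<partial>Q x)"
      using increment_markov_step[OF Suc.IH] * unfolding increment_markov_def by blast
    also have "(\<integral>\<omega>. Z \<omega> * moment_step n (t - s) (X s \<omega>) \<partial>Q x)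
        = (\<integral>\<omega>. Z \<omega> * moment (Suc n) (t - s) (X s \<omega>) \<partial>Q x)"
      by (rule Bochner_Integration.integral_cong)
         (use * in \<open>auto simp: eq space_Q X_in_space\<close>)
    finally show "(\<integral>\<omega>. Z \<omega> * (A t \<omega> - A s \<omega>) ^ Suc n \<partial>Q x)
        = fact (Suc n) * (\<integral>\<omega>. Z \<omega> * moment (Suc n) (t - s) (X s \<omega>) \<partial>Q x)" .
  qed
qed

lemma moment_Suc:
  assumes "x \<in> space E" "0 \<le> t"
  shows "moment (Suc n) t x = (LINT u:{0..t}|lborel. transition u (\<lambda>y. f y * moment n (t - u) y) x)"
  using increment_markov_unique[OF increment_markov_step[OF increment_markov_moment] assms borel_measurable_moment_step]
  by (simp add: moment_step_def)

end

section \<open>Partial exponential sums and exponential decay\<close>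

text \<open>
The mean value estimate for the function \<open>x \<mapsto> x\<^sup>i\<^sup>+\<^sup>1\<close>.
\<close>

lemma power_increment_le:
  fixes s v :: real
  assumes "0 \<le> v" "v \<le> s"
  shows "s ^ Suc i - v ^ Suc i \<le> real (Suc i) * (s - v) * s ^ i"
proof (induction i)
  case 0
  then show ?case by simp
next
  case (Suc i)
  have "s ^ Suc (Suc i) - v ^ Suc (Suc i) = s * (s ^ Suc i - v ^ Suc i) + v ^ Suc i * (s - v)"
    by (simp add: algebra_simps)
  also have "\<dots> \<le> s * (real (Suc i) * (s - v) * s ^ i) + s ^ Suc i * (s - v)"
    using assms by (intro add_mono mult_left_mono[OF Suc.IH] mult_right_mono power_mono) auto
  also have "\<dots> = real (Suc (Suc i)) * (s - v) * s ^ Suc i"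
    by (simp add: algebra_simps)
  finally show ?case .
qed

text \<open>
Each of the last \<open>m\<close> factors of \<open>(n + m)!\<close> is at least \<open>n + 1\<close>.
\<close>

lemma fact_mult_power_le_fact: "fact n * real (Suc n) ^ m \<le> fact (n + m)"
proof (induction m)
  case 0
  then show ?case by simp
next
  case (Suc m)
  have "fact n * real (Suc n) ^ Suc m = real (Suc n) * (fact n * real (Suc n) ^ m)" by simp
  also have "\<dots> \<le> real (Suc (n + m)) * fact (n + m)"
    by (intro mult_mono Suc.IH) auto
  finally show ?case by simp
qed

text \<open>
The polynomials in which all bounds below are expressed: integrating one of them raises its degree
by one, and beyond \<open>x = n\<close> the terms increase, so that there the last one controls the sum.
\<close>

definition exp_partial :: "nat \<Rightarrow> real \<Rightarrow> real" where
  "exp_partial n x = (\<Sum>p\<le>n. x ^ p / fact p)"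

lemma exp_partial_nonneg: "0 \<le> x \<Longrightarrow> 0 \<le> exp_partial n x"
  by (auto simp: exp_partial_def intro: sum_nonneg)

lemma exp_partial_ge_term: "0 \<le> x \<Longrightarrow> p \<le> n \<Longrightarrow> x ^ p / fact p \<le> exp_partial n x"
  unfolding exp_partial_def by (rule member_le_sum) auto

lemma exp_partial_mono_index: "0 \<le> x \<Longrightarrow> m \<le> n \<Longrightarrow> exp_partial m x \<le> exp_partial n x"
  unfolding exp_partial_def by (rule sum_mono2) auto

lemma exp_partial_mono: "0 \<le> x \<Longrightarrow> x \<le> y \<Longrightarrow> exp_partial n x \<le> exp_partial n y"
  unfolding exp_partial_def by (intro sum_mono divide_right_mono power_mono) auto

lemma exp_partial_le_top_term:
  assumes "real n \<le> x"
  shows "exp_partial n x \<le> real (Suc n) * (x ^ n / fact n)"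
proof -
  have x: "0 \<le> x" using assms by linarith
  have step: "x ^ p / fact p \<le> x ^ Suc p / fact (Suc p)" if "p < n" for p
  proof -
    have "x ^ p / fact p * 1 \<le> x ^ p / fact p * (x / real (Suc p))"
      using that assms x by (intro mult_left_mono) (auto simp: field_simps)
    then show ?thesis by (simp add: field_simps)
  qed
  have "x ^ p / fact p \<le> x ^ n / fact n" if "p \<le> n" for p
    using that
  proof (induction rule: inc_induct)
    case (step m)
    then show ?case using \<open>\<And>p. p < n \<Longrightarrow> _ p\<close>[of m] by simp
  qed simp
  then have "exp_partial n x \<le> (\<Sum>p\<le>n. x ^ n / fact n)"
    unfolding exp_partial_def by (intro sum_mono) auto
  then show ?thesis by simp
qed

lemma continuous_on_exp_partial[continuous_intros]:
  "continuous_on S g \<Longrightarrow> continuous_on S (\<lambda>x. exp_partial n (g x))"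
  unfolding exp_partial_def by (intro continuous_intros) auto

lemma integral_exp_partial:
  assumes "0 < a" "0 \<le> t"
  shows "(LINT s:{0..t}|lborel. exp_partial n (s / a)) = a * (exp_partial (Suc n) (t / a) - 1)"
proof -
  have eq: "exp_partial (Suc n) x = 1 + (\<Sum>p\<le>n. x ^ Suc p / fact (Suc p))" for x
    unfolding exp_partial_def by (subst sum.atMost_Suc_shift) simp
  have d1: "((\<lambda>s. (s / a) ^ Suc p / fact (Suc p)) has_real_derivative (s / a) ^ p / fact p / a) (at s)" for p s
    using assms(1) by (auto intro!: derivative_eq_intros simp del: power_Suc)
  have deriv: "((\<lambda>s. a * exp_partial (Suc n) (s / a)) has_real_derivative exp_partial n (s / a)) (at s)" for s
  proof -
    have "((\<lambda>s. a * exp_partial (Suc n) (s / a)) has_real_derivative a * (\<Sum>p\<le>n. (s / a) ^ p / fact p / a)) (at s)"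
      unfolding eq by (rule derivative_eq_intros d1 refl)+ simp
    also have "a * (\<Sum>p\<le>n. (s / a) ^ p / fact p / a) = exp_partial n (s / a)"
      using assms(1) by (simp add: exp_partial_def sum_distrib_left)
    finally show ?thesis .
  qed
  have "(LINT s:{0..t}|lborel. exp_partial n (s / a))
      = a * exp_partial (Suc n) (t / a) - a * exp_partial (Suc n) (0 / a)"
    by (rule set_integral_interval_FTC[OF assms(2) deriv])
       (use assms(1) in \<open>auto intro!: continuous_on_exp_partial continuous_on_divide\<close>)
  moreover have "exp_partial (Suc n) 0 = 1" by (simp add: eq)
  ultimately show ?thesis by (simp add: right_diff_distrib)
qed

lemma
  fixes g :: real
  assumes "0 < g"
  shows set_integrable_exp_decay: "set_integrable lborel {s..} (\<lambda>u. g * exp (- g * u))"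
    and integral_exp_decay_atLeast: "(LINT u:{s..}|lborel. g * exp (- g * u)) = exp (- g * s)"
proof -
  have lim: "((\<lambda>u. - exp (- g * u)) \<longlongrightarrow> 0) at_top"
    using assms by real_asymp
  have "(\<integral>\<^sup>+u. ennreal (g * exp (- g * u)) * indicator {s..} u \<partial>lborel) = 0 - (- exp (- g * s))"
  proof (rule nn_integral_FTC_atLeast[OF _ _ _ lim])
    show "DERIV (\<lambda>u. - exp (- g * u)) u :> g * exp (- g * u)" for u
      by (auto intro!: derivative_eq_intros)
  qed (use assms in auto)
  then have "(\<integral>\<^sup>+u. ennreal (indicator {s..} u *\<^sub>R (g * exp (- g * u))) \<partial>lborel) = ennreal (exp (- g * s))"
    by (simp add: indicator_mult_ennreal mult.commute)
  then have "has_bochner_integral lborel (\<lambda>u. indicator {s..} u *\<^sub>R (g * exp (- g * u))) (exp (- g * s))"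
    using assms by (intro has_bochner_integral_nn_integral) auto
  then show "set_integrable lborel {s..} (\<lambda>u. g * exp (- g * u))"
    "(LINT u:{s..}|lborel. g * exp (- g * u)) = exp (- g * s)"
    unfolding set_integrable_def set_lebesgue_integral_def has_bochner_integral_iff by blast+
qed

lemma integral_exp_decay_le:
  fixes g :: real
  assumes "0 < g" "0 \<le> t"
  shows "(LINT u:{0..t}|lborel. g * exp (- g * u)) \<le> 1"
proof -
  have "(LINT u:{0..t}|lborel. g * exp (- g * u)) = - exp (- g * t) - (- exp (- g * 0))"
    by (rule set_integral_interval_FTC)
       (use assms in \<open>auto intro!: derivative_eq_intros continuous_intros\<close>)
  then show ?thesis by simp
qed

lemma integral_linear_exp_decay_le:
  fixes g :: real
  assumes "0 < g" "0 \<le> t"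
  shows "(LINT u:{0..t}|lborel. g * exp (- g * u) * u) \<le> 1 / g"
proof -
  have "(LINT u:{0..t}|lborel. g * exp (- g * u) * u)
      = - (t + 1 / g) * exp (- g * t) - (- (0 + 1 / g) * exp (- g * 0))"
    by (rule set_integral_interval_FTC)
       (use assms in \<open>auto intro!: derivative_eq_intros continuous_intros simp: field_simps\<close>)
  moreover have "- (t + 1 / g) * exp (- g * t) \<le> 0"
    using assms by (intro mult_nonpos_nonneg) (simp_all add: add_nonneg_nonneg del: minus_add_distrib)
  ultimately show ?thesis by simp
qed

section \<open>Geometric ergodicity\<close>

context markov_process
begin

lemma
  fixes W :: "'w \<Rightarrow> real"
  assumes \<mu>: "\<mu> \<in> space (prob_algebra E)" and W: "W \<in> borel_measurable M"
    and bd: "\<And>\<omega>. \<omega> \<in> space M \<Longrightarrow> \<bar>W \<omega>\<bar> \<le> K"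
  shows integral_initial_law: "(\<integral>\<omega>. W \<omega> \<partial>(\<mu> \<bind> Q)) = (\<integral>x. (\<integral>\<omega>. W \<omega> \<partial>Q x) \<partial>\<mu>)"
    and integrable_initial_law: "integrable (\<mu> \<bind> Q) W"
proof -
  interpret \<mu>: prob_space \<mu> using \<mu> by (simp add: space_prob_algebra)
  have sets_\<mu>: "sets \<mu> = sets E" using \<mu> by (simp add: space_prob_algebra)
  have Q: "Q \<in> \<mu> \<rightarrow>\<^sub>M subprob_algebra M"
    using kernel_subprob by (simp add: measurable_cong_sets[OF sets_\<mu> refl])
  have em: "AE x in \<mu>. emeasure (Q x) (space (Q x)) \<le> ennreal 1"
    using prob_space.emeasure_space_1[OF prob_space_Q] sets_eq_imp_space_eq[OF sets_\<mu>] by auto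
  show "(\<integral>\<omega>. W \<omega> \<partial>(\<mu> \<bind> Q)) = (\<integral>x. (\<integral>\<omega>. W \<omega> \<partial>Q x) \<partial>\<mu>)" "integrable (\<mu> \<bind> Q) W"
    by (rule integral_bind[OF W bd Q \<mu>.finite_measure_axioms em] integrable_bind[OF W bd Q \<mu>.finite_measure_axioms em]; assumption)+
qed

end

locale weighted_ergodic = markov_process E M X Q
  for E :: "'e measure" and M :: "'w measure" and X :: "real \<Rightarrow> 'w \<Rightarrow> 'e" and Q :: "'e \<Rightarrow> 'w measure" +
  fixes \<beta> :: "'e measure" and \<psi> :: "'e \<Rightarrow> real" and c C \<gamma> :: real
  assumes invariant: "invariant_prob E X Q \<beta>"
    and c_pos: "0 < c" and measurable_\<psi>[measurable]: "\<psi> \<in> borel_measurable E"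
    and \<psi>_ge: "\<And>x. x \<in> space E \<Longrightarrow> c \<le> \<psi> x"
    and C_pos: "0 < C" and \<gamma>_pos: "0 < \<gamma>"
    and ergodic: "\<And>x t. x \<in> space E \<Longrightarrow> 0 \<le> t \<Longrightarrow>
      weighted_dist E \<psi> (distr (Q x) E (X t)) \<beta> \<le> ennreal (C * exp (- \<gamma> * t) * \<psi> x)"
begin

lemma \<beta>_prob_algebra: "\<beta> \<in> space (prob_algebra E)"
  using invariant by (simp add: invariant_prob_def)

lemma prob_space_\<beta>: "prob_space \<beta>" and sets_\<beta>: "sets \<beta> = sets E"
  using \<beta>_prob_algebra by (auto simp: space_prob_algebra)

sublocale \<beta>: prob_space \<beta> by (rule prob_space_\<beta>)

lemma space_\<beta>: "space \<beta> = space E"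
  using sets_\<beta> by (rule sets_eq_imp_space_eq)

lemma measurable_\<beta>: "g \<in> \<beta> \<rightarrow>\<^sub>M N \<longleftrightarrow> g \<in> E \<rightarrow>\<^sub>M N"
  by (simp add: measurable_cong_sets[OF sets_\<beta> refl])

lemma \<psi>_pos: "x \<in> space E \<Longrightarrow> 0 < \<psi> x"
  using \<psi>_ge c_pos by fastforce

lemma integrable_\<beta>_bounded:
  fixes g :: "'e \<Rightarrow> real"
  assumes "g \<in> borel_measurable E" "\<And>x. x \<in> space E \<Longrightarrow> \<bar>g x\<bar> \<le> K"
  shows "integrable \<beta> g"
  by (rule \<beta>.integrable_const_bound[where B = K])
     (use assms in \<open>auto simp: measurable_\<beta> space_\<beta>\<close>)

definition deviation :: "real \<Rightarrow> ('e \<Rightarrow> real) \<Rightarrow> 'e \<Rightarrow> real" where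
  "deviation t g x = transition t g x - (\<integral>y. g y \<partial>\<beta>)"

text \<open>
Scaling \<open>g\<close> by \<open>1 / K\<close> gives a test function of norm at most one for the weighted distance. For
\<open>K = 0\<close> the scaling is meaningless, but then \<open>g\<close> vanishes.
\<close>

lemma deviation_abs_le:
  assumes x: "x \<in> space E" and t: "0 \<le> t" and g: "g \<in> borel_measurable E"
    and bd: "\<And>y. y \<in> space E \<Longrightarrow> \<bar>g y\<bar> \<le> K * \<psi> y"
  shows "\<bar>deviation t g x\<bar> \<le> C * exp (- \<gamma> * t) * \<psi> x * K"
proof -
  have "0 \<le> K * \<psi> x" using bd[OF x] by linarith
  then have K0: "0 \<le> K" using \<psi>_pos[OF x] by (simp add: zero_le_mult_iff)
  have X: "X t \<in> Q x \<rightarrow>\<^sub>M E"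
    using measurable_X[OF t] by (simp add: measurable_cong_sets[OF sets_Q[OF x] refl])
  show ?thesis
  proof (cases "K = 0")
    case True
    with bd have g0: "\<And>y. y \<in> space E \<Longrightarrow> g y = 0" by force
    have "transition t g x = transition t (\<lambda>_. 0) x"
      by (rule transition_cong[OF x t g0])
    moreover have "(\<integral>y. g y \<partial>\<beta>) = (\<integral>y. 0 \<partial>\<beta>)"
      by (rule Bochner_Integration.integral_cong) (auto simp: g0 space_\<beta>)
    ultimately show ?thesis by (simp add: deviation_def transition_def True)
  next
    case False
    with K0 have K: "0 < K" by simp
    let ?h = "\<lambda>y. g y / K"
    have "Linf_norm E \<psi> ?h \<le> 1"
      unfolding Linf_norm_def
    proof (rule SUP_least)
      fix y assume y: "y \<in> space E"
      have "\<bar>?h y / \<psi> y\<bar> = \<bar>g y\<bar> / (K * \<psi> y)" using K \<psi>_pos[OF y] by (simp add: abs_divide abs_mult)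
      also have "\<dots> \<le> 1" using bd[OF y] K \<psi>_pos[OF y] by (simp add: divide_le_eq)
      finally show "ennreal \<bar>?h y / \<psi> y\<bar> \<le> 1" by simp
    qed
    then have "ennreal \<bar>(\<integral>y. ?h y \<partial>distr (Q x) E (X t)) - (\<integral>y. ?h y \<partial>\<beta>)\<bar>
        \<le> weighted_dist E \<psi> (distr (Q x) E (X t)) \<beta>"
      unfolding weighted_dist_def using g by (intro SUP_upper) auto
    also have "\<dots> \<le> ennreal (C * exp (- \<gamma> * t) * \<psi> x)" by (rule ergodic[OF x t])
    finally have "\<bar>(\<integral>y. ?h y \<partial>distr (Q x) E (X t)) - (\<integral>y. ?h y \<partial>\<beta>)\<bar> \<le> C * exp (- \<gamma> * t) * \<psi> x"
      using C_pos \<psi>_pos[OF x] by (simp add: ennreal_le_iff)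
    moreover have "(\<integral>y. ?h y \<partial>distr (Q x) E (X t)) = transition t g x / K"
      using g by (subst integral_distr[OF X]) (auto simp: transition_def)
    moreover have "(\<integral>y. ?h y \<partial>\<beta>) = (\<integral>y. g y \<partial>\<beta>) / K" by simp
    ultimately have "\<bar>deviation t g x / K\<bar> \<le> C * exp (- \<gamma> * t) * \<psi> x"
      using K by (simp add: deviation_def diff_divide_distrib)
    then show ?thesis using K by (simp add: abs_divide divide_le_eq)
  qed
qed

lemma transition_0:
  assumes "x \<in> space E" "g \<in> borel_measurable E"
  shows "transition 0 g x = g x"
  using integral_at_time_0[OF assms, of "\<lambda>_. 1"] prob_space.prob_space[OF prob_space_Q[OF assms(1)]]
  by (simp add: transition_def)

text \<open>
At time 0 the law of the process is a point mass, so the ergodicity bound compares \<open>\<beta>\<close> with a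
Dirac measure: the integrals of the bounded truncations \<open>min \<psi> n\<close> stay below \<open>(1 + C) * \<psi> x\<close>, and
monotone convergence applies.
\<close>

lemma integrable_\<psi>: "integrable \<beta> \<psi>"
proof -
  obtain x where x: "x \<in> space E" using \<beta>.not_empty space_\<beta> by auto
  let ?g = "\<lambda>n y. min (\<psi> y) (real n)"
  have g_bd: "\<bar>?g n y\<bar> \<le> 1 * \<psi> y" "\<bar>?g n y\<bar> \<le> real n" if "y \<in> space E" for n y
    using \<psi>_pos[OF that] by auto
  have int: "integrable \<beta> (?g n)" for n
    by (rule integrable_\<beta>_bounded[OF _ g_bd(2)]) auto
  have le: "(\<integral>y. ?g n y \<partial>\<beta>) \<le> (1 + C) * \<psi> x" for n
  proof -
    have "\<bar>deviation 0 (?g n) x\<bar> \<le> C * exp (- \<gamma> * 0) * \<psi> x * 1"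
      by (rule deviation_abs_le[OF x order_refl _ g_bd(1)]) auto
    then have "\<bar>?g n x - (\<integral>y. ?g n y \<partial>\<beta>)\<bar> \<le> C * \<psi> x"
      using transition_0[OF x, of "?g n"] by (simp add: deviation_def)
    then show ?thesis using \<psi>_pos[OF x] by (simp add: algebra_simps)
  qed
  have "incseq (\<lambda>n. \<integral>y. ?g n y \<partial>\<beta>)"
    by (rule incseq_SucI, rule integral_mono[OF int int]) auto
  then obtain l where l: "(\<lambda>n. \<integral>y. ?g n y \<partial>\<beta>) \<longlonglongrightarrow> l"
    using incseq_convergent[of _ "(1 + C) * \<psi> x"] le by blast
  show ?thesis
  proof (rule integrable_monotone_convergence[OF int _ _ l])
    show "AE y in \<beta>. mono (\<lambda>n. ?g n y)" by (auto simp: mono_def)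
    show "AE y in \<beta>. (\<lambda>n. ?g n y) \<longlonglongrightarrow> \<psi> y"
    proof (rule AE_I2)
      fix y
      have "eventually (\<lambda>n. ?g n y = \<psi> y) sequentially"
        using eventually_ge_at_top[of "nat \<lceil>\<psi> y\<rceil>"] by eventually_elim linarith
      then show "(\<lambda>n. ?g n y) \<longlonglongrightarrow> \<psi> y" by (rule tendsto_eventually)
    qed
    show "\<psi> \<in> borel_measurable \<beta>" by (simp add: measurable_\<beta>)
  qed
qed

lemma integral_transition:
  assumes t: "0 \<le> t" and g: "g \<in> borel_measurable E" "\<And>y. y \<in> space E \<Longrightarrow> \<bar>g y\<bar> \<le> K"
  shows "(\<integral>x. transition t g x \<partial>\<beta>) = (\<integral>x. g x \<partial>\<beta>)"
proof -
  have X: "X t \<in> (\<beta> \<bind> Q) \<rightarrow>\<^sub>M E"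
    using measurable_X[OF t] by (simp add: measurable_cong_sets[OF sets_bind'[OF \<beta>_prob_algebra kernel] refl])
  have "(\<integral>x. transition t g x \<partial>\<beta>) = (\<integral>\<omega>. g (X t \<omega>) \<partial>(\<beta> \<bind> Q))"
    unfolding transition_def
    by (rule integral_initial_law[symmetric, OF \<beta>_prob_algebra, of _ K])
       (use g X_in_space[OF t] measurable_compose[OF measurable_X[OF t] g(1)] in auto)
  also have "\<dots> = (\<integral>x. g x \<partial>distr (\<beta> \<bind> Q) E (X t))"
    by (rule integral_distr[OF X g(1), symmetric])
  also have "distr (\<beta> \<bind> Q) E (X t) = \<beta>"
    using invariant t by (simp add: invariant_prob_def)
  finally show ?thesis .
qed

text \<open>
\<open>\<alpha>\<close> is the total mass of the decay \<open>C * exp (- \<gamma> * t)\<close> and \<open>B\<close> the mean of \<open>\<psi> / c\<close>. The time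
scale \<open>a\<close> is the base of the powers in the claimed constants: \<open>a\<^sup>k\<^sup>-\<^sup>1\<close> is the maximum of \<open>1\<close> and
\<open>(\<alpha> * (1 + B))\<^sup>k\<^sup>-\<^sup>1\<close>.
\<close>

definition \<alpha> :: real where "\<alpha> = C / \<gamma>"
definition B :: real where "B = (\<integral>x. \<psi> x \<partial>\<beta>) / c"
definition a :: real where "a = max 1 (\<alpha> * (1 + B))"

lemma \<beta>\<psi>: "(\<integral>x. \<psi> x \<partial>\<beta>) = c * B"
  using c_pos by (simp add: B_def)

lemma B_ge_1: "1 \<le> B"
proof -
  have "(\<integral>x. c \<partial>\<beta>) \<le> (\<integral>x. \<psi> x \<partial>\<beta>)"
    by (rule integral_mono) (use integrable_\<psi> \<psi>_ge space_\<beta> in auto)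
  then show ?thesis using c_pos by (simp add: B_def \<beta>.prob_space field_simps)
qed

lemma \<alpha>_pos: "0 < \<alpha>" using C_pos \<gamma>_pos by (simp add: \<alpha>_def)

lemma \<gamma>\<alpha>: "\<gamma> * \<alpha> = C" using \<gamma>_pos by (simp add: \<alpha>_def)

lemma a_ge_1: "1 \<le> a" and a_ge: "\<alpha> * (1 + B) \<le> a" by (auto simp: a_def)

lemma a_ge_\<alpha>B: "\<alpha> * B \<le> a"
  using a_ge \<alpha>_pos by (simp add: algebra_simps)

lemma integral_abs_le_\<psi>:
  fixes g :: "'e \<Rightarrow> real"
  assumes "\<And>x. x \<in> space E \<Longrightarrow> \<bar>g x\<bar> \<le> K * \<psi> x"
  shows "\<bar>\<integral>x. g x \<partial>\<beta>\<bar> \<le> K * (c * B)"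
proof -
  have "\<bar>LINT x:space \<beta>|\<beta>. g x\<bar> \<le> (LINT x:space \<beta>|\<beta>. K * \<psi> x)"
  proof (rule set_integral_abs_le)
    show "set_integrable \<beta> (space \<beta>) (\<lambda>x. K * \<psi> x)"
      unfolding set_integrable_def using integrable_\<psi> by (intro integrable_mult_indicator) auto
  qed (use assms in \<open>simp add: space_\<beta>\<close>)
  moreover have "(LINT x:space \<beta>|\<beta>. h x) = (\<integral>x. h x \<partial>\<beta>)" for h :: "'e \<Rightarrow> real"
    unfolding set_lebesgue_integral_def by (rule Bochner_Integration.integral_cong) auto
  ultimately show ?thesis by (simp add: \<beta>\<psi>)
qed

lemma a_pos: "0 < a" using a_ge_1 by simp

lemma B_pos: "0 < B" using B_ge_1 by simp

text \<open>
This value makes the error recursion close: one step turns an error \<open>W\<close> into at most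
\<open>\<alpha> * (B * W + 1 + 2 * B / \<gamma>) \<le> \<alpha> * (1 + B) * W \<le> a * W\<close>.
\<close>

definition W :: real where "W = (1 + B) * (1 + 2 / \<gamma>)"

lemma W_ge_1: "1 \<le> W" and W_ge: "1 / \<gamma> \<le> W" "1 + 2 * B / \<gamma> \<le> W"
  and W_pos: "0 < W"
proof -
  have *: "W = 1 + B + 2 / \<gamma> + 2 * B / \<gamma>" by (simp add: W_def algebra_simps)
  have "0 \<le> 1 / \<gamma>" "0 \<le> 2 / \<gamma>" "0 \<le> 2 * B / \<gamma>" "1 / \<gamma> \<le> 2 / \<gamma>"
    using \<gamma>_pos B_pos by (auto simp: divide_right_mono)
  then show "1 \<le> W" "1 / \<gamma> \<le> W" "1 + 2 * B / \<gamma> \<le> W" "0 < W"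
    unfolding * using B_pos by linarith+
qed

text \<open>
A factor \<open>1 + W\<close> from the error of the mean and the centred part, and \<open>a\<^sup>2 / c\<close> to pass from
\<open>a\<^sup>2\<^sup>k (t / a)\<^sup>k\<^sup>-\<^sup>1\<close> to \<open>a\<^sup>k\<^sup>-\<^sup>1 t\<^sup>k\<^sup>-\<^sup>1\<close> and from \<open>1\<close> to \<open>\<psi>\<close>.
\<close>

definition moment_error_const :: real where "moment_error_const = (1 + W) * a ^ 2 / c"

lemma moment_error_const_pos: "0 < moment_error_const"
  using W_pos a_pos c_pos by (simp add: moment_error_const_def)

end

section \<open>Mean and centred part of the moments\<close>

locale ergodic_functional = weighted_ergodic E M X Q \<beta> \<psi> c C \<gamma> + markov_functional E M X Q f
  for E :: "'e measure" and M :: "'w measure" and X :: "real \<Rightarrow> 'w \<Rightarrow> 'e" and Q :: "'e \<Rightarrow> 'w measure"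
    and \<beta> :: "'e measure" and \<psi> :: "'e \<Rightarrow> real" and c C \<gamma> :: real and f :: "'e \<Rightarrow> real" +
  assumes centred_f: "(\<integral>x. f x \<partial>\<beta>) = 0"
begin

definition mean :: "nat \<Rightarrow> real \<Rightarrow> real" where
  "mean n t = (\<integral>x. moment n t x \<partial>\<beta>)"

definition centred :: "nat \<Rightarrow> real \<Rightarrow> 'e \<Rightarrow> real" where
  "centred n t x = moment n t x - mean n t"

definition correlation :: "real \<Rightarrow> real" where
  "correlation u = (\<integral>x. f x * transition u f x \<partial>\<beta>)"

definition total_correlation :: real where
  "total_correlation = (LINT u:{0..}|lborel. correlation u)"

lemma borel_measurable_mean[measurable (raw)]:
  assumes [measurable]: "\<tau> \<in> borel_measurable N"
  shows "(\<lambda>p. mean n (\<tau> p)) \<in> borel_measurable N"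
proof -
  have "(\<lambda>(t, x). moment n t x) \<in> borel_measurable (borel \<Otimes>\<^sub>M E)" by measurable
  then have [measurable]: "(\<lambda>(t, x). moment n t x) \<in> borel_measurable (borel \<Otimes>\<^sub>M \<beta>)"
    by (simp add: measurable_cong_sets[OF sets_pair_measure_cong[OF refl sets_\<beta>] refl])
  have "mean n \<in> borel_measurable borel"
    unfolding mean_def by measurable
  then show ?thesis by measurable
qed

lemma borel_measurable_centred[measurable (raw)]:
  assumes [measurable]: "\<tau> \<in> borel_measurable N" "\<xi> \<in> N \<rightarrow>\<^sub>M E"
  shows "(\<lambda>p. centred n (\<tau> p) (\<xi> p)) \<in> borel_measurable N"
  unfolding centred_def by measurable

lemma integrable_moment: "0 \<le> t \<Longrightarrow> integrable \<beta> (moment n t)"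
  by (rule integrable_\<beta>_bounded[OF _ moment_abs_le]) auto

lemma mean_abs_le:
  assumes "0 \<le> t"
  shows "\<bar>mean n t\<bar> \<le> t ^ n / fact n"
proof -
  have "\<bar>mean n t\<bar> \<le> (\<integral>x. \<bar>moment n t x\<bar> \<partial>\<beta>)"
    unfolding mean_def by (rule integral_abs_bound)
  also have "\<dots> \<le> (\<integral>x. t ^ n / fact n \<partial>\<beta>)"
    by (rule integral_mono) (use assms in \<open>auto intro!: integrable_abs integrable_moment moment_abs_le simp: space_\<beta>\<close>)
  finally show ?thesis by (simp add: \<beta>.prob_space)
qed

lemma centred_abs_le:
  assumes "x \<in> space E" "0 \<le> u" "u \<le> t"
  shows "\<bar>centred n u x\<bar> \<le> 2 * (t ^ n / fact n)"
proof -
  have "\<bar>centred n u x\<bar> \<le> 2 * (u ^ n / fact n)"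
    using moment_abs_le[OF assms(1,2), of n] mean_abs_le[OF assms(2), of n] by (simp add: centred_def)
  also have "\<dots> \<le> 2 * (t ^ n / fact n)"
    using assms by (auto intro!: divide_right_mono power_mono)
  finally show ?thesis .
qed

lemma f_centred_abs_le:
  assumes "x \<in> space E" "0 \<le> u" "u \<le> t"
  shows "\<bar>f x * centred n u x\<bar> \<le> 2 * (t ^ n / fact n)"
  using mult_mono[OF f_abs_le[OF assms(1)] centred_abs_le[OF assms, of n]] by (simp add: abs_mult)

lemma f_le_\<psi>:
  assumes "x \<in> space E"
  shows "\<bar>f x\<bar> \<le> 1 / c * \<psi> x"
proof -
  have "1 \<le> 1 / c * \<psi> x" using \<psi>_ge[OF assms] c_pos by (simp add: field_simps)
  with f_abs_le[OF assms] show ?thesis by linarith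
qed

lemma mult_f_abs_le: "x \<in> space E \<Longrightarrow> \<bar>g\<bar> \<le> K \<Longrightarrow> \<bar>f x * g\<bar> \<le> K"
  using mult_mono[OF f_abs_le[of x], of "\<bar>g\<bar>" K] by (simp add: abs_mult)

lemma mean_0: "mean 0 t = 1"
proof -
  have "mean 0 t = (\<integral>x. 1 \<partial>\<beta>)"
    unfolding mean_def by (rule Bochner_Integration.integral_cong) (auto simp: moment_0 space_\<beta>)
  then show ?thesis by (simp add: \<beta>.prob_space)
qed

lemma centred_0: "x \<in> space E \<Longrightarrow> centred 0 t x = 0"
  by (simp add: centred_def moment_0 mean_0)

text \<open>
The mean part drops out because \<open>f\<close> is centred; this is why a mean gains a power of \<open>t\<close> only in
every second step.
\<close>

lemma integral_f_moment:
  assumes "0 \<le> t"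
  shows "(\<integral>y. f y * moment n t y \<partial>\<beta>) = (\<integral>y. f y * centred n t y \<partial>\<beta>)"
proof -
  have "(\<integral>y. f y * moment n t y \<partial>\<beta>) = (\<integral>y. f y * centred n t y + mean n t * f y \<partial>\<beta>)"
    by (rule Bochner_Integration.integral_cong) (auto simp: centred_def algebra_simps)
  also have "\<dots> = (\<integral>y. f y * centred n t y \<partial>\<beta>) + (\<integral>y. mean n t * f y \<partial>\<beta>)"
  proof (rule Bochner_Integration.integral_add)
    show "integrable \<beta> (\<lambda>y. f y * centred n t y)"
      by (rule integrable_\<beta>_bounded[OF _ f_centred_abs_le[OF _ assms order_refl]]) auto
    show "integrable \<beta> (\<lambda>y. mean n t * f y)"
      by (intro integrable_mult_right integrable_\<beta>_bounded[OF _ f_abs_le]) auto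
  qed
  finally show ?thesis by (simp add: centred_f)
qed

text \<open>
Integrating the recursion for the moments against the invariant law removes the transition.
\<close>

lemma
  assumes t: "0 \<le> t"
  shows mean_Suc: "mean (Suc n) t = (LINT s:{0..t}|lborel. \<integral>y. f y * centred n s y \<partial>\<beta>)"
    and set_integrable_f_centred:
      "set_integrable lborel {0..t} (\<lambda>s. \<integral>y. f y * centred n s y \<partial>\<beta>)"
proof -
  have "mean (Suc n) t = (\<integral>x. (LINT u:{0..t}|lborel. transition u (\<lambda>y. f y * moment n (t - u) y) x) \<partial>\<beta>)"
    unfolding mean_def
    by (rule Bochner_Integration.integral_cong) (auto simp: moment_Suc[OF _ t] space_\<beta>)
  also have "\<dots> = (LINT u:{0..t}|lborel. \<integral>x. transition u (\<lambda>y. f y * moment n (t - u) y) x \<partial>\<beta>)"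
  proof (rule integral_interval_swap[OF \<beta>.finite_measure_axioms])
    note [measurable] = borel_measurable_moment_transition[of n t]
    have "(\<lambda>(u, x). indicator {0..t} u * transition (max 0 u) (\<lambda>y. f y * moment n (t - u) y) x)
        \<in> borel_measurable (borel \<Otimes>\<^sub>M E)" by measurable
    also have "(\<lambda>(u, x). indicator {0..t} u * transition (max 0 u) (\<lambda>y. f y * moment n (t - u) y) x)
        = (\<lambda>(u, x). indicator {0..t} u * transition u (\<lambda>y. f y * moment n (t - u) y) x)"
      by (auto simp: max_def split: split_indicator)
    finally show "(\<lambda>(u, x). indicator {0..t} u * transition u (\<lambda>y. f y * moment n (t - u) y) x)
        \<in> borel_measurable (borel \<Otimes>\<^sub>M \<beta>)"
      by (simp add: measurable_cong_sets[OF sets_pair_measure_cong[OF refl sets_\<beta>] refl])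
    show "\<bar>transition u (\<lambda>y. f y * moment n (t - u) y) x\<bar> \<le> t ^ n / fact n"
      if "u \<in> {0..t}" "x \<in> space \<beta>" for u x
      by (rule transition_abs_le) (use that in \<open>auto simp: space_\<beta> intro!: f_moment_abs_le\<close>)
  qed
  also have "\<dots> = (LINT u:{0..t}|lborel. \<integral>y. f y * centred n (t - u) y \<partial>\<beta>)"
  proof (rule set_lebesgue_integral_cong; (intro allI impI)?)
    fix u assume u: "u \<in> {0..t}"
    have "(\<integral>x. transition u (\<lambda>y. f y * moment n (t - u) y) x \<partial>\<beta>) = (\<integral>y. f y * moment n (t - u) y \<partial>\<beta>)"
      by (rule integral_transition[OF _ _ f_moment_abs_le[of _ _ t]]) (use u in auto)
    then show "(\<integral>x. transition u (\<lambda>y. f y * moment n (t - u) y) x \<partial>\<beta>) = (\<integral>y. f y * centred n (t - u) y \<partial>\<beta>)"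
      using integral_f_moment[of "t - u" n] u by simp
  qed simp
  also have "\<dots> = (LINT s:{0..t}|lborel. \<integral>y. f y * centred n s y \<partial>\<beta>)"
    by (rule set_integral_interval_reflect)
  finally show "mean (Suc n) t = (LINT s:{0..t}|lborel. \<integral>y. f y * centred n s y \<partial>\<beta>)" .
  show "set_integrable lborel {0..t} (\<lambda>s. \<integral>y. f y * centred n s y \<partial>\<beta>)"
  proof (rule set_integrable_integral_interval[OF \<beta>.finite_measure_axioms])
    have "(\<lambda>(s, y). indicator {0..t} s * (f y * centred n s y)) \<in> borel_measurable (borel \<Otimes>\<^sub>M E)"
      by measurable
    then show "(\<lambda>(s, y). indicator {0..t} s * (f y * centred n s y)) \<in> borel_measurable (borel \<Otimes>\<^sub>M \<beta>)"
      by (simp add: measurable_cong_sets[OF sets_pair_measure_cong[OF refl sets_\<beta>] refl])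
    show "\<bar>f y * centred n s y\<bar> \<le> 2 * (t ^ n / fact n)" if "s \<in> {0..t}" "y \<in> space \<beta>" for s y
      by (rule f_centred_abs_le) (use that in \<open>auto simp: space_\<beta>\<close>)
  qed
qed

lemma deviation_f: "deviation u f x = transition u f x"
  by (simp add: deviation_def centred_f)

text \<open>
Subtracting the mean turns every transition in the recursion into a deviation from equilibrium,
and splitting \<open>f * moment\<close> into its mean and centred parts separates the two sources: the decay of
\<open>f\<close> itself, weighted with the mean, and the decay of the previous centred part.
\<close>

lemma centred_Suc:
  assumes x: "x \<in> space E" and t: "0 \<le> t"
  shows "centred (Suc n) t x = (LINT u:{0..t}|lborel.
    mean n (t - u) * transition u f x + deviation u (\<lambda>y. f y * centred n (t - u) y) x)"
proof -
  let ?m = "\<lambda>u y. f y * moment n (t - u) y"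
  have "set_integrable lborel {0..t} (\<lambda>u. transition u (?m u) x)"
  proof (rule set_integrable_interval_bounded)
    have "(\<lambda>u. transition (max 0 u) (\<lambda>y. f y * moment n (t - u) y) x) \<in> borel_measurable borel"
      using measurable_compose[OF measurable_Pair2'[OF x] borel_measurable_moment_transition]
      by (intro borel_measurable_transition) (use x in measurable)
    then have "(\<lambda>u. indicator {0..t} u *\<^sub>R transition (max 0 u) (\<lambda>y. f y * moment n (t - u) y) x)
        \<in> borel_measurable lborel" by measurable
    also have "(\<lambda>u. indicator {0..t} u *\<^sub>R transition (max 0 u) (\<lambda>y. f y * moment n (t - u) y) x)
        = (\<lambda>u. indicator {0..t} u *\<^sub>R transition u (?m u) x)"
      by (auto simp: max_def split: split_indicator)
    finally show "set_borel_measurable lborel {0..t} (\<lambda>u. transition u (?m u) x)"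
      by (simp add: set_borel_measurable_def)
    show "\<bar>transition u (?m u) x\<bar> \<le> t ^ n / fact n" if "u \<in> {0..t}" for u
      by (rule transition_abs_le[OF x]) (use that in \<open>auto intro!: f_moment_abs_le\<close>)
  qed
  moreover have "set_integrable lborel {0..t} (\<lambda>u. \<integral>y. f y * centred n (t - u) y \<partial>\<beta>)"
  proof -
    have "integrable lborel (\<lambda>u. indicator {0..t} (t - u) *\<^sub>R (\<integral>y. f y * centred n (t - u) y \<partial>\<beta>))"
      using lborel_integrable_real_affine[OF set_integrable_f_centred[OF t, unfolded set_integrable_def],
          where c = "-1" and t = t] by simp
    moreover have "indicator {0..t} (t - u) = indicat_real {0..t} u" for u
      by (auto split: split_indicator)
    ultimately show ?thesis by (simp add: set_integrable_def)
  qed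
  ultimately have "centred (Suc n) t x
      = (LINT u:{0..t}|lborel. transition u (?m u) x - (\<integral>y. f y * centred n (t - u) y \<partial>\<beta>))"
    unfolding centred_def[of "Suc n"] moment_Suc[OF x t] mean_Suc[OF t]
    by (simp add: set_integral_diff(2) set_integral_interval_reflect[where t = t, symmetric,
          of "\<lambda>s. \<integral>y. f y * centred n s y \<partial>\<beta>"])
  also have "\<dots> = (LINT u:{0..t}|lborel.
    mean n (t - u) * transition u f x + deviation u (\<lambda>y. f y * centred n (t - u) y) x)"
  proof (rule set_lebesgue_integral_cong; (intro allI impI)?)
    fix u assume u: "u \<in> {0..t}"
    have "transition u (?m u) x = transition u (\<lambda>y. mean n (t - u) * f y + 1 * (f y * centred n (t - u) y)) x"
      by (rule transition_cong[OF x]) (use u in \<open>auto simp: centred_def algebra_simps\<close>)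
    also have "\<dots> = mean n (t - u) * transition u f x + 1 * transition u (\<lambda>y. f y * centred n (t - u) y) x"
      by (rule transition_linear[OF x _ _ f_abs_le _ f_centred_abs_le[of _ _ t]]) (use u in auto)
    finally show "transition u (?m u) x - (\<integral>y. f y * centred n (t - u) y \<partial>\<beta>)
        = mean n (t - u) * transition u f x + deviation u (\<lambda>y. f y * centred n (t - u) y) x"
      by (simp add: deviation_def)
  qed simp
  finally show ?thesis .
qed

lemma borel_measurable_deviation_centred:
  "(\<lambda>(u, x). deviation (max 0 u) (\<lambda>y. f y * centred n (t - u) y) x) \<in> borel_measurable (borel \<Otimes>\<^sub>M E)"
proof -
  have [measurable]: "(\<lambda>p. transition (max 0 (fst p)) (\<lambda>y. f y * centred n (t - fst p) y) (snd p))
      \<in> borel_measurable (borel \<Otimes>\<^sub>M E)"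
    by (rule borel_measurable_transition) measurable
  have "(\<lambda>(u, y). f y * centred n (t - u) y) \<in> borel_measurable (borel \<Otimes>\<^sub>M E)" by measurable
  then have [measurable]: "(\<lambda>(u, y). f y * centred n (t - u) y) \<in> borel_measurable (borel \<Otimes>\<^sub>M \<beta>)"
    by (simp add: measurable_cong_sets[OF sets_pair_measure_cong[OF refl sets_\<beta>] refl])
  have [measurable]: "(\<lambda>u. \<integral>y. f y * centred n (t - u) y \<partial>\<beta>) \<in> borel_measurable borel"
    by measurable
  have "(\<lambda>p. transition (max 0 (fst p)) (\<lambda>y. f y * centred n (t - fst p) y) (snd p)
        - (\<integral>y. f y * centred n (t - fst p) y \<partial>\<beta>)) \<in> borel_measurable (borel \<Otimes>\<^sub>M E)"
    by measurable
  then show ?thesis by (simp add: deviation_def case_prod_beta')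
qed

lemma borel_measurable_transition_f:
  "(\<lambda>(u, x). transition (max 0 u) f x) \<in> borel_measurable (borel \<Otimes>\<^sub>M E)"
proof -
  have "(\<lambda>p. transition (max 0 (fst p)) f (snd p)) \<in> borel_measurable (borel \<Otimes>\<^sub>M E)"
    by (rule borel_measurable_transition) measurable
  then show ?thesis by (simp add: case_prod_beta')
qed

lemma deviation_centred_abs_le:
  assumes "x \<in> space E" "0 \<le> u" "u \<le> t"
  shows "\<bar>deviation u (\<lambda>y. f y * centred n (t - u) y) x\<bar> \<le> 4 * (t ^ n / fact n)"
proof -
  have 1: "\<bar>transition u (\<lambda>y. f y * centred n (t - u) y) x\<bar> \<le> 2 * (t ^ n / fact n)"
    by (rule transition_abs_le[OF assms(1,2) _ f_centred_abs_le]) (use assms in auto)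
  have "\<bar>\<integral>y. f y * centred n (t - u) y \<partial>\<beta>\<bar> \<le> (\<integral>y. \<bar>f y * centred n (t - u) y\<bar> \<partial>\<beta>)"
    by (rule integral_abs_bound)
  also have "\<dots> \<le> (\<integral>y. 2 * (t ^ n / fact n) \<partial>\<beta>)"
  proof (rule integral_mono)
    show "integrable \<beta> (\<lambda>y. \<bar>f y * centred n (t - u) y\<bar>)"
      by (intro integrable_abs integrable_\<beta>_bounded[OF _ f_centred_abs_le[of _ _ t]]) (use assms in auto)
    show "\<bar>f y * centred n (t - u) y\<bar> \<le> 2 * (t ^ n / fact n)" if "y \<in> space \<beta>" for y
      by (rule f_centred_abs_le) (use assms that in \<open>auto simp: space_\<beta>\<close>)
  qed simp
  finally have "\<bar>\<integral>y. f y * centred n (t - u) y \<partial>\<beta>\<bar> \<le> 2 * (t ^ n / fact n)"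
    by (simp add: \<beta>.prob_space)
  with 1 show ?thesis by (simp add: deviation_def)
qed

text \<open>
Integrated against \<open>f\<close>, the first source becomes the stationary correlation of \<open>f\<close>, which is
where the asymptotic variance comes from.
\<close>

lemma integral_f_centred_Suc:
  assumes s: "0 \<le> s"
  shows "(\<integral>x. f x * centred (Suc n) s x \<partial>\<beta>) = (LINT u:{0..s}|lborel.
      mean n (s - u) * correlation u + (\<integral>x. f x * deviation u (\<lambda>y. f y * centred n (s - u) y) x \<partial>\<beta>))"
    and "set_integrable lborel {0..s} (\<lambda>u.
      mean n (s - u) * correlation u + (\<integral>x. f x * deviation u (\<lambda>y. f y * centred n (s - u) y) x \<partial>\<beta>))"
proof -
  let ?d = "\<lambda>u x. deviation u (\<lambda>y. f y * centred n (s - u) y) x"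
  let ?I = "\<lambda>u x. f x * (mean n (s - u) * transition u f x + ?d u x)"
  have I_eq: "(\<integral>x. ?I u x \<partial>\<beta>) = mean n (s - u) * correlation u + (\<integral>x. f x * ?d u x \<partial>\<beta>)"
    if u: "u \<in> {0..s}" for u
  proof -
    have tr: "transition u f \<in> borel_measurable E"
      by (rule borel_measurable_transition_fixed) (use u in auto)
    have dm: "?d u \<in> borel_measurable E"
      using measurable_compose[OF measurable_Pair1'[of u borel E] borel_measurable_deviation_centred[of n s]] u
      by (simp add: max_def)
    have "(\<integral>x. ?I u x \<partial>\<beta>) = (\<integral>x. mean n (s - u) * (f x * transition u f x) + f x * ?d u x \<partial>\<beta>)"
      by (rule Bochner_Integration.integral_cong) (auto simp: algebra_simps)
    also have "\<dots> = (\<integral>x. mean n (s - u) * (f x * transition u f x) \<partial>\<beta>) + (\<integral>x. f x * ?d u x \<partial>\<beta>)"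
    proof (rule Bochner_Integration.integral_add)
      show "integrable \<beta> (\<lambda>x. mean n (s - u) * (f x * transition u f x))"
        by (intro integrable_mult_right integrable_\<beta>_bounded[OF _ mult_f_abs_le[OF _ transition_abs_le[OF _ _ _ f_abs_le]]])
           (use u tr in auto)
      show "integrable \<beta> (\<lambda>x. f x * ?d u x)"
        by (intro integrable_\<beta>_bounded[OF _ mult_f_abs_le[OF _ deviation_centred_abs_le]])
           (use u dm in auto)
    qed
    finally show ?thesis by (simp add: correlation_def)
  qed
  have meas: "(\<lambda>(u, x). indicator {0..s} u * ?I u x) \<in> borel_measurable (borel \<Otimes>\<^sub>M \<beta>)"
  proof -
    note [measurable] = borel_measurable_deviation_centred[of n s] borel_measurable_transition_f
    have "(\<lambda>(u, x). indicator {0..s} u * (f x * (mean n (s - u) * transition (max 0 u) f x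
        + deviation (max 0 u) (\<lambda>y. f y * centred n (s - u) y) x))) \<in> borel_measurable (borel \<Otimes>\<^sub>M E)"
      by measurable
    also have "(\<lambda>(u, x). indicator {0..s} u * (f x * (mean n (s - u) * transition (max 0 u) f x
        + deviation (max 0 u) (\<lambda>y. f y * centred n (s - u) y) x)))
        = (\<lambda>(u, x). indicator {0..s} u * ?I u x)"
      by (auto simp: max_def split: split_indicator)
    finally show ?thesis
      by (simp add: measurable_cong_sets[OF sets_pair_measure_cong[OF refl sets_\<beta>] refl])
  qed
  have bound: "\<bar>?I u x\<bar> \<le> 5 * (s ^ n / fact n)" if u: "u \<in> {0..s}" and "x \<in> space \<beta>" for u x
  proof (rule mult_f_abs_le)
    show x: "x \<in> space E" using that by (simp add: space_\<beta>)
    have "\<bar>mean n (s - u)\<bar> \<le> s ^ n / fact n"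
      by (rule order_trans[OF mean_abs_le]) (use u in \<open>auto intro!: divide_right_mono power_mono\<close>)
    moreover have "\<bar>transition u f x\<bar> \<le> 1"
      by (rule transition_abs_le[OF x]) (use u in \<open>auto intro: f_abs_le\<close>)
    ultimately have "\<bar>mean n (s - u) * transition u f x\<bar> \<le> s ^ n / fact n * 1"
      unfolding abs_mult by (intro mult_mono) auto
    moreover have "\<bar>?d u x\<bar> \<le> 4 * (s ^ n / fact n)"
      by (rule deviation_centred_abs_le[OF x]) (use u in auto)
    ultimately show "\<bar>mean n (s - u) * transition u f x + ?d u x\<bar> \<le> 5 * (s ^ n / fact n)"
      by linarith
  qed
  have "(\<integral>x. f x * centred (Suc n) s x \<partial>\<beta>) = (\<integral>x. (LINT u:{0..s}|lborel. ?I u x) \<partial>\<beta>)"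
    by (rule Bochner_Integration.integral_cong)
       (auto simp: centred_Suc[OF _ s] space_\<beta> set_integral_mult_right[symmetric] simp del: set_integral_mult_right)
  also have "\<dots> = (LINT u:{0..s}|lborel. \<integral>x. ?I u x \<partial>\<beta>)"
    by (rule integral_interval_swap[OF \<beta>.finite_measure_axioms meas bound])
  also have "\<dots> = (LINT u:{0..s}|lborel. mean n (s - u) * correlation u + (\<integral>x. f x * ?d u x \<partial>\<beta>))"
    by (rule set_lebesgue_integral_cong) (auto simp: I_eq)
  finally show "(\<integral>x. f x * centred (Suc n) s x \<partial>\<beta>)
      = (LINT u:{0..s}|lborel. mean n (s - u) * correlation u + (\<integral>x. f x * ?d u x \<partial>\<beta>))" .
  have "set_integrable lborel {0..s} (\<lambda>u. \<integral>x. ?I u x \<partial>\<beta>)"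
    by (rule set_integrable_integral_interval[OF \<beta>.finite_measure_axioms meas bound])
  then show "set_integrable lborel {0..s} (\<lambda>u. mean n (s - u) * correlation u + (\<integral>x. f x * ?d u x \<partial>\<beta>))"
    by (subst (asm) set_integrable_cong[OF refl refl I_eq]) auto
qed

lemma correlation_abs_le:
  assumes u: "0 \<le> u"
  shows "\<bar>correlation u\<bar> \<le> \<alpha> * B * (\<gamma> * exp (- \<gamma> * u))"
proof -
  have "\<bar>correlation u\<bar> \<le> C * exp (- \<gamma> * u) / c * (c * B)"
    unfolding correlation_def
  proof (rule integral_abs_le_\<psi>, rule mult_f_abs_le)
    fix x assume x: "x \<in> space E"
    have "\<bar>deviation u f x\<bar> \<le> C * exp (- \<gamma> * u) * \<psi> x * (1 / c)"
      by (rule deviation_abs_le[OF x u measurable_f f_le_\<psi>])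
    then show "\<bar>transition u f x\<bar> \<le> C * exp (- \<gamma> * u) / c * \<psi> x"
      by (simp add: deviation_f)
  qed
  also have "\<dots> = (\<gamma> * \<alpha>) * exp (- \<gamma> * u) * B"
    using c_pos by (simp add: \<gamma>\<alpha>)
  finally show ?thesis by (simp only: mult_ac)
qed

lemma borel_measurable_correlation: "(\<lambda>u. correlation (max 0 u)) \<in> borel_measurable borel"
proof -
  note [measurable] = borel_measurable_transition_f
  have "(\<lambda>(u, x). f x * transition (max 0 u) f x) \<in> borel_measurable (borel \<Otimes>\<^sub>M E)"
    by measurable
  then have [measurable]: "(\<lambda>(u, x). f x * transition (max 0 u) f x) \<in> borel_measurable (borel \<Otimes>\<^sub>M \<beta>)"
    by (simp add: measurable_cong_sets[OF sets_pair_measure_cong[OF refl sets_\<beta>] refl])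
  show ?thesis unfolding correlation_def by measurable
qed

lemma set_integrable_correlation: "set_integrable lborel {0..} correlation"
proof (rule set_integrable_bound)
  show "set_integrable lborel {0..} (\<lambda>u. \<alpha> * B * (\<gamma> * exp (- \<gamma> * u)))"
    using set_integrable_exp_decay[OF \<gamma>_pos, of 0] by (rule set_integrable_mult_right)
  have "(\<lambda>u. indicator {0..} u *\<^sub>R correlation (max 0 u)) \<in> borel_measurable lborel"
    using borel_measurable_correlation by measurable
  also have "(\<lambda>u. indicator {0..} u *\<^sub>R correlation (max 0 u)) = (\<lambda>u. indicator {0..} u *\<^sub>R correlation u)"
    by (auto simp: max_def split: split_indicator)
  finally show "set_borel_measurable lborel {0..} correlation"
    by (simp add: set_borel_measurable_def)
  show "AE u in lborel. u \<in> {0..} \<longrightarrow> norm (correlation u) \<le> norm (\<alpha> * B * (\<gamma> * exp (- \<gamma> * u)))"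
    unfolding real_norm_def
    by (intro AE_I2 impI, rule order_trans[OF correlation_abs_le abs_ge_self]) simp
qed

lemma total_correlation_tail:
  assumes "0 \<le> s"
  shows "\<bar>total_correlation - (LINT u:{0..s}|lborel. correlation u)\<bar> \<le> \<alpha> * B * exp (- \<gamma> * s)"
proof -
  have "(LINT u:{0..s} \<union> {s..}|lborel. correlation u)
      = (LINT u:{0..s}|lborel. correlation u) + (LINT u:{s..}|lborel. correlation u)"
  proof (rule set_integral_Un_AE)
    show "AE u in lborel. \<not> (u \<in> {0..s} \<and> u \<in> {s..})"
      using AE_lborel_singleton[of s] by eventually_elim auto
  qed (use assms in \<open>auto intro: set_integrable_subset[OF set_integrable_correlation]\<close>)
  moreover have "{0..s} \<union> {s..} = {0..}" using assms by auto
  ultimately have split: "total_correlation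
      = (LINT u:{0..s}|lborel. correlation u) + (LINT u:{s..}|lborel. correlation u)"
    by (simp add: total_correlation_def)
  have "\<bar>LINT u:{s..}|lborel. correlation u\<bar> \<le> (LINT u:{s..}|lborel. \<alpha> * B * (\<gamma> * exp (- \<gamma> * u)))"
  proof (rule set_integral_abs_le)
    show "set_integrable lborel {s..} (\<lambda>u. \<alpha> * B * (\<gamma> * exp (- \<gamma> * u)))"
      by (rule set_integrable_mult_right[OF set_integrable_exp_decay[OF \<gamma>_pos]])
    show "\<bar>correlation u\<bar> \<le> \<alpha> * B * (\<gamma> * exp (- \<gamma> * u))" if "u \<in> {s..}" for u
      by (rule correlation_abs_le) (use that assms in simp)
  qed
  also have "(LINT u:{s..}|lborel. \<alpha> * B * (\<gamma> * exp (- \<gamma> * u))) = \<alpha> * B * exp (- \<gamma> * s)"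
    unfolding set_integral_mult_right[of _ _ "\<alpha> * B"] integral_exp_decay_atLeast[OF \<gamma>_pos] ..
  finally show ?thesis by (simp add: split)
qed

lemma total_correlation_abs_le: "\<bar>total_correlation\<bar> \<le> \<alpha> * B"
proof -
  have "(LINT u:{0..0}|lborel. correlation u) = 0"
    using set_integral_interval_abs_le_const[of 0 0 correlation "\<bar>correlation 0\<bar>"] by simp
  then show ?thesis using total_correlation_tail[of 0] by simp
qed

end

section \<open>Error bounds for the moments\<close>

context ergodic_functional
begin

lemma exp_partial_time_mono: "0 \<le> u \<Longrightarrow> u \<le> t \<Longrightarrow> exp_partial n (u / a) \<le> exp_partial n (t / a)"
  using a_pos by (intro exp_partial_mono divide_right_mono) auto

lemma set_integral_exp_decay_bound:
  assumes "0 \<le> t" "0 \<le> K" "\<And>u. u \<in> {0..t} \<Longrightarrow> \<bar>g u\<bar> \<le> \<gamma> * exp (- \<gamma> * u) * K"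
  shows "\<bar>LINT u:{0..t}|lborel. g u\<bar> \<le> K"
proof -
  have "\<bar>LINT u:{0..t}|lborel. g u\<bar> \<le> (LINT u:{0..t}|lborel. \<gamma> * exp (- \<gamma> * u) * K)"
    by (rule set_integral_abs_le)
       (use assms in \<open>auto intro!: set_integrable_interval_continuous continuous_intros\<close>)
  also have "\<dots> = (LINT u:{0..t}|lborel. \<gamma> * exp (- \<gamma> * u)) * K"
    by (rule set_integral_mult_left)
  also have "\<dots> \<le> 1 * K"
    by (intro mult_right_mono integral_exp_decay_le \<gamma>_pos assms)
  finally show ?thesis by simp
qed

lemma integral_exp_partial_le:
  assumes "0 \<le> t"
  shows "(LINT s:{0..t}|lborel. exp_partial n (s / a)) \<le> a * exp_partial (Suc n) (t / a)"
  using integral_exp_partial[OF a_pos assms, of n] a_pos by simp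

text \<open>
A centred part is an integral over deviations that decay at rate \<open>\<gamma>\<close>, so it is of the size of the
preceding mean and centred part, without a gain in \<open>t\<close>. A mean is the time integral of the
preceding centred part, which raises the degree by one. Two steps of the recursion together
therefore raise the degree by one, which is the halving of \<open>n\<close> in the bounds. The constants
reproduce because \<open>\<alpha> * (1 / c + 1 / (c * B)) = \<alpha> * (1 + B) / (c * B) \<le> a / (c * B)\<close>.
\<close>

lemma mean_centred_bound:
  assumes "0 \<le> t"
  shows mean_bound: "\<bar>mean n t\<bar> \<le> a ^ n * exp_partial (n div 2) (t / a)"
    and centred_bound: "\<And>x. x \<in> space E \<Longrightarrow>
      \<bar>centred n t x\<bar> \<le> a ^ n * exp_partial ((n - 1) div 2) (t / a) / (c * B) * \<psi> x"
proof -
  have "\<forall>t\<ge>0. \<bar>mean n t\<bar> \<le> a ^ n * exp_partial (n div 2) (t / a) \<and>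
    (\<forall>x\<in>space E. \<bar>centred n t x\<bar> \<le> a ^ n * exp_partial ((n - 1) div 2) (t / a) / (c * B) * \<psi> x)"
  proof (induction n)
    case 0
    have "0 \<le> \<psi> x" if "x \<in> space E" for x using \<psi>_pos[OF that] by simp
    then show ?case using c_pos B_pos by (simp add: mean_0 centred_0 exp_partial_def)
  next
    case (Suc n)
    show ?case
    proof (intro allI impI conjI ballI)
      fix t :: real assume t: "0 \<le> t"
      show "\<bar>mean (Suc n) t\<bar> \<le> a ^ Suc n * exp_partial (Suc n div 2) (t / a)"
      proof (cases n)
        case 0
        have "mean (Suc 0) t = (LINT s:{0..t}|lborel. 0)"
          unfolding mean_Suc[OF t]
        proof (rule set_lebesgue_integral_cong; (intro allI impI)?)
          fix s
          have "(\<integral>y. f y * centred 0 s y \<partial>\<beta>) = (\<integral>y. 0 \<partial>\<beta>)"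
            by (rule Bochner_Integration.integral_cong) (auto simp: centred_0 space_\<beta>)
          then show "(\<integral>y. f y * centred 0 s y \<partial>\<beta>) = 0" by simp
        qed simp
        then show ?thesis
          using a_pos t by (simp add: 0 exp_partial_nonneg set_lebesgue_integral_def)
      next
        case (Suc m)
        have "\<bar>mean (Suc n) t\<bar> \<le> (LINT s:{0..t}|lborel. a ^ n * exp_partial (m div 2) (s / a))"
          unfolding mean_Suc[OF t]
        proof (rule set_integral_abs_le)
          fix s assume s: "s \<in> {0..t}"
          have "\<bar>\<integral>y. f y * centred n s y \<partial>\<beta>\<bar> \<le> a ^ n * exp_partial (m div 2) (s / a) / (c * B) * (c * B)"
            by (intro integral_abs_le_\<psi> mult_f_abs_le) (use Suc.IH s Suc in auto)
          then show "\<bar>\<integral>y. f y * centred n s y \<partial>\<beta>\<bar> \<le> a ^ n * exp_partial (m div 2) (s / a)"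
            using c_pos B_pos by simp
        qed (use a_pos in \<open>auto intro!: set_integrable_interval_continuous continuous_on_mult continuous_on_exp_partial continuous_on_divide\<close>)
        also have "\<dots> = a ^ n * (LINT s:{0..t}|lborel. exp_partial (m div 2) (s / a))"
          by (rule set_integral_mult_right)
        also have "\<dots> \<le> a ^ n * (a * exp_partial (Suc (m div 2)) (t / a))"
          using a_pos by (intro mult_left_mono integral_exp_partial_le t) auto
        also have "Suc (m div 2) = Suc n div 2" using Suc by simp
        finally show ?thesis by (simp add: mult_ac)
      qed
    next
      fix t x assume t: "(0::real) \<le> t" and x: "x \<in> space E"
      let ?H = "exp_partial (n div 2) (t / a)"
      have H0: "0 \<le> ?H" using t a_pos by (intro exp_partial_nonneg) auto
      have "\<bar>centred (Suc n) t x\<bar> \<le> a * (a ^ n * ?H / (c * B) * \<psi> x)"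
        unfolding centred_Suc[OF x t]
      proof (rule set_integral_exp_decay_bound[OF t])
        show "0 \<le> a * (a ^ n * ?H / (c * B) * \<psi> x)"
          using a_pos H0 c_pos B_pos \<psi>_pos[OF x] by simp
        fix u assume u: "u \<in> {0..t}"
        have "\<bar>mean n (t - u)\<bar> \<le> a ^ n * ?H"
        proof -
          have "\<bar>mean n (t - u)\<bar> \<le> a ^ n * exp_partial (n div 2) ((t - u) / a)"
            using Suc.IH u by auto
          also have "\<dots> \<le> a ^ n * ?H"
            using a_pos u by (intro mult_left_mono exp_partial_time_mono) auto
          finally show ?thesis .
        qed
        moreover have "\<bar>transition u f x\<bar> \<le> C * exp (- \<gamma> * u) * \<psi> x * (1 / c)"
          using deviation_abs_le[OF x _ measurable_f f_le_\<psi>, of u] u by (simp add: deviation_f)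
        ultimately have 1: "\<bar>mean n (t - u) * transition u f x\<bar>
            \<le> (a ^ n * ?H) * (C * exp (- \<gamma> * u) * \<psi> x * (1 / c))"
          unfolding abs_mult using a_pos H0 by (intro mult_mono) auto
        have 2: "\<bar>deviation u (\<lambda>y. f y * centred n (t - u) y) x\<bar>
            \<le> C * exp (- \<gamma> * u) * \<psi> x * (a ^ n * ?H / (c * B))"
        proof (rule deviation_abs_le[OF x])
          fix y assume y: "y \<in> space E"
          have "\<bar>centred n (t - u) y\<bar> \<le> a ^ n * exp_partial ((n - 1) div 2) ((t - u) / a) / (c * B) * \<psi> y"
            using Suc.IH u y by auto
          also have "exp_partial ((n - 1) div 2) ((t - u) / a) \<le> exp_partial (n div 2) ((t - u) / a)"
            using u a_pos by (intro exp_partial_mono_index divide_nonneg_pos) (auto intro: div_le_mono)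
          also have "exp_partial (n div 2) ((t - u) / a) \<le> ?H"
            using u by (intro exp_partial_time_mono) auto
          finally have "\<bar>centred n (t - u) y\<bar> \<le> a ^ n * ?H / (c * B) * \<psi> y"
            using a_pos c_pos B_pos \<psi>_pos[OF y]
            by (simp add: mult_left_mono mult_right_mono divide_right_mono)
          then show "\<bar>f y * centred n (t - u) y\<bar> \<le> a ^ n * ?H / (c * B) * \<psi> y"
            by (rule mult_f_abs_le[OF y])
        qed (use u in auto)
        have "\<bar>mean n (t - u) * transition u f x + deviation u (\<lambda>y. f y * centred n (t - u) y) x\<bar>
            \<le> (a ^ n * ?H) * (C * exp (- \<gamma> * u) * \<psi> x * (1 / c))
              + C * exp (- \<gamma> * u) * \<psi> x * (a ^ n * ?H / (c * B))"
          using 1 2 by linarith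
        also have "\<dots> = C * (1 + B) * (exp (- \<gamma> * u) * (a ^ n * ?H / (c * B) * \<psi> x))"
          using c_pos B_pos by (simp add: field_simps)
        also have "\<dots> = (\<gamma> * \<alpha>) * (1 + B) * (exp (- \<gamma> * u) * (a ^ n * ?H / (c * B) * \<psi> x))"
          by (simp only: \<gamma>\<alpha>)
        also have "\<dots> = (\<alpha> * (1 + B)) * (\<gamma> * exp (- \<gamma> * u) * (a ^ n * ?H / (c * B) * \<psi> x))"
          by (simp only: mult_ac)
        also have "\<dots> \<le> a * (\<gamma> * exp (- \<gamma> * u) * (a ^ n * ?H / (c * B) * \<psi> x))"
          using a_ge a_pos H0 c_pos B_pos \<psi>_pos[OF x] \<gamma>_pos by (intro mult_right_mono) auto
        finally show "\<bar>mean n (t - u) * transition u f x + deviation u (\<lambda>y. f y * centred n (t - u) y) x\<bar>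
            \<le> \<gamma> * exp (- \<gamma> * u) * (a * (a ^ n * ?H / (c * B) * \<psi> x))"
          by (simp only: mult_ac)
      qed
      then show "\<bar>centred (Suc n) t x\<bar>
          \<le> a ^ Suc n * exp_partial ((Suc n - 1) div 2) (t / a) / (c * B) * \<psi> x"
        by simp
    qed
  qed
  with assms show "\<bar>mean n t\<bar> \<le> a ^ n * exp_partial (n div 2) (t / a)"
    "\<And>x. x \<in> space E \<Longrightarrow>
      \<bar>centred n t x\<bar> \<le> a ^ n * exp_partial ((n - 1) div 2) (t / a) / (c * B) * \<psi> x"
    by auto
qed

text \<open>
The value that \<open>mean (2 * k) t\<close> would have if the correlations of \<open>f\<close> were concentrated at time
lag 0 with total mass \<open>total_correlation\<close>: then \<open>2 * k\<close> factors pair up into \<open>k\<close> neighbouring pairs.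
\<close>

definition leading :: "nat \<Rightarrow> real \<Rightarrow> real" where
  "leading k t = total_correlation ^ k * (t ^ k / fact k)"

lemma continuous_on_leading: "continuous_on S (leading k)"
  unfolding leading_def by (intro continuous_intros) auto

lemma leading_Suc:
  assumes "0 \<le> t"
  shows "leading (Suc k) t = (LINT s:{0..t}|lborel. total_correlation * leading k s)"
proof -
  have "(LINT s:{0..t}|lborel. total_correlation * leading k s) = leading (Suc k) t - leading (Suc k) 0"
  proof (rule set_integral_interval_FTC[OF assms])
    show "(leading (Suc k) has_real_derivative total_correlation * leading k x) (at x)" for x
    proof -
      have "((\<lambda>x. x ^ Suc k / fact (Suc k)) has_real_derivative x ^ k / fact k) (at x)"
        by (auto intro!: derivative_eq_intros simp del: power_Suc)
      from DERIV_cmult[OF this, of "total_correlation ^ Suc k"] show ?thesis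
        by (simp add: leading_def[abs_def] mult.assoc)
    qed
  qed (intro continuous_intros continuous_on_leading)
  then show ?thesis by (simp add: leading_def)
qed

lemma leading_abs_le:
  assumes "0 \<le> t"
  shows "\<bar>leading k t\<bar> \<le> a ^ k * (t ^ k / fact k)"
proof -
  have "\<bar>total_correlation\<bar> \<le> a" using total_correlation_abs_le a_ge_\<alpha>B by linarith
  then have "\<bar>total_correlation\<bar> ^ k * (t ^ k / fact k) \<le> a ^ k * (t ^ k / fact k)"
    using assms by (intro mult_right_mono power_mono) auto
  then show ?thesis using assms by (simp add: leading_def abs_mult power_abs)
qed

text \<open>
The derivative of \<open>mean 2\<close> is the correlation integrated up to \<open>s\<close>, so only the tail is missing.
\<close>

lemma even_mean_derivative_error_0:
  assumes s: "0 \<le> s"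
  shows "\<bar>(\<integral>x. f x * centred (Suc 0) s x \<partial>\<beta>) - total_correlation * leading 0 s\<bar>
    \<le> \<alpha> * B * exp (- \<gamma> * s)"
proof -
  have "(\<integral>x. f x * centred (Suc 0) s x \<partial>\<beta>) = (LINT u:{0..s}|lborel. correlation u)"
    unfolding integral_f_centred_Suc(1)[OF s]
  proof (rule set_lebesgue_integral_cong; (intro allI impI)?)
    fix u assume u: "u \<in> {0..s}"
    have d0: "deviation u (\<lambda>y. f y * centred 0 (s - u) y) x = 0" if "x \<in> space E" for x
      using deviation_abs_le[OF that, of u "\<lambda>y. f y * centred 0 (s - u) y" 0] u
      by (simp add: centred_0)
    have "(\<integral>x. f x * deviation u (\<lambda>y. f y * centred 0 (s - u) y) x \<partial>\<beta>) = (\<integral>x. 0 \<partial>\<beta>)"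
      by (rule Bochner_Integration.integral_cong) (auto simp: d0 space_\<beta>)
    then show "mean 0 (s - u) * correlation u
        + (\<integral>x. f x * deviation u (\<lambda>y. f y * centred 0 (s - u) y) x \<partial>\<beta>) = correlation u"
      by (simp add: mean_0)
  qed simp
  then show ?thesis
    using total_correlation_tail[OF s] by (simp add: leading_def abs_minus_commute)
qed

text \<open>
The derivative of \<open>mean (2 * i + 4)\<close> is compared with that of its leading term. Four errors arise,
each bounded by a multiple of \<open>exp_partial i (s / a)\<close>: the error of the previous even mean, the delay
by the correlation time \<open>u\<close> in the argument of the leading term, the contribution of the previous
centred part, whose degree is smaller by one, and the correlations at lags beyond \<open>s\<close>.
\<close>

lemma even_mean_derivative_error_Suc:
  assumes s: "0 \<le> s"
    and IH: "\<And>v. 0 \<le> v \<Longrightarrow> v \<le> s \<Longrightarrow>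
      \<bar>mean (2 * Suc i) v - leading (Suc i) v\<bar> \<le> W * a ^ (2 * Suc i) * exp_partial i (v / a)"
  shows "\<bar>(\<integral>x. f x * centred (Suc (2 * Suc i)) s x \<partial>\<beta>) - total_correlation * leading (Suc i) s\<bar>
    \<le> W * a ^ Suc (2 * Suc i) * exp_partial i (s / a)"
proof -
  let ?n = "2 * Suc i"
  define h where "h = a ^ ?n * exp_partial i (s / a)"
  have h0: "0 \<le> h" unfolding h_def using a_pos s by (intro mult_nonneg_nonneg exp_partial_nonneg) auto
  let ?tail = "total_correlation - (LINT u:{0..s}|lborel. correlation u)"
  let ?d = "\<lambda>u. \<integral>x. f x * deviation u (\<lambda>y. f y * centred ?n (s - u) y) x \<partial>\<beta>"
  have s_term: "a ^ Suc i * (s ^ i / fact i) \<le> h"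
  proof -
    have "a ^ Suc i * (s ^ i / fact i) = a ^ Suc (2 * i) * ((s / a) ^ i / fact i)"
      using a_pos by (simp add: power_divide field_simps flip: power_add mult_2)
    also have "\<dots> \<le> a ^ ?n * exp_partial i (s / a)"
      using a_ge_1 s by (intro mult_mono power_increasing exp_partial_ge_term) auto
    finally show ?thesis by (simp add: h_def)
  qed
  have corr: "set_integrable lborel {0..s} correlation"
    by (rule set_integrable_subset[OF set_integrable_correlation]) auto
  have "(\<integral>x. f x * centred (Suc ?n) s x \<partial>\<beta>) - (LINT u:{0..s}|lborel. leading (Suc i) s * correlation u)
      = (LINT u:{0..s}|lborel. (mean ?n (s - u) * correlation u + ?d u) - leading (Suc i) s * correlation u)"
    unfolding integral_f_centred_Suc(1)[OF s]
    by (rule set_integral_diff(2)[symmetric, OF integral_f_centred_Suc(2)[OF s] set_integrable_mult_right[OF corr]])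
  then have "(\<integral>x. f x * centred (Suc ?n) s x \<partial>\<beta>) - total_correlation * leading (Suc i) s
      = (LINT u:{0..s}|lborel. (mean ?n (s - u) * correlation u + ?d u) - leading (Suc i) s * correlation u)
        - ?tail * leading (Suc i) s"
    by (simp add: algebra_simps)
  moreover have "\<bar>LINT u:{0..s}|lborel. (mean ?n (s - u) * correlation u + ?d u) - leading (Suc i) s * correlation u\<bar>
      \<le> (\<alpha> * B * W + \<alpha>) * h + \<alpha> * B * h / \<gamma>"
  proof -
    have "\<bar>LINT u:{0..s}|lborel. (mean ?n (s - u) * correlation u + ?d u) - leading (Suc i) s * correlation u\<bar>
      \<le> (LINT u:{0..s}|lborel. (\<alpha> * B * W + \<alpha>) * h * (\<gamma> * exp (- \<gamma> * u)) + \<alpha> * B * h * (\<gamma> * exp (- \<gamma> * u) * u))"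
    proof (rule set_integral_abs_le)
      fix u assume u: "u \<in> {0..s}"
      have inc: "\<bar>leading (Suc i) (s - u) - leading (Suc i) s\<bar> \<le> h * u"
      proof -
        have "s ^ Suc i - (s - u) ^ Suc i \<le> real (Suc i) * (s - (s - u)) * s ^ i"
          by (rule power_increment_le) (use u in auto)
        moreover have "(s - u) ^ Suc i \<le> s ^ Suc i" using u by (intro power_mono) auto
        ultimately have "\<bar>(s - u) ^ Suc i - s ^ Suc i\<bar> \<le> real (Suc i) * u * s ^ i" by simp
        then have "\<bar>(s - u) ^ Suc i - s ^ Suc i\<bar> / fact (Suc i) \<le> real (Suc i) * u * s ^ i / fact (Suc i)"
          by (rule divide_right_mono) simp
        also have "\<dots> = s ^ i / fact i * u" by (simp add: fact_Suc del: of_nat_Suc)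
        finally have le: "\<bar>(s - u) ^ Suc i - s ^ Suc i\<bar> / fact (Suc i) \<le> s ^ i / fact i * u" .
        have "leading (Suc i) (s - u) - leading (Suc i) s
            = total_correlation ^ Suc i * (((s - u) ^ Suc i - s ^ Suc i) / fact (Suc i))"
          unfolding leading_def right_diff_distrib[symmetric] diff_divide_distrib ..
        then have "\<bar>leading (Suc i) (s - u) - leading (Suc i) s\<bar>
            = \<bar>total_correlation\<bar> ^ Suc i * (\<bar>(s - u) ^ Suc i - s ^ Suc i\<bar> / fact (Suc i))"
          by (simp only: abs_mult abs_divide power_abs abs_of_nonneg[OF fact_ge_zero])
        also have "\<dots> \<le> a ^ Suc i * (s ^ i / fact i * u)"
          using le total_correlation_abs_le a_ge_\<alpha>B a_pos by (intro mult_mono power_mono) auto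
        also have "\<dots> = (a ^ Suc i * (s ^ i / fact i)) * u" by (simp only: mult.assoc)
        also have "\<dots> \<le> h * u" using s_term u by (intro mult_right_mono) auto
        finally show ?thesis .
      qed
      have "\<bar>mean ?n (s - u) - leading (Suc i) (s - u)\<bar> \<le> W * h"
      proof -
        have "\<bar>mean ?n (s - u) - leading (Suc i) (s - u)\<bar> \<le> W * a ^ ?n * exp_partial i ((s - u) / a)"
          by (rule IH) (use u in auto)
        also have "\<dots> \<le> W * a ^ ?n * exp_partial i (s / a)"
          using u a_pos W_pos by (intro mult_left_mono exp_partial_time_mono) auto
        finally show ?thesis by (simp add: h_def mult.assoc)
      qed
      with inc have "\<bar>mean ?n (s - u) - leading (Suc i) s\<bar> \<le> W * h + h * u" by linarith
      then have 1: "\<bar>(mean ?n (s - u) - leading (Suc i) s) * correlation u\<bar>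
          \<le> (W * h + h * u) * (\<alpha> * B * (\<gamma> * exp (- \<gamma> * u)))"
        unfolding abs_mult using u h0 W_pos by (intro mult_mono correlation_abs_le) auto
      have "\<bar>?d u\<bar> \<le> C * exp (- \<gamma> * u) * (h / (c * B)) * (c * B)"
      proof (intro integral_abs_le_\<psi> mult_f_abs_le)
        fix x assume x: "x \<in> space E"
        have "\<bar>deviation u (\<lambda>y. f y * centred ?n (s - u) y) x\<bar> \<le> C * exp (- \<gamma> * u) * \<psi> x * (h / (c * B))"
        proof (rule deviation_abs_le[OF x])
          fix y assume y: "y \<in> space E"
          have "\<bar>centred ?n (s - u) y\<bar> \<le> a ^ ?n * exp_partial ((?n - 1) div 2) ((s - u) / a) / (c * B) * \<psi> y"
            by (rule centred_bound) (use u y in auto)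
          also have "(?n - 1) div 2 = i" by simp
          also have "a ^ ?n * exp_partial i ((s - u) / a) / (c * B) * \<psi> y \<le> h / (c * B) * \<psi> y"
            unfolding h_def using u a_pos c_pos B_pos \<psi>_pos[OF y]
            by (intro mult_right_mono divide_right_mono mult_left_mono exp_partial_time_mono) auto
          finally show "\<bar>f y * centred ?n (s - u) y\<bar> \<le> h / (c * B) * \<psi> y"
            by (rule mult_f_abs_le[OF y])
        qed (use u in auto)
        then show "\<bar>deviation u (\<lambda>y. f y * centred ?n (s - u) y) x\<bar> \<le> C * exp (- \<gamma> * u) * (h / (c * B)) * \<psi> x"
          by (simp only: mult_ac)
      qed
      also have "\<dots> = (\<gamma> * \<alpha>) * exp (- \<gamma> * u) * h"
        using c_pos B_pos by (simp add: \<gamma>\<alpha>)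
      also have "\<dots> = \<alpha> * h * (\<gamma> * exp (- \<gamma> * u))"
        by (simp only: mult_ac)
      finally have 2: "\<bar>?d u\<bar> \<le> \<alpha> * h * (\<gamma> * exp (- \<gamma> * u))" .
      have "\<bar>(mean ?n (s - u) * correlation u + ?d u) - leading (Suc i) s * correlation u\<bar>
          = \<bar>(mean ?n (s - u) - leading (Suc i) s) * correlation u + ?d u\<bar>"
        by (simp add: algebra_simps)
      also have "\<dots> \<le> (W * h + h * u) * (\<alpha> * B * (\<gamma> * exp (- \<gamma> * u))) + \<alpha> * h * (\<gamma> * exp (- \<gamma> * u))"
        using 1 2 by linarith
      also have "\<dots> = (\<alpha> * B * W + \<alpha>) * h * (\<gamma> * exp (- \<gamma> * u)) + \<alpha> * B * h * (\<gamma> * exp (- \<gamma> * u) * u)"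
        by (simp add: algebra_simps)
      finally show "\<bar>(mean ?n (s - u) * correlation u + ?d u) - leading (Suc i) s * correlation u\<bar> \<le> \<dots>" .
    qed (auto intro!: set_integrable_interval_continuous continuous_intros)
    also have "\<dots> = (\<alpha> * B * W + \<alpha>) * h * (LINT u:{0..s}|lborel. \<gamma> * exp (- \<gamma> * u))
        + \<alpha> * B * h * (LINT u:{0..s}|lborel. \<gamma> * exp (- \<gamma> * u) * u)"
      unfolding set_integral_mult_right[where a = "\<alpha> * B * h", symmetric]
        set_integral_mult_right[where a = "(\<alpha> * B * W + \<alpha>) * h", symmetric]
      by (rule set_integral_add(2)) (auto intro!: set_integrable_interval_continuous continuous_intros)
    also have "\<dots> \<le> (\<alpha> * B * W + \<alpha>) * h * 1 + \<alpha> * B * h * (1 / \<gamma>)"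
      using \<alpha>_pos B_pos W_pos h0
      by (intro add_mono mult_left_mono integral_exp_decay_le integral_linear_exp_decay_le \<gamma>_pos s) auto
    finally show ?thesis by simp
  qed
  moreover have "\<bar>?tail * leading (Suc i) s\<bar> \<le> \<alpha> * B * h / \<gamma>"
  proof -
    have "exp (- \<gamma> * s) * s \<le> 1 / \<gamma>"
    proof -
      have "\<gamma> * s \<le> exp (\<gamma> * s)" using exp_ge_add_one_self[of "\<gamma> * s"] by linarith
      then show ?thesis using \<gamma>_pos by (simp add: exp_minus field_simps)
    qed
    moreover have "\<bar>leading (Suc i) s\<bar> \<le> h * s"
    proof -
      have "\<bar>leading (Suc i) s\<bar> \<le> a ^ Suc i * (s ^ Suc i / fact (Suc i))"
        by (rule leading_abs_le[OF s])
      also have "s ^ Suc i / fact (Suc i) \<le> s ^ Suc i / fact i"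
        using s by (intro divide_left_mono) (auto simp: fact_mono)
      also have "a ^ Suc i * (s ^ Suc i / fact i) = a ^ Suc i * (s ^ i / fact i) * s" by simp
      also have "\<dots> \<le> h * s" using s_term s by (rule mult_right_mono)
      finally show ?thesis using a_pos by simp
    qed
    ultimately have "\<bar>?tail * leading (Suc i) s\<bar> \<le> (\<alpha> * B * exp (- \<gamma> * s)) * (h * s)"
      unfolding abs_mult using total_correlation_tail[OF s] \<alpha>_pos B_pos by (intro mult_mono) auto
    also have "\<dots> = \<alpha> * B * h * (exp (- \<gamma> * s) * s)" by (simp only: mult_ac)
    also have "\<dots> \<le> \<alpha> * B * h * (1 / \<gamma>)"
      using \<open>exp (- \<gamma> * s) * s \<le> 1 / \<gamma>\<close> \<alpha>_pos B_pos h0 by (intro mult_left_mono) auto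
    finally show ?thesis by simp
  qed
  ultimately have "\<bar>(\<integral>x. f x * centred (Suc ?n) s x \<partial>\<beta>) - total_correlation * leading (Suc i) s\<bar>
      \<le> (\<alpha> * B * W + \<alpha>) * h + \<alpha> * B * h / \<gamma> + \<alpha> * B * h / \<gamma>"
    by linarith
  also have "\<dots> = \<alpha> * (B * W + (1 + 2 * B / \<gamma>)) * h"
    by (simp add: algebra_simps)
  also have "\<dots> \<le> \<alpha> * (B * W + W) * h"
    using W_ge(2) \<alpha>_pos h0 by (intro mult_right_mono mult_left_mono add_left_mono) auto
  also have "\<dots> = (\<alpha> * (1 + B)) * (W * h)" by (simp add: algebra_simps)
  also have "\<dots> \<le> a * (W * h)"
    using a_ge W_pos h0 by (intro mult_right_mono) auto
  finally show ?thesis by (simp add: h_def mult_ac)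
qed

lemma even_mean_error:
  assumes "0 \<le> t"
  shows "\<bar>mean (2 * Suc j) t - leading (Suc j) t\<bar> \<le> W * a ^ (2 * Suc j) * exp_partial j (t / a)"
  using assms
proof (induction j arbitrary: t)
  case 0
  have ci: "set_integrable lborel {0..t} (\<lambda>s. total_correlation * leading 0 s)"
    by (intro set_integrable_interval_continuous continuous_intros continuous_on_leading)
  have "\<bar>mean 2 t - leading 1 t\<bar>
      = \<bar>LINT s:{0..t}|lborel. (\<integral>x. f x * centred (Suc 0) s x \<partial>\<beta>) - total_correlation * leading 0 s\<bar>"
    using mean_Suc[OF 0, of "Suc 0"] leading_Suc[OF 0, of 0]
      set_integral_diff(2)[OF set_integrable_f_centred[OF 0, of "Suc 0"] ci]
    by (simp add: numeral_2_eq_2)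
  also have "\<dots> \<le> \<alpha> * B / \<gamma>"
  proof (rule set_integral_exp_decay_bound[OF 0])
    show "\<bar>(\<integral>x. f x * centred (Suc 0) s x \<partial>\<beta>) - total_correlation * leading 0 s\<bar>
        \<le> \<gamma> * exp (- \<gamma> * s) * (\<alpha> * B / \<gamma>)" if "s \<in> {0..t}" for s
      using even_mean_derivative_error_0[of s] that \<gamma>_pos by (simp add: mult_ac)
  qed (use \<alpha>_pos B_pos \<gamma>_pos in auto)
  also have "\<dots> \<le> a * W"
    using mult_mono[OF a_ge_\<alpha>B W_ge(1)] a_pos \<gamma>_pos by simp
  also have "\<dots> \<le> W * a ^ 2"
    using a_ge_1 W_pos by (simp add: power2_eq_square)
  finally show ?case by (simp add: exp_partial_def)
next
  case (Suc i)
  let ?n = "2 * Suc i"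
  have ci: "set_integrable lborel {0..t} (\<lambda>s. total_correlation * leading (Suc i) s)"
    by (intro set_integrable_interval_continuous continuous_intros continuous_on_leading)
  have "\<bar>mean (2 * Suc (Suc i)) t - leading (Suc (Suc i)) t\<bar>
      = \<bar>LINT s:{0..t}|lborel. (\<integral>x. f x * centred (Suc ?n) s x \<partial>\<beta>) - total_correlation * leading (Suc i) s\<bar>"
    using mean_Suc[OF Suc.prems, of "Suc ?n"] leading_Suc[OF Suc.prems, of "Suc i"]
      set_integral_diff(2)[OF set_integrable_f_centred[OF Suc.prems, of "Suc ?n"] ci]
    by simp
  also have "\<dots> \<le> (LINT s:{0..t}|lborel. W * a ^ Suc ?n * exp_partial i (s / a))"
  proof (rule set_integral_abs_le)
    show "\<bar>(\<integral>x. f x * centred (Suc ?n) s x \<partial>\<beta>) - total_correlation * leading (Suc i) s\<bar>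
        \<le> W * a ^ Suc ?n * exp_partial i (s / a)" if "s \<in> {0..t}" for s
      by (rule even_mean_derivative_error_Suc) (use that Suc.IH in auto)
  qed (use a_pos in \<open>auto intro!: set_integrable_interval_continuous continuous_on_mult continuous_on_exp_partial continuous_on_divide\<close>)
  also have "\<dots> = W * a ^ Suc ?n * (LINT s:{0..t}|lborel. exp_partial i (s / a))"
    by (rule set_integral_mult_right)
  also have "\<dots> \<le> W * a ^ Suc ?n * (a * exp_partial (Suc i) (t / a))"
    using a_pos W_pos by (intro mult_left_mono integral_exp_partial_le Suc.prems) auto
  finally show ?case by (simp add: mult_ac)
qed

text \<open>
For \<open>t\<close> beyond \<open>(j + 1) * a\<close> the terms of the partial exponential sum increase, so the last of them,
taken \<open>j + 1\<close> times, bounds the sum. For smaller \<open>t\<close> the bounds by powers of \<open>t / a\<close> are useless. There,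
with \<open>k = j + 1\<close>, the trivial bound \<open>t\<^sup>2\<^sup>k / (2 k)!\<close> on the moment is small enough, by
\<open>(2 k)! \<ge> (k - 1)! k\<^sup>k\<^sup>+\<^sup>1\<close>, and so is the leading term.
\<close>

lemma even_moment_error:
  assumes x: "x \<in> space E" and t: "0 < t"
  shows "\<bar>moment (2 * Suc j) t x - leading (Suc j) t\<bar>
    \<le> moment_error_const * a ^ j * real (Suc j) * (t ^ j / fact j) * \<psi> x"
proof (cases "real (Suc j) * a \<le> t")
  case True
  have "real j * a \<le> t" using True a_pos by (simp add: algebra_simps)
  then have ja: "real j \<le> t / a" using a_pos by (simp add: field_simps)
  let ?H = "exp_partial j (t / a)"
  have H0: "0 \<le> ?H" using t a_pos by (intro exp_partial_nonneg) auto
  have 1: "\<bar>centred (2 * Suc j) t x\<bar> \<le> a ^ (2 * Suc j) * ?H * (\<psi> x / c)"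
  proof -
    have "\<bar>centred (2 * Suc j) t x\<bar> \<le> a ^ (2 * Suc j) * exp_partial ((2 * Suc j - 1) div 2) (t / a) / (c * B) * \<psi> x"
      by (rule centred_bound) (use x t in auto)
    also have "(2 * Suc j - 1) div 2 = j" by simp
    also have "a ^ (2 * Suc j) * ?H / (c * B) * \<psi> x \<le> a ^ (2 * Suc j) * ?H / (c * 1) * \<psi> x"
      using a_pos H0 c_pos B_ge_1 \<psi>_pos[OF x]
      by (intro mult_right_mono divide_left_mono mult_left_mono) auto
    finally show ?thesis by simp
  qed
  have "1 \<le> \<psi> x / c" using \<psi>_ge[OF x] c_pos by simp
  then have "W * a ^ (2 * Suc j) * ?H * 1 \<le> W * a ^ (2 * Suc j) * ?H * (\<psi> x / c)"
    using W_pos a_pos H0 by (intro mult_left_mono) auto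
  with even_mean_error[of t j] t
  have 2: "\<bar>mean (2 * Suc j) t - leading (Suc j) t\<bar> \<le> W * a ^ (2 * Suc j) * ?H * (\<psi> x / c)" by simp
  have "\<bar>moment (2 * Suc j) t x - leading (Suc j) t\<bar>
      \<le> \<bar>centred (2 * Suc j) t x\<bar> + \<bar>mean (2 * Suc j) t - leading (Suc j) t\<bar>"
    by (simp add: centred_def)
  also have "\<dots> \<le> a ^ (2 * Suc j) * ?H * (\<psi> x / c) + W * a ^ (2 * Suc j) * ?H * (\<psi> x / c)"
    using 1 2 by linarith
  also have "\<dots> = (1 + W) * a ^ (2 * Suc j) * (\<psi> x / c) * ?H" by (simp add: algebra_simps)
  also have "\<dots> \<le> (1 + W) * a ^ (2 * Suc j) * (\<psi> x / c) * (real (Suc j) * ((t / a) ^ j / fact j))"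
    using W_pos a_pos c_pos \<psi>_pos[OF x] by (intro mult_left_mono exp_partial_le_top_term ja) auto
  also have "\<dots> = moment_error_const * a ^ j * real (Suc j) * (t ^ j / fact j) * \<psi> x"
  proof -
    have "a ^ (2 * Suc j) = a ^ 2 * a ^ j * a ^ j"
      by (simp add: power2_eq_square flip: power_add mult_2)
    then show ?thesis using a_pos by (simp add: moment_error_const_def power_divide)
  qed
  finally show ?thesis .
next
  case False
  then have ta: "t \<le> real (Suc j) * a" by simp
  have psi: "1 \<le> \<psi> x / c" using \<psi>_ge[OF x] c_pos by simp
  have "t ^ (2 * Suc j) / fact (2 * Suc j) \<le> a ^ (j + 2) * (t ^ j / fact j)"
  proof -
    have "t ^ (j + 2) \<le> (real (Suc j) * a) ^ (j + 2)" using ta t by (intro power_mono) auto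
    then have "fact j * t ^ (j + 2) \<le> (fact j * real (Suc j) ^ (j + 2)) * a ^ (j + 2)"
      by (simp add: power_mult_distrib mult.assoc del: power_Suc power_add)
    also have "\<dots> \<le> fact (j + (j + 2)) * a ^ (j + 2)"
      using a_pos by (intro mult_right_mono fact_mult_power_le_fact) auto
    also have "j + (j + 2) = 2 * Suc j" by simp
    finally have "t ^ (j + 2) / fact (2 * Suc j) \<le> a ^ (j + 2) / fact j"
      by (simp only: divide_le_eq pos_le_divide_eq fact_gt_zero times_divide_eq_left mult_ac if_True)
        (simp add: field_simps)
    moreover have "t ^ (2 * Suc j) = t ^ j * t ^ (j + 2)" by (simp flip: power_add mult_2)
    then have "t ^ (2 * Suc j) / fact (2 * Suc j) = t ^ j * (t ^ (j + 2) / fact (2 * Suc j))"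
      by (simp only: times_divide_eq_right)
    moreover have "a ^ (j + 2) * (t ^ j / fact j) = t ^ j * (a ^ (j + 2) / fact j)"
      by simp
    ultimately show ?thesis
      using t by (simp only: mult_left_mono zero_le_power less_imp_le)
  qed
  then have "\<bar>moment (2 * Suc j) t x\<bar> \<le> a ^ (j + 2) * (t ^ j / fact j)"
    using moment_abs_le[OF x, of t "2 * Suc j"] t by linarith
  moreover have "\<bar>leading (Suc j) t\<bar> \<le> a ^ (j + 2) * (t ^ j / fact j)"
  proof -
    have "\<bar>leading (Suc j) t\<bar> \<le> a ^ Suc j * (t ^ Suc j / fact (Suc j))"
      using t by (intro leading_abs_le) auto
    also have "t ^ Suc j / fact (Suc j) = t ^ j / fact j * (t / real (Suc j))" by (simp add: field_simps)
    also have "a ^ Suc j * (t ^ j / fact j * (t / real (Suc j))) \<le> a ^ Suc j * (t ^ j / fact j * a)"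
      using ta a_pos t by (intro mult_left_mono) (auto simp: field_simps)
    finally show ?thesis by (simp add: mult_ac)
  qed
  ultimately have "\<bar>moment (2 * Suc j) t x - leading (Suc j) t\<bar> \<le> 2 * (a ^ (j + 2) * (t ^ j / fact j))"
    by linarith
  also have "\<dots> \<le> (1 + W) * (real (Suc j) * (\<psi> x / c)) * (a ^ (j + 2) * (t ^ j / fact j))"
  proof (rule mult_right_mono)
    have "2 * (1 * 1) \<le> (1 + W) * (real (Suc j) * (\<psi> x / c))"
      using W_ge_1 psi by (intro mult_mono) auto
    then show "2 \<le> (1 + W) * (real (Suc j) * (\<psi> x / c))" by simp
  qed (use a_pos t in auto)
  also have "\<dots> = moment_error_const * a ^ j * real (Suc j) * (t ^ j / fact j) * \<psi> x"
    by (simp add: moment_error_const_def power_add power2_eq_square)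
  finally show ?thesis .
qed

lemma odd_moment_bound:
  assumes x: "x \<in> space E" and t: "0 \<le> t"
  shows "\<bar>moment (2 * k + 1) t x\<bar> \<le> 2 * a ^ (2 * k + 1) * exp_partial k (t / a) * (\<psi> x / c)"
proof -
  let ?h = "a ^ (2 * k + 1) * exp_partial k (t / a)"
  have h0: "0 \<le> ?h" using t a_pos by (intro mult_nonneg_nonneg exp_partial_nonneg) auto
  have "\<bar>centred (2 * k + 1) t x\<bar> \<le> ?h / (c * B) * \<psi> x"
    using centred_bound[OF t x, of "2 * k + 1"] by simp
  also have "\<dots> \<le> ?h / (c * 1) * \<psi> x"
    using h0 c_pos B_ge_1 \<psi>_pos[OF x] by (intro mult_right_mono divide_left_mono mult_left_mono) auto
  finally have 1: "\<bar>centred (2 * k + 1) t x\<bar> \<le> ?h * (\<psi> x / c)" by simp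
  have "1 \<le> \<psi> x / c" using \<psi>_ge[OF x] c_pos by simp
  then have "?h * 1 \<le> ?h * (\<psi> x / c)" using h0 by (rule mult_left_mono)
  with mean_bound[OF t, of "2 * k + 1"] have 2: "\<bar>mean (2 * k + 1) t\<bar> \<le> ?h * (\<psi> x / c)" by simp
  have "\<bar>moment (2 * k + 1) t x\<bar> \<le> \<bar>centred (2 * k + 1) t x\<bar> + \<bar>mean (2 * k + 1) t\<bar>"
    by (simp add: centred_def)
  also have "\<dots> \<le> ?h * (\<psi> x / c) + ?h * (\<psi> x / c)" by (rule add_mono[OF 1 2])
  finally show ?thesis by (simp add: mult_ac)
qed

end

section \<open>Moments under an initial law\<close>

context ergodic_functional
begin

text \<open>
Both means vanish in equilibrium, so the covariance is the expectation of the product, and the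
transition from time 0 to time \<open>s\<close> expresses it through \<open>\<beta>\<close>.
\<close>

lemma asymptotic_variance_eq: "asymptotic_variance X Q \<beta> f = 2 * total_correlation"
proof -
  have fX: "(\<lambda>\<omega>. f (X s \<omega>)) \<in> borel_measurable M" if "0 \<le> s" for s
    using measurable_compose[OF measurable_X[OF that] measurable_f] .
  have "covariance (\<beta> \<bind> Q) (\<lambda>\<omega>. f (X 0 \<omega>)) (\<lambda>\<omega>. f (X s \<omega>)) = correlation s" if s: "0 \<le> s" for s
  proof -
    have centred: "(\<integral>\<omega>. f (X r \<omega>) \<partial>(\<beta> \<bind> Q)) = 0" if "0 \<le> r" for r
    proof -
      have "(\<integral>\<omega>. f (X r \<omega>) \<partial>(\<beta> \<bind> Q)) = (\<integral>x. transition r f x \<partial>\<beta>)"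
        unfolding transition_def
        by (rule integral_initial_law[OF \<beta>_prob_algebra fX[OF that], of 1])
           (use that in \<open>auto intro!: f_abs_le X_in_space\<close>)
      also have "\<dots> = 0"
        using integral_transition[OF that measurable_f f_abs_le] centred_f by simp
      finally show ?thesis .
    qed
    have "covariance (\<beta> \<bind> Q) (\<lambda>\<omega>. f (X 0 \<omega>)) (\<lambda>\<omega>. f (X s \<omega>))
        = (\<integral>\<omega>. f (X 0 \<omega>) * f (X s \<omega>) \<partial>(\<beta> \<bind> Q))"
      using centred[of 0] centred[OF s] by (simp add: covariance_def)
    also have "\<dots> = (\<integral>x. (\<integral>\<omega>. f (X 0 \<omega>) * f (X s \<omega>) \<partial>Q x) \<partial>\<beta>)"
    proof (rule integral_initial_law[OF \<beta>_prob_algebra])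
      show "(\<lambda>\<omega>. f (X 0 \<omega>) * f (X s \<omega>)) \<in> borel_measurable M"
        using fX[of 0] fX[OF s] by simp
      show "\<bar>f (X 0 \<omega>) * f (X s \<omega>)\<bar> \<le> 1" if "\<omega> \<in> space M" for \<omega>
        by (intro mult_f_abs_le f_abs_le X_in_space that s) simp
    qed
    also have "\<dots> = correlation s"
      unfolding correlation_def
      by (rule Bochner_Integration.integral_cong)
         (auto simp: integral_at_time_0[OF _ measurable_f fX[OF s]] transition_def space_\<beta>)
    finally show ?thesis .
  qed
  then have "(LINT s:{0..}|lborel. covariance (\<beta> \<bind> Q) (\<lambda>\<omega>. f (X 0 \<omega>)) (\<lambda>\<omega>. f (X s \<omega>))) = total_correlation"
    unfolding total_correlation_def by (intro set_lebesgue_integral_cong) auto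
  then show ?thesis by (simp add: asymptotic_variance_def)
qed

context
  fixes \<mu> :: "'e measure"
  assumes \<mu>: "\<mu> \<in> space (prob_algebra E)" and integrable_\<mu>\<psi>: "integrable \<mu> \<psi>"
begin

lemma prob_space_\<mu>: "prob_space \<mu>" and sets_\<mu>: "sets \<mu> = sets E"
  using \<mu> by (auto simp: space_prob_algebra)

lemma space_\<mu>: "space \<mu> = space E"
  using sets_\<mu> by (rule sets_eq_imp_space_eq)

lemma time_integral_power_abs_le:
  assumes "\<omega> \<in> space M"
  shows "\<bar>(b * A t \<omega>) ^ n\<bar> \<le> (\<bar>b\<bar> * \<bar>t\<bar>) ^ n"
proof -
  have "\<bar>A t \<omega>\<bar> \<le> \<bar>t\<bar>"
    using time_integral_abs_le[OF assms, of t]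
    by (cases "0 \<le> t") (auto simp: time_integral_def set_lebesgue_integral_def)
  then show ?thesis
    unfolding power_abs abs_mult by (intro power_mono mult_left_mono) auto
qed

lemma integrable_scaled_power: "integrable (\<mu> \<bind> Q) (\<lambda>\<omega>. (b * A t \<omega>) ^ n)"
  by (rule integrable_initial_law[OF \<mu> _ time_integral_power_abs_le]) measurable

lemma integrable_\<mu>_moment:
  assumes "0 \<le> t"
  shows "integrable \<mu> (moment n t)"
proof -
  interpret prob_space \<mu> by (rule prob_space_\<mu>)
  show ?thesis
    by (rule integrable_const_bound[where B = "t ^ n / fact n"])
       (use assms in \<open>auto intro!: AE_I2 moment_abs_le simp: space_\<mu> measurable_cong_sets[OF sets_\<mu> refl]\<close>)
qed

lemma integral_time_integral_power:
  "(\<integral>\<omega>. A t \<omega> ^ n \<partial>(\<mu> \<bind> Q)) = fact n * (\<integral>x. moment n t x \<partial>\<mu>)"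
proof -
  have "(\<integral>\<omega>. A t \<omega> ^ n \<partial>(\<mu> \<bind> Q)) = (\<integral>x. (\<integral>\<omega>. A t \<omega> ^ n \<partial>Q x) \<partial>\<mu>)"
    by (rule integral_initial_law[OF \<mu>, of _ "(\<bar>1\<bar> * \<bar>t\<bar>) ^ n"])
       (use time_integral_power_abs_le[of _ 1 t n] in auto)
  then show ?thesis by (simp add: moment_def)
qed

lemma even_moment_estimate:
  assumes t: "0 < t"
  shows "\<bar>(\<integral>\<omega>. 1 / t ^ Suc j * A t \<omega> ^ (2 * Suc j) \<partial>(\<mu> \<bind> Q))
      - fact (2 * Suc j) / fact (Suc j) * (asymptotic_variance X Q \<beta> f ^ Suc j / 2 ^ Suc j)\<bar>
    \<le> fact (2 * Suc j) * (a ^ j * moment_error_const) * (real (Suc j) / fact j) * ((\<integral>x. \<psi> x \<partial>\<mu>) / t)"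
proof -
  interpret prob_space \<mu> by (rule prob_space_\<mu>)
  let ?k = "Suc j"
  let ?R = "moment_error_const * a ^ j * real ?k * (t ^ j / fact j)"
  have int: "integrable \<mu> (\<lambda>x. moment (2 * ?k) t x - leading ?k t)"
    using integrable_\<mu>_moment[of t] t by auto
  have "\<bar>(\<integral>x. moment (2 * ?k) t x \<partial>\<mu>) - leading ?k t\<bar> = \<bar>\<integral>x. moment (2 * ?k) t x - leading ?k t \<partial>\<mu>\<bar>"
    using integrable_\<mu>_moment[of t] t by (simp add: prob_space)
  also have "\<dots> \<le> (\<integral>x. \<bar>moment (2 * ?k) t x - leading ?k t\<bar> \<partial>\<mu>)" by (rule integral_abs_bound)
  also have "\<dots> \<le> (\<integral>x. ?R * \<psi> x \<partial>\<mu>)"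
    by (rule integral_mono[OF integrable_abs[OF int] integrable_mult_right[OF integrable_\<mu>\<psi>]])
       (rule even_moment_error[OF _ t], simp add: space_\<mu>)
  also have "\<dots> = ?R * (\<integral>x. \<psi> x \<partial>\<mu>)" by (rule integral_mult_right_zero)
  finally have le: "\<bar>(\<integral>x. moment (2 * ?k) t x \<partial>\<mu>) - leading ?k t\<bar> \<le> ?R * (\<integral>x. \<psi> x \<partial>\<mu>)" .
  have "(\<integral>\<omega>. 1 / t ^ ?k * A t \<omega> ^ (2 * ?k) \<partial>(\<mu> \<bind> Q)) = 1 / t ^ ?k * (fact (2 * ?k) * (\<integral>x. moment (2 * ?k) t x \<partial>\<mu>))"
    unfolding integral_time_integral_power[symmetric] by (rule integral_mult_right_zero)
  moreover have "fact (2 * ?k) / fact ?k * (asymptotic_variance X Q \<beta> f ^ ?k / 2 ^ ?k)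
      = 1 / t ^ ?k * (fact (2 * ?k) * leading ?k t)"
  proof -
    have "asymptotic_variance X Q \<beta> f ^ ?k / 2 ^ ?k = total_correlation ^ ?k"
      unfolding asymptotic_variance_eq power_mult_distrib by simp
    then show ?thesis using t by (simp add: leading_def del: power_Suc fact_Suc)
  qed
  ultimately have "\<bar>(\<integral>\<omega>. 1 / t ^ ?k * A t \<omega> ^ (2 * ?k) \<partial>(\<mu> \<bind> Q))
      - fact (2 * ?k) / fact ?k * (asymptotic_variance X Q \<beta> f ^ ?k / 2 ^ ?k)\<bar>
      = 1 / t ^ ?k * fact (2 * ?k) * \<bar>(\<integral>x. moment (2 * ?k) t x \<partial>\<mu>) - leading ?k t\<bar>"
    using t by (simp add: abs_mult right_diff_distrib[symmetric] diff_divide_distrib[symmetric] mult.assoc del: power_Suc fact_Suc)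
  also have "\<dots> \<le> 1 / t ^ ?k * fact (2 * ?k) * (?R * (\<integral>x. \<psi> x \<partial>\<mu>))"
    using t by (intro mult_left_mono le) auto
  also have "\<dots> = fact (2 * ?k) * (a ^ j * moment_error_const) * (real ?k / fact j) * ((\<integral>x. \<psi> x \<partial>\<mu>) / t)"
    using t by (simp add: field_simps del: fact_Suc of_nat_Suc)
  finally show ?thesis .
qed

text \<open>
The moment of order \<open>2 * k + 1\<close> has the degree \<open>k\<close> in \<open>t\<close> only, half a power below the normalisation.
\<close>

lemma odd_moment_estimate:
  assumes t: "1 \<le> t"
  shows "\<bar>\<integral>\<omega>. 1 / (t ^ k * sqrt t) * A t \<omega> ^ (2 * k + 1) \<partial>(\<mu> \<bind> Q)\<bar>
    \<le> fact (2 * k + 1) * (2 * a ^ (2 * k + 1) * exp_partial k (1 / a) / c) * (\<integral>x. \<psi> x \<partial>\<mu>) / sqrt t"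
proof -
  let ?K = "2 * a ^ (2 * k + 1) * exp_partial k (1 / a) / c"
  have partial: "exp_partial k (t / a) \<le> t ^ k * exp_partial k (1 / a)"
    unfolding exp_partial_def sum_distrib_left
  proof (rule sum_mono)
    fix p assume "p \<in> {..k}"
    then have "t ^ p * ((1 / a) ^ p / fact p) \<le> t ^ k * ((1 / a) ^ p / fact p)"
      using t a_pos by (intro mult_right_mono power_increasing) auto
    then show "(t / a) ^ p / fact p \<le> t ^ k * ((1 / a) ^ p / fact p)"
      by (simp add: power_divide)
  qed
  have "\<bar>\<integral>x. moment (2 * k + 1) t x \<partial>\<mu>\<bar> \<le> (\<integral>x. \<bar>moment (2 * k + 1) t x\<bar> \<partial>\<mu>)"
    by (rule integral_abs_bound)
  also have "\<dots> \<le> (\<integral>x. t ^ k * ?K * \<psi> x \<partial>\<mu>)"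
  proof (rule integral_mono)
    show "integrable \<mu> (\<lambda>x. \<bar>moment (2 * k + 1) t x\<bar>)"
      using t by (intro integrable_abs integrable_\<mu>_moment) auto
    show "integrable \<mu> (\<lambda>x. t ^ k * ?K * \<psi> x)"
      by (rule integrable_mult_right[OF integrable_\<mu>\<psi>])
    fix x assume "x \<in> space \<mu>"
    then have x: "x \<in> space E" by (simp add: space_\<mu>)
    have "\<bar>moment (2 * k + 1) t x\<bar> \<le> 2 * a ^ (2 * k + 1) * exp_partial k (t / a) * (\<psi> x / c)"
      using t by (intro odd_moment_bound x) auto
    also have "\<dots> \<le> 2 * a ^ (2 * k + 1) * (t ^ k * exp_partial k (1 / a)) * (\<psi> x / c)"
      using a_pos c_pos \<psi>_pos[OF x] by (intro mult_right_mono mult_left_mono partial) auto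
    finally show "\<bar>moment (2 * k + 1) t x\<bar> \<le> t ^ k * ?K * \<psi> x"
      by (simp add: mult_ac)
  qed
  also have "\<dots> = t ^ k * ?K * (\<integral>x. \<psi> x \<partial>\<mu>)" by (rule integral_mult_right_zero)
  finally have le: "\<bar>\<integral>x. moment (2 * k + 1) t x \<partial>\<mu>\<bar> \<le> t ^ k * ?K * (\<integral>x. \<psi> x \<partial>\<mu>)" .
  have "(\<integral>\<omega>. 1 / (t ^ k * sqrt t) * A t \<omega> ^ (2 * k + 1) \<partial>(\<mu> \<bind> Q))
      = 1 / (t ^ k * sqrt t) * (fact (2 * k + 1) * (\<integral>x. moment (2 * k + 1) t x \<partial>\<mu>))"
    unfolding integral_time_integral_power[symmetric] by (rule integral_mult_right_zero)
  then have "\<bar>\<integral>\<omega>. 1 / (t ^ k * sqrt t) * A t \<omega> ^ (2 * k + 1) \<partial>(\<mu> \<bind> Q)\<bar>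
      = 1 / (t ^ k * sqrt t) * fact (2 * k + 1) * \<bar>\<integral>x. moment (2 * k + 1) t x \<partial>\<mu>\<bar>"
    using t by (simp only: abs_mult mult.assoc abs_of_nonneg[OF fact_ge_zero]) simp
  also have "\<dots> \<le> 1 / (t ^ k * sqrt t) * fact (2 * k + 1) * (t ^ k * ?K * (\<integral>x. \<psi> x \<partial>\<mu>))"
    using t by (intro mult_left_mono le) auto
  also have "\<dots> = fact (2 * k + 1) * ?K * (\<integral>x. \<psi> x \<partial>\<mu>) / sqrt t"
    using t by (simp add: mult_ac)
  finally show ?thesis .
qed

lemma odd_moment_tendsto:
  "((\<lambda>t. \<integral>\<omega>. 1 / (t ^ k * sqrt t) * A t \<omega> ^ (2 * k + 1) \<partial>(\<mu> \<bind> Q)) \<longlongrightarrow> 0) at_top"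
proof (rule Lim_null_comparison)
  let ?K = "fact (2 * k + 1) * (2 * a ^ (2 * k + 1) * exp_partial k (1 / a) / c) * (\<integral>x. \<psi> x \<partial>\<mu>)"
  show "\<forall>\<^sub>F t in at_top. norm (\<integral>\<omega>. 1 / (t ^ k * sqrt t) * A t \<omega> ^ (2 * k + 1) \<partial>(\<mu> \<bind> Q)) \<le> ?K / sqrt t"
    using eventually_ge_at_top[of 1] by eventually_elim (simp only: real_norm_def odd_moment_estimate)
  show "((\<lambda>t. ?K / sqrt t) \<longlongrightarrow> 0) at_top"
    by (intro tendsto_divide_0[OF tendsto_const] filterlim_at_top_imp_at_infinity sqrt_at_top)
qed

lemma even_moment_tendsto:
  "((\<lambda>t. \<integral>\<omega>. 1 / t ^ k * A t \<omega> ^ (2 * k) \<partial>(\<mu> \<bind> Q))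
    \<longlongrightarrow> fact (2 * k) / fact k * (asymptotic_variance X Q \<beta> f ^ k / 2 ^ k)) at_top"
proof (cases k)
  case 0
  have "prob_space (\<mu> \<bind> Q)" by (rule prob_space_bind'[OF \<mu> kernel])
  then show ?thesis by (simp add: 0 prob_space.prob_space)
next
  case (Suc j)
  let ?L = "fact (2 * k) / fact k * (asymptotic_variance X Q \<beta> f ^ k / 2 ^ k)"
  let ?K = "fact (2 * k) * (a ^ j * moment_error_const) * (real k / fact j) * (\<integral>x. \<psi> x \<partial>\<mu>)"
  have "((\<lambda>t. (\<integral>\<omega>. 1 / t ^ k * A t \<omega> ^ (2 * k) \<partial>(\<mu> \<bind> Q)) - ?L) \<longlongrightarrow> 0) at_top"
  proof (rule Lim_null_comparison)
    show "\<forall>\<^sub>F t in at_top. norm ((\<integral>\<omega>. 1 / t ^ k * A t \<omega> ^ (2 * k) \<partial>(\<mu> \<bind> Q)) - ?L) \<le> ?K / t"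
      using eventually_gt_at_top[of 0]
      by eventually_elim (use even_moment_estimate[of _ j] in \<open>simp only: real_norm_def Suc times_divide_eq_right\<close>)
    show "((\<lambda>t. ?K / t) \<longlongrightarrow> 0) at_top"
      by (intro tendsto_divide_0[OF tendsto_const] filterlim_at_top_imp_at_infinity filterlim_ident)
  qed
  then show ?thesis by (rule Lim_transform_eq[THEN iffD2, rotated, OF tendsto_const])
qed

end

end

section \<open>The method of moments and the central limit theorem\<close>

text \<open>
The characteristic functions converge: up to an error bounded by the moment of order \<open>2 * k\<close>, each
of them is its Taylor polynomial, and those converge with the moments. As the moments of order
\<open>2 * k\<close> converge as well, the limiting error is governed by the moment of the limit, which the growth
condition makes small for large \<open>k\<close>.
\<close>

lemma weak_conv_of_moments:
  fixes \<mu> :: "nat \<Rightarrow> real measure" and \<nu> :: "real measure"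
  assumes \<mu>: "\<And>n. real_distribution (\<mu> n)" and \<nu>: "real_distribution \<nu>"
    and int_\<mu>: "\<And>n k. integrable (\<mu> n) (\<lambda>x. x ^ k)" and int_\<nu>: "\<And>k. integrable \<nu> (\<lambda>x. x ^ k)"
    and moments: "\<And>k. (\<lambda>n. \<integral>x. x ^ k \<partial>\<mu> n) \<longlonglongrightarrow> (\<integral>x. x ^ k \<partial>\<nu>)"
    and growth: "\<And>u::real. (\<lambda>k. u ^ (2 * k) / fact (2 * k) * (\<integral>x. x ^ (2 * k) \<partial>\<nu>)) \<longlonglongrightarrow> 0"
  shows "weak_conv_m \<mu> \<nu>"
proof (rule levy_continuity[OF \<mu> \<nu>])
  fix u :: real
  define P where "P k \<kappa> = (\<Sum>j\<le>2 * k. (\<i> * u) ^ j / fact j * complex_of_real (\<integral>x. x ^ j \<partial>\<kappa>))"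
    for k :: nat and \<kappa> :: "real measure"
  define R where "R k \<kappa> = 2 * (u ^ (2 * k) / fact (2 * k) * (\<integral>x. x ^ (2 * k) \<partial>\<kappa>))"
    for k :: nat and \<kappa> :: "real measure"
  have taylor: "cmod (char \<kappa> u - P k \<kappa>) \<le> R k \<kappa>"
    if "real_distribution \<kappa>" "\<And>j. integrable \<kappa> (\<lambda>x. x ^ j)" for \<kappa> k
    using real_distribution.char_approx1[OF that(1), of "2 * k" u] that(2)
    by (simp add: P_def R_def power_even_abs mult.assoc)
  have P_conv: "(\<lambda>n. P k (\<mu> n)) \<longlonglongrightarrow> P k \<nu>" for k
    unfolding P_def by (intro tendsto_intros moments)
  have R_conv: "(\<lambda>n. R k (\<mu> n)) \<longlonglongrightarrow> R k \<nu>" for k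
    unfolding R_def by (intro tendsto_intros moments)
  have "(\<lambda>k. 2 * (2 * (u ^ (2 * k) / fact (2 * k) * (\<integral>x. x ^ (2 * k) \<partial>\<nu>)))) \<longlonglongrightarrow> 2 * (2 * 0)"
    by (intro tendsto_intros growth)
  then have R_lim: "(\<lambda>k. 2 * R k \<nu>) \<longlonglongrightarrow> 0" by (simp add: R_def)
  show "(\<lambda>n. char (\<mu> n) u) \<longlonglongrightarrow> char \<nu> u"
  proof (rule tendstoI)
    fix \<epsilon> :: real assume "0 < \<epsilon>"
    with order_tendstoD(2)[OF R_lim] obtain k where k: "2 * R k \<nu> < \<epsilon>"
      by (auto simp: eventually_sequentially)
    have "(\<lambda>n. R k (\<mu> n) + cmod (P k (\<mu> n) - P k \<nu>) + R k \<nu>) \<longlonglongrightarrow> R k \<nu> + cmod (P k \<nu> - P k \<nu>) + R k \<nu>"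
      by (intro tendsto_intros R_conv P_conv)
    with k have "\<forall>\<^sub>F n in sequentially. R k (\<mu> n) + cmod (P k (\<mu> n) - P k \<nu>) + R k \<nu> < \<epsilon>"
      by (intro order_tendstoD(2)) auto
    then show "\<forall>\<^sub>F n in sequentially. dist (char (\<mu> n) u) (char \<nu> u) < \<epsilon>"
    proof eventually_elim
      case (elim n)
      have "dist (char (\<mu> n) u) (char \<nu> u)
          = cmod ((char (\<mu> n) u - P k (\<mu> n)) + (P k (\<mu> n) - P k \<nu>) - (char \<nu> u - P k \<nu>))"
        by (simp add: dist_norm)
      also have "\<dots> \<le> cmod ((char (\<mu> n) u - P k (\<mu> n)) + (P k (\<mu> n) - P k \<nu>)) + cmod (char \<nu> u - P k \<nu>)"
        by (rule norm_triangle_ineq4)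
      also have "cmod ((char (\<mu> n) u - P k (\<mu> n)) + (P k (\<mu> n) - P k \<nu>))
          \<le> cmod (char (\<mu> n) u - P k (\<mu> n)) + cmod (P k (\<mu> n) - P k \<nu>)"
        by (rule norm_triangle_ineq)
      also have "cmod (char (\<mu> n) u - P k (\<mu> n)) \<le> R k (\<mu> n)"
        by (rule taylor[OF \<mu> int_\<mu>])
      also have "cmod (char \<nu> u - P k \<nu>) \<le> R k \<nu>"
        by (rule taylor[OF \<nu> int_\<nu>])
      finally show ?case using elim by simp
    qed
  qed
qed

lemma
  assumes s: "0 < s"
  shows integrable_normal_power: "integrable (density lborel (normal_density 0 s)) (\<lambda>x. x ^ k)"
    and integral_normal_even_power:
      "(\<integral>x. x ^ (2 * k) \<partial>density lborel (normal_density 0 s)) = fact (2 * k) / fact k * ((s\<^sup>2) ^ k / 2 ^ k)"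
    and integral_normal_odd_power:
      "(\<integral>x. x ^ (2 * k + 1) \<partial>density lborel (normal_density 0 s)) = 0"
proof -
  have eq: "(\<integral>x. x ^ n \<partial>density lborel (normal_density 0 s)) = (\<integral>x. normal_density 0 s x * (x - 0) ^ n \<partial>lborel)" for n
    by (subst integral_density) (auto simp: normal_density_nonneg)
  show "integrable (density lborel (normal_density 0 s)) (\<lambda>x. x ^ k)"
    using integrable_normal_moment[OF s, of 0 k] by (subst integrable_density) auto
  show "(\<integral>x. x ^ (2 * k) \<partial>density lborel (normal_density 0 s)) = fact (2 * k) / fact k * ((s\<^sup>2) ^ k / 2 ^ k)"
    unfolding eq integral_normal_moment_even[OF s] using s by (simp add: power_divide)
  show "(\<integral>x. x ^ (2 * k + 1) \<partial>density lborel (normal_density 0 s)) = 0"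
    unfolding eq by (rule integral_normal_moment_odd[OF s])
qed

lemma real_distribution_normal:
  "0 < s \<Longrightarrow> real_distribution (density lborel (normal_density 0 s))"
  using prob_space_normal_density[of s 0]
  by (simp add: real_distribution_def real_distribution_axioms_def)

lemma normal_moments_growth:
  assumes s: "0 < s"
  shows "(\<lambda>k. u ^ (2 * k) / fact (2 * k) * (\<integral>x. x ^ (2 * k) \<partial>density lborel (normal_density 0 s)))
    \<longlonglongrightarrow> (0::real)"
proof -
  have "u ^ (2 * k) / fact (2 * k) * (\<integral>x. x ^ (2 * k) \<partial>density lborel (normal_density 0 s))
      = (u\<^sup>2 * s\<^sup>2 / 2) ^ k / fact k" for k
    unfolding integral_normal_even_power[OF s]
    by (simp add: power_mult power_divide power_mult_distrib)
  moreover have "(\<lambda>k. (u\<^sup>2 * s\<^sup>2 / 2) ^ k / fact k) \<longlonglongrightarrow> 0"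
    using summable_LIMSEQ_zero[OF summable_exp[of "u\<^sup>2 * s\<^sup>2 / 2"]] by (simp add: field_simps)
  ultimately show ?thesis by simp
qed

lemma (in ergodic_functional) central_limit_theorem:
  assumes \<mu>: "\<mu> \<in> space (prob_algebra E)" "integrable \<mu> \<psi>"
    and pos: "0 < asymptotic_variance X Q \<beta> f"
  shows "weak_conv_along at_top (\<lambda>t. distr (\<mu> \<bind> Q) borel (\<lambda>\<omega>. 1 / sqrt t * A t \<omega>))
    (density lborel (normal_density 0 (sqrt (asymptotic_variance X Q \<beta> f))))"
proof -
  let ?N = "density lborel (normal_density 0 (sqrt (asymptotic_variance X Q \<beta> f)))"
  let ?D = "\<lambda>t. distr (\<mu> \<bind> Q) borel (\<lambda>\<omega>. 1 / sqrt t * A t \<omega>)"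
  interpret prob_space "\<mu> \<bind> Q" by (rule prob_space_bind'[OF \<mu>(1) kernel])
  have s: "0 < sqrt (asymptotic_variance X Q \<beta> f)" using pos by simp
  have meas: "(\<lambda>\<omega>. 1 / sqrt t * A t \<omega>) \<in> borel_measurable (\<mu> \<bind> Q)" for t
    by (subst measurable_cong_sets[OF sets_bind'[OF \<mu>(1) kernel] refl]) measurable
  have real_distr: "real_distribution (?D t)" for t
    by (rule real_distribution_distr[OF meas])
  have moment_eq: "(\<integral>x. x ^ k \<partial>?D t) = (\<integral>\<omega>. (1 / sqrt t * A t \<omega>) ^ k \<partial>(\<mu> \<bind> Q))" for k t
    by (rule integral_distr[OF meas]) simp
  have moments: "((\<lambda>t. \<integral>x. x ^ k \<partial>?D t) \<longlongrightarrow> (\<integral>x. x ^ k \<partial>?N)) at_top" for k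
  proof (cases "even k")
    case True
    then obtain m where k: "k = 2 * m" by (elim evenE)
    show ?thesis
    proof (rule Lim_transform_eventually)
      show "((\<lambda>t. \<integral>\<omega>. 1 / t ^ m * A t \<omega> ^ (2 * m) \<partial>(\<mu> \<bind> Q)) \<longlongrightarrow> (\<integral>x. x ^ k \<partial>?N)) at_top"
        using even_moment_tendsto[OF \<mu>, of m] pos by (simp only: k integral_normal_even_power[OF s] real_sqrt_pow2 less_imp_le)
      show "\<forall>\<^sub>F t in at_top. (\<integral>\<omega>. 1 / t ^ m * A t \<omega> ^ (2 * m) \<partial>(\<mu> \<bind> Q)) = (\<integral>x. x ^ k \<partial>?D t)"
        using eventually_gt_at_top[of 0]
      proof eventually_elim
        case (elim t)
        then have "(1 / sqrt t * y) ^ (2 * m) = 1 / t ^ m * y ^ (2 * m)" for y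
          by (simp add: power_mult_distrib power_divide power_mult)
        then show ?case by (simp only: moment_eq k)
      qed
    qed
  next
    case False
    then obtain m where k: "k = 2 * m + 1" by (elim oddE)
    show ?thesis
    proof (rule Lim_transform_eventually)
      show "((\<lambda>t. \<integral>\<omega>. 1 / (t ^ m * sqrt t) * A t \<omega> ^ (2 * m + 1) \<partial>(\<mu> \<bind> Q)) \<longlongrightarrow> (\<integral>x. x ^ k \<partial>?N)) at_top"
        using odd_moment_tendsto[OF \<mu>, of m] by (simp only: k integral_normal_odd_power[OF s])
      show "\<forall>\<^sub>F t in at_top. (\<integral>\<omega>. 1 / (t ^ m * sqrt t) * A t \<omega> ^ (2 * m + 1) \<partial>(\<mu> \<bind> Q)) = (\<integral>x. x ^ k \<partial>?D t)"
        using eventually_gt_at_top[of 0]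
      proof eventually_elim
        case (elim t)
        then have "(1 / sqrt t * y) ^ (2 * m + 1) = 1 / (t ^ m * sqrt t) * y ^ (2 * m + 1)" for y
          by (simp add: power_mult_distrib power_divide power_mult)
        then show ?case by (simp only: moment_eq k)
      qed
    qed
  qed
  have integrable_D: "integrable (?D t) (\<lambda>x. x ^ k)" for t k
    using integrable_scaled_power[OF \<mu>, of "1 / sqrt t" t k]
    by (subst integrable_distr_eq[OF meas]) auto
  show ?thesis
    unfolding weak_conv_along_at_top_iff[OF real_distr real_distribution_normal[OF s]]
  proof (intro allI impI)
    fix T :: "nat \<Rightarrow> real" assume T: "filterlim T at_top sequentially"
    show "weak_conv_m (\<lambda>n. ?D (T n)) ?N"
    proof (rule weak_conv_of_moments[OF real_distr real_distribution_normal[OF s]])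
      show "integrable (?D (T n)) (\<lambda>x. x ^ k)" for n k by (rule integrable_D)
      show "integrable ?N (\<lambda>x. x ^ k)" for k by (rule integrable_normal_power[OF s])
      show "(\<lambda>n. \<integral>x. x ^ k \<partial>?D (T n)) \<longlonglongrightarrow> (\<integral>x. x ^ k \<partial>?N)" for k
        by (rule filterlim_compose[OF moments T])
      show "(\<lambda>k. u ^ (2 * k) / fact (2 * k) * (\<integral>x. x ^ (2 * k) \<partial>?N)) \<longlonglongrightarrow> 0" for u :: real
        by (rule normal_moments_growth[OF s])
    qed
  qed
qed

theorem theorem2:
  fixes E :: "'e measure" and M :: "'w measure"
    and X :: "real \<Rightarrow> 'w \<Rightarrow> 'e" and Q :: "'e \<Rightarrow> 'w measure"
    and \<beta> :: "'e measure" and \<psi> :: "'e \<Rightarrow> real" and c C \<gamma> :: real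
  assumes "markov_process E M X Q"
    and "invariant_prob E X Q \<beta>"
    and "c > 0" and "\<psi> \<in> borel_measurable E" and "\<And>x. x \<in> space E \<Longrightarrow> c \<le> \<psi> x"
    and "C > 0" and "\<gamma> > 0"
    and "\<And>x t. x \<in> space E \<Longrightarrow> t \<ge> 0 \<Longrightarrow>
      weighted_dist E \<psi> (distr (Q x) E (X t)) \<beta> \<le> ennreal (C * exp (- \<gamma> * t) * \<psi> x)"
  shows "\<exists>C\<^sub>1>0.
    (\<exists>D :: nat \<Rightarrow> real. (\<forall>k\<ge>1. D k > 0) \<and>
      (\<forall>k\<ge>1. \<forall>\<mu>\<in>space (prob_algebra E). integrable \<mu> \<psi> \<longrightarrow>
        (\<forall>f\<in>unit_bounded E. (\<integral>x. f x \<partial>\<beta>) = 0 \<longrightarrow>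
          (\<forall>t>0. \<bar>(\<integral>\<omega>. 1 / t ^ k * time_integral X f t \<omega> ^ (2 * k) \<partial>(\<mu> \<bind> Q))
                - fact (2 * k) / fact k * (asymptotic_variance X Q \<beta> f ^ k / 2 ^ k)\<bar>
            \<le> fact (2 * k) * D k * C\<^sub>1 * (real k / fact (k - 1)) * ((\<integral>x. \<psi> x \<partial>\<mu>) / t)))))
    \<and>
    (\<forall>k::nat. \<forall>\<mu>\<in>space (prob_algebra E). integrable \<mu> \<psi> \<longrightarrow>
      (\<forall>f\<in>unit_bounded E. (\<integral>x. f x \<partial>\<beta>) = 0 \<longrightarrow>
        ((\<lambda>t. \<integral>\<omega>. 1 / (t ^ k * sqrt t) * time_integral X f t \<omega> ^ (2 * k + 1) \<partial>(\<mu> \<bind> Q))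
          \<longlongrightarrow> 0) at_top))
    \<and>
    (\<forall>\<mu>\<in>space (prob_algebra E). integrable \<mu> \<psi> \<longrightarrow>
      (\<forall>f\<in>unit_bounded E. (\<integral>x. f x \<partial>\<beta>) = 0 \<longrightarrow> asymptotic_variance X Q \<beta> f > 0 \<longrightarrow>
        weak_conv_along at_top
          (\<lambda>t. distr (\<mu> \<bind> Q) borel (\<lambda>\<omega>. 1 / sqrt t * time_integral X f t \<omega>))
          (density lborel (normal_density 0 (sqrt (asymptotic_variance X Q \<beta> f))))))
    \<and>
    (let D = (\<lambda>k::nat. max ((C / \<gamma> * (1 + (\<integral>x. \<psi> x \<partial>\<beta>) / c)) ^ (k - 1)) 1
                * max (C\<^sup>2 / c) (C * (\<integral>x. \<psi> x \<partial>\<beta>) / (c\<^sup>2 * \<gamma>)))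
     in (\<forall>k\<ge>1. D k > 0) \<and>
      (\<forall>k\<ge>1. \<forall>\<mu>\<in>space (prob_algebra E). integrable \<mu> \<psi> \<longrightarrow>
        (\<forall>f\<in>unit_bounded E. (\<integral>x. f x \<partial>\<beta>) = 0 \<longrightarrow>
          (\<forall>t>0. \<bar>(\<integral>\<omega>. 1 / t ^ k * time_integral X f t \<omega> ^ (2 * k) \<partial>(\<mu> \<bind> Q))
                - fact (2 * k) / fact k * (asymptotic_variance X Q \<beta> f ^ k / 2 ^ k)\<bar>
            \<le> fact (2 * k) * D k * C\<^sub>1 * (real k / fact (k - 1)) * ((\<integral>x. \<psi> x \<partial>\<mu>) / t)))))"
proof -
  interpret weighted_ergodic E M X Q \<beta> \<psi> c C \<gamma>
    using assms by (simp add: weighted_ergodic_def weighted_ergodic_axioms_def)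
  have functional: "ergodic_functional E M X Q \<beta> \<psi> c C \<gamma> f"
    if "f \<in> unit_bounded E" "(\<integral>x. f x \<partial>\<beta>) = 0" for f
    by unfold_locales (use that in auto)
  \<comment> \<open>The second factor of \<open>D k\<close> is at least \<open>C\<^sup>2 / c\<close>; with this choice
    \<open>D k * C\<^sub>1\<close> is at least \<open>a\<^sup>k\<^sup>-\<^sup>1 * moment_error_const\<close>.\<close>
  define C\<^sub>1 where "C\<^sub>1 = moment_error_const / (C\<^sup>2 / c)"
  define D where "D = (\<lambda>k::nat. max ((C / \<gamma> * (1 + (\<integral>x. \<psi> x \<partial>\<beta>) / c)) ^ (k - 1)) 1
    * max (C\<^sup>2 / c) (C * (\<integral>x. \<psi> x \<partial>\<beta>) / (c\<^sup>2 * \<gamma>)))"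
  have C2: "0 < C\<^sup>2 / c" using C_pos c_pos by simp
  have C1_pos: "0 < C\<^sub>1" unfolding C\<^sub>1_def using moment_error_const_pos C2 by (rule divide_pos_pos)
  have D_pos: "0 < D k" for k
    unfolding D_def by (intro mult_pos_pos) (use C2 in \<open>auto simp: less_max_iff_disj\<close>)
  have D_ge: "a ^ j * moment_error_const \<le> D (Suc j) * C\<^sub>1" for j
  proof -
    have "a ^ j \<le> max ((\<alpha> * (1 + B)) ^ j) 1"
      unfolding a_def by (cases "1 \<le> \<alpha> * (1 + B)") (auto simp: max_def)
    then have "a ^ j * (C\<^sup>2 / c) \<le> D (Suc j)"
      unfolding D_def \<alpha>_def B_def diff_Suc_1 using C2 by (intro mult_mono) auto
    then have "a ^ j * (C\<^sup>2 / c) * C\<^sub>1 \<le> D (Suc j) * C\<^sub>1"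
      using C1_pos by (intro mult_right_mono) auto
    moreover have "a ^ j * (C\<^sup>2 / c) * C\<^sub>1 = a ^ j * moment_error_const"
      using C_pos c_pos by (simp add: C\<^sub>1_def)
    ultimately show ?thesis by simp
  qed
  have even: "\<forall>k\<ge>1. \<forall>\<mu>\<in>space (prob_algebra E). integrable \<mu> \<psi> \<longrightarrow>
        (\<forall>f\<in>unit_bounded E. (\<integral>x. f x \<partial>\<beta>) = 0 \<longrightarrow>
          (\<forall>t>0. \<bar>(\<integral>\<omega>. 1 / t ^ k * time_integral X f t \<omega> ^ (2 * k) \<partial>(\<mu> \<bind> Q))
                - fact (2 * k) / fact k * (asymptotic_variance X Q \<beta> f ^ k / 2 ^ k)\<bar>
            \<le> fact (2 * k) * D k * C\<^sub>1 * (real k / fact (k - 1)) * ((\<integral>x. \<psi> x \<partial>\<mu>) / t)))"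
  proof (intro allI ballI impI)
    fix k :: nat and \<mu> f and t :: real
    assume k: "1 \<le> k" and \<mu>: "\<mu> \<in> space (prob_algebra E)" "integrable \<mu> \<psi>"
      and f: "f \<in> unit_bounded E" "(\<integral>x. f x \<partial>\<beta>) = 0" and t: "0 < t"
    interpret F: ergodic_functional E M X Q \<beta> \<psi> c C \<gamma> f by (rule functional[OF f])
    from k obtain j where j: "k = Suc j" by (cases k) auto
    have "0 \<le> (\<integral>x. \<psi> x \<partial>\<mu>)"
      by (rule Bochner_Integration.integral_nonneg) (use \<psi>_pos F.space_\<mu>[OF \<mu>] in \<open>auto intro: less_imp_le\<close>)
    then have "fact (2 * k) * (a ^ j * moment_error_const) * (real k / fact j) * ((\<integral>x. \<psi> x \<partial>\<mu>) / t)
        \<le> fact (2 * k) * (D k * C\<^sub>1) * (real k / fact j) * ((\<integral>x. \<psi> x \<partial>\<mu>) / t)"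
      using t D_ge[of j] unfolding j by (intro mult_right_mono mult_left_mono) auto
    then show "\<bar>(\<integral>\<omega>. 1 / t ^ k * time_integral X f t \<omega> ^ (2 * k) \<partial>(\<mu> \<bind> Q))
                - fact (2 * k) / fact k * (asymptotic_variance X Q \<beta> f ^ k / 2 ^ k)\<bar>
            \<le> fact (2 * k) * D k * C\<^sub>1 * (real k / fact (k - 1)) * ((\<integral>x. \<psi> x \<partial>\<mu>) / t)"
      using F.even_moment_estimate[OF \<mu> t, of j] unfolding j diff_Suc_1 mult.assoc by linarith
  qed
  show ?thesis
  proof (intro exI conjI)
    show "0 < C\<^sub>1" by (rule C1_pos)
    show "\<forall>k\<ge>1. 0 < D k" using D_pos by simp
    show "\<forall>k\<ge>1. \<forall>\<mu>\<in>space (prob_algebra E). integrable \<mu> \<psi> \<longrightarrow>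
        (\<forall>f\<in>unit_bounded E. (\<integral>x. f x \<partial>\<beta>) = 0 \<longrightarrow>
          (\<forall>t>0. \<bar>(\<integral>\<omega>. 1 / t ^ k * time_integral X f t \<omega> ^ (2 * k) \<partial>(\<mu> \<bind> Q))
                - fact (2 * k) / fact k * (asymptotic_variance X Q \<beta> f ^ k / 2 ^ k)\<bar>
            \<le> fact (2 * k) * D k * C\<^sub>1 * (real k / fact (k - 1)) * ((\<integral>x. \<psi> x \<partial>\<mu>) / t)))"
      by (rule even)
    show "\<forall>k::nat. \<forall>\<mu>\<in>space (prob_algebra E). integrable \<mu> \<psi> \<longrightarrow>
      (\<forall>f\<in>unit_bounded E. (\<integral>x. f x \<partial>\<beta>) = 0 \<longrightarrow>
        ((\<lambda>t. \<integral>\<omega>. 1 / (t ^ k * sqrt t) * time_integral X f t \<omega> ^ (2 * k + 1) \<partial>(\<mu> \<bind> Q))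
          \<longlongrightarrow> 0) at_top)"
      by (intro allI ballI impI ergodic_functional.odd_moment_tendsto[OF functional])
    show "\<forall>\<mu>\<in>space (prob_algebra E). integrable \<mu> \<psi> \<longrightarrow>
      (\<forall>f\<in>unit_bounded E. (\<integral>x. f x \<partial>\<beta>) = 0 \<longrightarrow> asymptotic_variance X Q \<beta> f > 0 \<longrightarrow>
        weak_conv_along at_top
          (\<lambda>t. distr (\<mu> \<bind> Q) borel (\<lambda>\<omega>. 1 / sqrt t * time_integral X f t \<omega>))
          (density lborel (normal_density 0 (sqrt (asymptotic_variance X Q \<beta> f)))))"
      by (intro allI ballI impI ergodic_functional.central_limit_theorem[OF functional])
  next
    show "let D = (\<lambda>k::nat. max ((C / \<gamma> * (1 + (\<integral>x. \<psi> x \<partial>\<beta>) / c)) ^ (k - 1)) 1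
                * max (C\<^sup>2 / c) (C * (\<integral>x. \<psi> x \<partial>\<beta>) / (c\<^sup>2 * \<gamma>)))
     in (\<forall>k\<ge>1. D k > 0) \<and>
      (\<forall>k\<ge>1. \<forall>\<mu>\<in>space (prob_algebra E). integrable \<mu> \<psi> \<longrightarrow>
        (\<forall>f\<in>unit_bounded E. (\<integral>x. f x \<partial>\<beta>) = 0 \<longrightarrow>
          (\<forall>t>0. \<bar>(\<integral>\<omega>. 1 / t ^ k * time_integral X f t \<omega> ^ (2 * k) \<partial>(\<mu> \<bind> Q))
                - fact (2 * k) / fact k * (asymptotic_variance X Q \<beta> f ^ k / 2 ^ k)\<bar>
            \<le> fact (2 * k) * D k * C\<^sub>1 * (real k / fact (k - 1)) * ((\<integral>x. \<psi> x \<partial>\<mu>) / t))))"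
      unfolding D_def[symmetric] Let_def using D_pos even by blast
  qed
qed

end
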